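(* Let $E,K$ be two bounded subsets of $\mathbb{R}^{N\times n}$ and let, for $\delta>0$, $E_\delta,K_\delta\subset\mathbb{R}^{N\times n}$ be sets verifying the following conditions: (i) for every $\varepsilon>0$ there exists $\delta_0>0$ such that $\mathrm{dist}(\eta;E)\le\varepsilon$ for all $\eta\in E_\delta$ and all $\delta\in(0,\delta_0]$; (ii) for every $\eta\in\operatorname{int}K$ there exists $\delta_0>0$ such that $\eta\in K_\delta$ for all $\delta\in(0,\delta_0]$; (iii) for every $\delta>0$ and every $\xi\in K_\delta$ there exist $I\in\mathbb{N}$ and $(\lambda_i,\xi_i)_{1\le i\le I}$ with $\lambda_i>0$, $\sum_{i=1}^I\lambda_i=1$, $\xi_i\in\mathbb{R}^{N\times n}$, satisfying $(H_I(\operatorname{int}K))$ and such that $$\xi=\sum_{i=1}^I\lambda_i\xi_i,\qquad \sum_{\substack{1\le i\le I\\ \xi_i\notin E_\delta}}\lambda_i<\delta.$$ Then $\operatorname{int}K$ has the relaxation property with respect to $E$.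
   Context: Property $(H_I(U))$: let $U\subset\mathbb{R}^{N\times n}$ and, for an integer $I\ge1$, let $\xi_i\in\mathbb{R}^{N\times n}$ and $\lambda_i>0$, $i=1,\dots,I$, with $\sum_{i=1}^I\lambda_i=1$. We say that $(\lambda_i,\xi_i)_{1\le i\le I}$ satisfy $(H_I(U))$ if (recursively): (i) in the case $I=1$, $\xi_1\in U$; (ii) in the case $I=2$, $\xi_1,\xi_2\in U$ and $\operatorname{rank}(\xi_1-\xi_2)=1$; (iii) in the case $I>2$, up to a permutation of the indices, $\xi_1,\xi_2\in U$, $\operatorname{rank}(\xi_1-\xi_2)=1$ and, defining $\mu_1=\lambda_1+\lambda_2$, $\eta_1=\frac{\lambda_1\xi_1+\lambda_2\xi_2}{\lambda_1+\lambda_2}$, and $\mu_i=\lambda_{i+1}$, $\eta_i=\xi_{i+1}$ for $2\le i\le I-1$, the family $(\mu_i,\eta_i)_{1\le i\le I-1}$ satisfies $(H_{I-1}(U))$. Relaxation property: for $E,K\subset\mathbb{R}^{N\times n}$, $K$ has the relaxation property with respect to $E$ if for every bounded open set $\Omega\subset\mathbb{R}^n$ and every affine function $u_\xi$ with constant gradient $Du_\xi=\xi\in K$, there exists a sequence $u_\nu\in Aff_{piec}(\overline\Omega;\mathbb{R}^N)$ such that $u_\nu\in u_\xi+W^{1,\infty}_0(\Omega;\mathbb{R}^N)$, $Du_\nu(x)\in E\cup K$ for a.e. $x\in\Omega$, $u_\nu\rightharpoonup u_\xi$ weakly* in $W^{1,\infty}(\Omega;\mathbb{R}^N)$, and $\lim_{\nu\to+\infty}\int_\Omega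 \mathrm{dist}(Du_\nu(x);E)\,dx=0$. Conventions: $\operatorname{int}$ denotes the interior in $\mathbb{R}^{N\times n}$. $Aff_{piec}(\overline\Omega;\mathbb{R}^N)$ is the set of piecewise affine maps, i.e. maps $u\in W^{1,\infty}(\Omega;\mathbb{R}^N)\cap C(\overline\Omega;\mathbb{R}^N)$ for which there are countably many disjoint open sets $\Omega_k\subset\Omega$ with $\operatorname{meas}(\Omega\setminus\bigcup_k\Omega_k)=0$ such that $u$ is affine (with constant gradient) on each $\Omega_k$. $W^{1,\infty}_0(\Omega;\mathbb{R}^N)=W^{1,\infty}(\Omega;\mathbb{R}^N)\cap W^{1,1}_0(\Omega;\mathbb{R}^N)$. *)

theory Defs
  imports "HOL-Analysis.Analysis"
begin

subsection \<open>Test functions\<close>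

text \<open>Continuous differentiability of order \<open>k\<close> on the whole space: all partial derivatives
  exist and are of class \<open>C\<^sup>k\<^sup>-\<^sup>1\<close>. Differentiability in the sense of Frechet is required at each
  stage, so that the values of \<^const>\<open>frechet_derivative\<close> are meaningful.\<close>

primrec Ck :: "nat \<Rightarrow> (real^'n \<Rightarrow> 'b::real_normed_vector) \<Rightarrow> bool" where
  "Ck 0 f \<longleftrightarrow> continuous_on UNIV f"
| "Ck (Suc k) f \<longleftrightarrow> (\<forall>x. f differentiable (at x)) \<and>
     (\<forall>j. Ck k (\<lambda>x. frechet_derivative f (at x) (axis j 1)))"

definition test_functions :: "(real^'n) set \<Rightarrow> (real^'n \<Rightarrow> 'b::real_normed_vector) set" where
  "test_functions \<Omega> = {\<phi>. (\<forall>k. Ck k \<phi>) \<and> compact (closure {x. \<phi> x \<noteq> 0}) \<and>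
     closure {x. \<phi> x \<noteq> 0} \<subseteq> \<Omega>}"

subsection \<open>Sobolev spaces\<close>

text \<open>Functions are total on the ambient space, but only their values on \<open>\<Omega>\<close> (on its closure, where
  continuity up to the boundary is concerned) matter. Weak gradients are determined only up to null
  sets, hence are treated as a relation. Entry \<open>(i, j)\<close> of the gradient is the \<open>j\<close>-th partial
  derivative of the \<open>i\<close>-th component.\<close>

definition has_weak_gradient ::
    "(real^'n) set \<Rightarrow> (real^'n \<Rightarrow> real^'m) \<Rightarrow> (real^'n \<Rightarrow> real^'n^'m) \<Rightarrow> bool" where
  "has_weak_gradient \<Omega> u Du \<longleftrightarrow>
     (\<forall>C. compact C \<and> C \<subseteq> \<Omega> \<longrightarrow> u absolutely_integrable_on C \<and> Du absolutely_integrable_on C) \<and>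
     (\<forall>\<phi> \<in> test_functions \<Omega>. \<forall>i j.
        (LINT x|lebesgue_on \<Omega>. u x $ i * frechet_derivative \<phi> (at x) (axis j 1)) =
        - (LINT x|lebesgue_on \<Omega>. Du x $ i $ j * \<phi> x))"

definition L_inf :: "(real^'n) set \<Rightarrow> (real^'n \<Rightarrow> 'b::euclidean_space) set" where
  "L_inf \<Omega> = {f. f \<in> borel_measurable (lebesgue_on \<Omega>) \<and>
     (\<exists>C. AE x in lebesgue_on \<Omega>. norm (f x) \<le> C)}"

definition W1_inf :: "(real^'n) set \<Rightarrow> (real^'n \<Rightarrow> real^'m) set" where
  "W1_inf \<Omega> = {u. u \<in> L_inf \<Omega> \<and> (\<exists>Du. has_weak_gradient \<Omega> u Du \<and> Du \<in> L_inf \<Omega>)}"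

text \<open>The closure of the test functions in \<open>W\<^sup>1\<^sup>,\<^sup>1(\<Omega>)\<close>.\<close>

definition W11_0 :: "(real^'n) set \<Rightarrow> (real^'n \<Rightarrow> real^'m) set" where
  "W11_0 \<Omega> = {u. \<exists>Du. has_weak_gradient \<Omega> u Du \<and>
     integrable (lebesgue_on \<Omega>) u \<and> integrable (lebesgue_on \<Omega>) Du \<and>
     (\<exists>\<phi>. (\<forall>k::nat. \<phi> k \<in> test_functions \<Omega>) \<and>
        (\<lambda>k. \<integral>\<^sup>+x. ennreal (norm (\<phi> k x - u x)) \<partial>lebesgue_on \<Omega>) \<longlonglongrightarrow> 0 \<and>
        (\<lambda>k. \<integral>\<^sup>+x. ennreal (norm (jacobian (\<phi> k) (at x) - Du x)) \<partial>lebesgue_on \<Omega>) \<longlonglongrightarrow> 0)}"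

definition W1_inf_0 :: "(real^'n) set \<Rightarrow> (real^'n \<Rightarrow> real^'m) set" where
  "W1_inf_0 \<Omega> = W1_inf \<Omega> \<inter> W11_0 \<Omega>"

definition weak_star_L_inf ::
    "(real^'n) set \<Rightarrow> (nat \<Rightarrow> real^'n \<Rightarrow> 'b::euclidean_space) \<Rightarrow> (real^'n \<Rightarrow> 'b) \<Rightarrow> bool" where
  "weak_star_L_inf \<Omega> f g \<longleftrightarrow> (\<forall>\<nu>. f \<nu> \<in> L_inf \<Omega>) \<and> g \<in> L_inf \<Omega> \<and>
     (\<forall>h. integrable (lebesgue_on \<Omega>) h \<longrightarrow>
        (\<lambda>\<nu>. LINT x|lebesgue_on \<Omega>. f \<nu> x \<bullet> h x) \<longlonglongrightarrow> (LINT x|lebesgue_on \<Omega>. g x \<bullet> h x))"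

text \<open>Weak* convergence in \<open>W\<^sup>1\<^sup>,\<^sup>\<infinity>\<close> means weak* convergence in \<open>L\<^sup>\<infinity>\<close> of the functions and of their
  gradients. The result does not depend on the representatives chosen for the gradients.\<close>

definition weak_star_W1_inf ::
    "(real^'n) set \<Rightarrow> (nat \<Rightarrow> real^'n \<Rightarrow> real^'m) \<Rightarrow> (real^'n \<Rightarrow> real^'m) \<Rightarrow> bool" where
  "weak_star_W1_inf \<Omega> u v \<longleftrightarrow> weak_star_L_inf \<Omega> u v \<and>
     (\<exists>Du Dv. (\<forall>\<nu>. has_weak_gradient \<Omega> (u \<nu>) (Du \<nu>)) \<and> has_weak_gradient \<Omega> v Dv \<and>
        weak_star_L_inf \<Omega> Du Dv)"

text \<open>The countable family is indexed by \<^typ>\<open>nat\<close>; finite families are padded with empty sets.\<close>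

definition Aff_piec :: "(real^'n) set \<Rightarrow> (real^'n \<Rightarrow> real^'m) set" where
  "Aff_piec \<Omega> = {u. u \<in> W1_inf \<Omega> \<and> continuous_on (closure \<Omega>) u \<and>
     (\<exists>\<Omega>k :: nat \<Rightarrow> (real^'n) set.
        (\<forall>k. open (\<Omega>k k) \<and> \<Omega>k k \<subseteq> \<Omega>) \<and> disjoint_family \<Omega>k \<and>
        negligible (\<Omega> - (\<Union>k. \<Omega>k k)) \<and>
        (\<forall>k. \<exists>A b. \<forall>x \<in> \<Omega>k k. u x = A *v x + b))}"

subsection \<open>The relaxation property and the condition \<open>H\<^sub>I(U)\<close>\<close>

text \<open>Unlike \<^const>\<open>infdist\<close>, this distance to the empty set is \<open>\<infinity>\<close> rather than \<open>0\<close>.\<close>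

definition dist_set :: "'a::metric_space \<Rightarrow> 'a set \<Rightarrow> ennreal" where
  "dist_set x E = (INF y\<in>E. ennreal (dist x y))"

definition relaxation_property :: "(real^'n^'m) set \<Rightarrow> (real^'n^'m) set \<Rightarrow> bool" where
  "relaxation_property K E \<longleftrightarrow>
     (\<forall>\<Omega> :: (real^'n) set. \<forall>\<xi> b. open \<Omega> \<and> bounded \<Omega> \<and> \<xi> \<in> K \<longrightarrow>
       (\<exists>(u :: nat \<Rightarrow> real^'n \<Rightarrow> real^'m) Du.
          (\<forall>\<nu>. u \<nu> \<in> Aff_piec \<Omega> \<and>
               (\<lambda>x. u \<nu> x - (\<xi> *v x + b)) \<in> W1_inf_0 \<Omega> \<and>
               has_weak_gradient \<Omega> (u \<nu>) (Du \<nu>) \<and>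
               (AE x in lebesgue_on \<Omega>. Du \<nu> x \<in> E \<union> K)) \<and>
          weak_star_W1_inf \<Omega> u (\<lambda>x. \<xi> *v x + b) \<and>
          (\<lambda>\<nu>. \<integral>\<^sup>+x. dist_set (Du \<nu> x) E \<partial>lebesgue_on \<Omega>) \<longlonglongrightarrow> 0))"

text \<open>\<open>H_cond U I l x\<close> is the condition \<open>H\<^sub>I(U)\<close> for the weights \<open>l i\<close> and matrices \<open>x i\<close> with
  \<open>1 \<le> i \<le> I\<close>; values at other indices are irrelevant. That the weights are positive and sum to
  \<open>1\<close> is a standing assumption, to be stated where the condition is used.\<close>

fun H_cond :: "(real^'n^'m) set \<Rightarrow> nat \<Rightarrow> (nat \<Rightarrow> real) \<Rightarrow> (nat \<Rightarrow> real^'n^'m) \<Rightarrow> bool" where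
  "H_cond U 0 l x \<longleftrightarrow> False"
| "H_cond U (Suc 0) l x \<longleftrightarrow> x 1 \<in> U"
| "H_cond U (Suc (Suc 0)) l x \<longleftrightarrow> x 1 \<in> U \<and> x 2 \<in> U \<and> rank (x 1 - x 2) = 1"
| "H_cond U (Suc (Suc (Suc k))) l x \<longleftrightarrow>
     (\<exists>p. p permutes {1..k + 3} \<and>
        x (p 1) \<in> U \<and> x (p 2) \<in> U \<and> rank (x (p 1) - x (p 2)) = 1 \<and>
        H_cond U (Suc (Suc k))
          (\<lambda>i. if i = 1 then l (p 1) + l (p 2) else l (p (i + 1)))
          (\<lambda>i. if i = 1 then (l (p 1) *\<^sub>R x (p 1) + l (p 2) *\<^sub>R x (p 2)) /\<^sub>R (l (p 1) + l (p 2))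
               else x (p (i + 1))))"

end

(* If A - B has rank one and xi = t A + (1 - t) B, a tent-shaped function on a
   polytope gives a compactly supported, piecewise affine perturbation of the affine map with gradient
   xi whose gradients are close to A or to B (not merely to the segment between them, which may leave
   int K); a Vitali covering carries it to every bounded open set.  Since the gradient of the
   perturbation has mean zero, the gradients near A occupy about the fraction t of the domain.
   Perturbing again on the pieces, this shows by induction on H_I that a barycentre of
   (lambda_i, xi_i) is approximated by maps with gradients in int K that lie near the xi_i with
   volume fractions close to lambda_i; nothing is needed of the intermediate barycentres.  As int K is
   open, a gradient eta near xi_i is dealt with by translating the construction by eta - xi_i.  All
   maps involved are Lipschitz and vanish off the domain after subtracting the affine map, which
   yields the W^{1,infinity}_0 and weak* statements by mollification and density. *)
theory Submission
  imports Defs "HOL-Computational_Algebra.Polynomial"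
begin

subsection \<open>Locally affine maps\<close>

text \<open>Everything is phrased through \<open>loc_affine\<close>, exact affinity near a point:
  the points whose local gradient belongs to a prescribed set form an open set, so gradients are
  pointwise objects and volume fractions need no choice of representative.

  The induction does not follow I separate volume fractions. One open set \<open>G\<close>, the
  \<epsilon>-neighbourhood of E, is fixed, and only the fraction of the domain with gradient in
  \<open>G\<close> is bounded from below. This number is 1 or 0 at each \<xi>_i, and a lamination
  averages it with the same weights as the matrices, so at the barycentre it is the total weight of
  the \<xi>_i in \<open>G\<close>.

  The obstacle is uniformity. A lamination step applies earlier ones on countably many open pieces
  of unknown shape, at gradients only near the intended ones; so one Lipschitz constant must serve
  all domains and a whole ball of gradients. The final sequence has no common Lipschitz bound of
  this kind; its gradients are bounded because K is.\<close>

definition loc_affine :: "(real^'n \<Rightarrow> real^'m) \<Rightarrow> real^'n \<Rightarrow> real^'n^'m \<Rightarrow> bool" where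
  "loc_affine u x M \<longleftrightarrow> (\<exists>b. \<forall>\<^sub>F y in nhds x. u y = M *v y + b)"

lemma loc_affine_has_derivative:
  assumes "loc_affine u x M"
  shows "(u has_derivative (*v) M) (at x)"
proof -
  obtain b where b: "\<forall>\<^sub>F y in nhds x. u y = M *v y + b"
    using assms unfolding loc_affine_def by blast
  have "((\<lambda>y. M *v y + b) has_derivative (*v) M) (at x)"
    by (auto intro!: derivative_eq_intros bounded_linear_imp_has_derivative
        matrix_vector_mul_bounded_linear)
  moreover have "\<forall>\<^sub>F y in at x. M *v y + b = u y"
    using b by (auto simp: eventually_at_filter elim: eventually_mono)
  ultimately show ?thesis
    using eventually_nhds_x_imp_x[OF b] has_derivative_transform_eventually by fastforce
qed

lemma loc_affine_unique:
  assumes "loc_affine u x M" "loc_affine u x N"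
  shows "M = N"
  using has_derivative_unique[OF loc_affine_has_derivative[OF assms(1)]
      loc_affine_has_derivative[OF assms(2)]] by (metis matrix_eq)

lemma loc_affine_add:
  assumes "loc_affine u x M" "loc_affine v x N"
  shows "loc_affine (\<lambda>y. u y + v y) x (M + N)"
proof -
  obtain b c where "\<forall>\<^sub>F y in nhds x. u y = M *v y + b" "\<forall>\<^sub>F y in nhds x. v y = N *v y + c"
    using assms unfolding loc_affine_def by blast
  then have "\<forall>\<^sub>F y in nhds x. u y + v y = (M + N) *v y + (b + c)"
    by eventually_elim (simp add: matrix_vector_mult_add_rdistrib)
  then show ?thesis unfolding loc_affine_def by blast
qed

lemma loc_affine_affine: "loc_affine (\<lambda>y. M *v y + b) x M"
  unfolding loc_affine_def by (auto intro: exI[of _ b])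

lemma loc_affine_cong:
  assumes "\<forall>\<^sub>F y in nhds x. u y = v y"
  shows "loc_affine u x M \<longleftrightarrow> loc_affine v x M"
proof -
  have "(\<forall>\<^sub>F y in nhds x. u y = M *v y + b) \<longleftrightarrow> (\<forall>\<^sub>F y in nhds x. v y = M *v y + b)" for b
    by (rule eventually_cong[OF eventually_mono[OF assms]]) auto
  then show ?thesis unfolding loc_affine_def by simp
qed

lemma loc_affine_cong_on:
  assumes "open U" "x \<in> U" "\<And>y. y \<in> U \<Longrightarrow> u y = v y"
  shows "loc_affine u x M \<longleftrightarrow> loc_affine v x M"
  by (rule loc_affine_cong) (use assms eventually_nhds in blast)

text \<open>An affine formula valid near x is valid, with the same matrix, near every point close to
  x. So \<open>S\<close> may be arbitrary, and every later set of points with a prescribed kind of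
  gradient is open, hence measurable.\<close>

lemma open_loc_affine: "open {x. \<exists>M\<in>S. loc_affine u x M}"
proof (subst open_subopen, clarify)
  fix x M assume M: "M \<in> S" "loc_affine u x M"
  then obtain b T where "open T" "x \<in> T" "\<forall>y\<in>T. u y = M *v y + b"
    unfolding loc_affine_def eventually_nhds by blast
  moreover from this have "loc_affine u y M" if "y \<in> T" for y
    unfolding loc_affine_def eventually_nhds using that by blast
  ultimately show "\<exists>T. open T \<and> x \<in> T \<and> T \<subseteq> {x. \<exists>M\<in>S. loc_affine u x M}"
    using M by blast
qed

text \<open>Total, with the junk value \<open>0\<close> where the map is not locally affine.\<close>

definition grad :: "(real^'n \<Rightarrow> real^'m) \<Rightarrow> real^'n \<Rightarrow> real^'n^'m" where
  "grad u x = (if \<exists>M. loc_affine u x M then THE M. loc_affine u x M else 0)"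

lemma grad_eq: "loc_affine u x M \<Longrightarrow> grad u x = M"
  unfolding grad_def using loc_affine_unique by (metis the_equality)

lemma grad_borel [measurable]:
  fixes u :: "real^'n \<Rightarrow> real^'m"
  shows "grad u \<in> borel_measurable borel"
proof (rule borel_measurableI)
  fix S :: "(real^'n^'m) set" assume "open S"
  let ?A = "\<lambda>S. {x. \<exists>M\<in>S. loc_affine u x M}"
  \<comment> \<open>The second part accounts for the default value 0 taken off the open set of local
    affinity.\<close>
  have "grad u -` S = ?A S \<union> (if 0 \<in> S then - ?A UNIV else {})"
  proof -
    have "grad u x \<in> S \<longleftrightarrow> (\<exists>M\<in>S. loc_affine u x M) \<or> 0 \<in> S \<and> (\<forall>M. \<not> loc_affine u x M)" for x
    proof (cases "\<exists>M. loc_affine u x M")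
      case True
      then obtain M where M: "loc_affine u x M" by blast
      show ?thesis unfolding grad_eq[OF M] using M loc_affine_unique[OF M] by blast
    next
      case False
      then have "grad u x = 0" unfolding grad_def by (rule if_not_P)
      then show ?thesis using False by metis
    qed
    then show ?thesis by (simp add: set_eq_iff)
  qed
  also have "\<dots> \<in> sets borel"
    using open_loc_affine[of S u] open_loc_affine[of UNIV u] by auto
  finally show "grad u -` S \<inter> space borel \<in> sets borel" by simp
qed

text \<open>The pieces are indexed by the pair (gradient, constant term), both of which are locally constant.\<close>

lemma affine_pieces:
  fixes u :: "real^'n \<Rightarrow> real^'m"
  assumes "open O'" "\<And>x. x \<in> O' \<Longrightarrow> \<exists>M. loc_affine u x M"
  obtains \<D> where "disjoint \<D>" "countable \<D>" "\<Union>\<D> = O'" "\<And>U. U \<in> \<D> \<Longrightarrow> open U"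
    "\<And>U. U \<in> \<D> \<Longrightarrow> \<exists>M b. \<forall>x\<in>U. u x = M *v x + b"
proof -
  define U where "U = (\<lambda>(M, b). {x\<in>O'. \<forall>\<^sub>F y in nhds x. u y = M *v y + b})"
  have op: "open (U p)" for p
  proof (cases p)
    case (Pair M b)
    have "open {x. \<forall>\<^sub>F y in nhds x. u y = M *v y + b}"
      by (subst open_subopen) (force simp: eventually_nhds)
    then show ?thesis unfolding U_def Pair prod.case
      using \<open>open O'\<close> by (simp add: Collect_conj_eq open_Int)
  qed
  have eq: "p = q" if "x \<in> U p" "x \<in> U q" for x p q
  proof -
    obtain M b N c where p: "p = (M, b)" "q = (N, c)" by (cases p, cases q)
    have 1: "\<forall>\<^sub>F y in nhds x. u y = M *v y + b" "\<forall>\<^sub>F y in nhds x. u y = N *v y + c"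
      using that by (auto simp: U_def p)
    have "M = N" by (rule loc_affine_unique[of u x]) (use 1 in \<open>auto simp: loc_affine_def\<close>)
    moreover have "b = c"
      using eventually_nhds_x_imp_x[OF 1(1)] eventually_nhds_x_imp_x[OF 1(2)] \<open>M = N\<close> by simp
    ultimately show ?thesis by (simp add: p)
  qed
  \<comment> \<open>Most of the uncountably many pairs have an empty piece, but all of these
    contribute the single member {} of \<open>range U\<close>; a disjoint family of open sets is
    then countable.\<close>
  have dis: "disjoint (range U)"
    unfolding disjoint_def using eq by blast
  show ?thesis
  proof (rule that[of "range U"])
    show "disjoint (range U)" by (rule dis)
    show "countable (range U)"
      by (rule countable_disjoint_open_subsets) (use op dis in auto)
    show "\<Union>(range U) = O'"
      using assms(2) unfolding U_def loc_affine_def by force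
    show "open V" if "V \<in> range U" for V using op that by auto
    show "\<exists>M b. \<forall>x\<in>V. u x = M *v x + b" if "V \<in> range U" for V
      using that eventually_nhds_x_imp_x unfolding U_def by force
  qed
qed

text \<open>If x and y lie in no common member, then the function belonging to x vanishes at y and
  conversely, so each of the two values has norm at most L times the distance. The triangle
  inequality costs a factor 2, whatever the number of members.\<close>

lemma lipschitz_glue:
  fixes W :: "'a::metric_space set \<Rightarrow> 'a \<Rightarrow> 'b::real_normed_vector"
  assumes dis: "disjoint \<D>"
    and lip: "\<And>U. U \<in> \<D> \<Longrightarrow> L-lipschitz_on UNIV (W U)"
    and off: "\<And>U x. U \<in> \<D> \<Longrightarrow> x \<notin> U \<Longrightarrow> W U x = 0" and "L \<ge> 0"
  obtains w where "(2 * L)-lipschitz_on UNIV w" "\<And>U x. U \<in> \<D> \<Longrightarrow> x \<in> U \<Longrightarrow> w x = W U x"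
    "\<And>x. x \<notin> \<Union>\<D> \<Longrightarrow> w x = 0"
proof -
  define w where "w x = (if x \<in> \<Union>\<D> then W (THE U. U \<in> \<D> \<and> x \<in> U) x else 0)" for x
  have w1: "w x = W U x" if "U \<in> \<D>" "x \<in> U" for U x
  proof -
    have "(THE U. U \<in> \<D> \<and> x \<in> U) = U"
      using that dis by (intro the_equality) (auto simp: disjoint_def)
    then show ?thesis using that unfolding w_def by auto
  qed
  have w0: "w x = 0" if "x \<notin> \<Union>\<D>" for x using that by (simp add: w_def)
  have W: "dist (W U x) (W U y) \<le> L * dist x y" if "U \<in> \<D>" for U x y
    using lip[OF that] by (auto dest: lipschitz_onD)
  have one: "norm (w x) \<le> L * dist x y" if "U \<in> \<D>" "x \<in> U" "y \<notin> U" for U x y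
    using W[OF that(1), of x y] off[of U y] w1[of U x] that by (simp add: dist_norm)
  have "dist (w x) (w y) \<le> 2 * L * dist x y" for x y
  proof -
    have nn: "0 \<le> L * dist x y" using \<open>L \<ge> 0\<close> by simp
    consider U where "U \<in> \<D>" "x \<in> U" "y \<in> U" | "\<forall>U\<in>\<D>. x \<in> U \<longrightarrow> y \<notin> U" by blast
    then show ?thesis
    proof cases
      case 1
      then show ?thesis using W[of U x y] nn w1[of U x] w1[of U y] by simp
    next
      case 2
      have "norm (w x) \<le> L * dist x y"
        using one[of _ x y] 2 w0[of x] nn by (cases "x \<in> \<Union>\<D>") auto
      moreover have "norm (w y) \<le> L * dist x y"
        using one[of _ y x] 2 w0[of y] nn by (cases "y \<in> \<Union>\<D>") (auto simp: dist_commute)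
      ultimately show ?thesis using norm_triangle_ineq4[of "w x" "w y"] by (simp add: dist_norm)
    qed
  qed
  then have "(2 * L)-lipschitz_on UNIV w" using \<open>L \<ge> 0\<close> by (auto intro: lipschitz_onI)
  with w1 w0 show ?thesis using that by blast
qed

subsection \<open>Mollifiers\<close>

text \<open>The one-variable smoothness from which the bump functions inherit \<open>Ck\<close>. The
  derivative is a witness instead of a chosen term, so the rules for sums, products and affine
  substitutions follow by supplying it.\<close>

primrec Ck_real :: "nat \<Rightarrow> (real \<Rightarrow> real) \<Rightarrow> bool" where
  "Ck_real 0 f \<longleftrightarrow> continuous_on UNIV f"
| "Ck_real (Suc k) f \<longleftrightarrow> (\<exists>f'. (\<forall>x. (f has_real_derivative f' x) (at x)) \<and> Ck_real k f')"

lemma Ck_real_SucI: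
  assumes "\<And>x. (f has_real_derivative f' x) (at x)" "Ck_real k f'"
  shows "Ck_real (Suc k) f"
  using assms by auto

lemma Ck_real_SucE:
  assumes "Ck_real (Suc k) f"
  obtains f' where "\<forall>x. (f has_real_derivative f' x) (at x)" "Ck_real k f'"
  using assms by auto

declare Ck_real.simps(2) [simp del]

lemma Ck_real_SucD: "Ck_real (Suc k) f \<Longrightarrow> Ck_real k f"
proof (induction k arbitrary: f)
  case 0
  then obtain f' where "\<forall>x. (f has_real_derivative f' x) (at x)" by (rule Ck_real_SucE)
  then have "isCont f x" for x using DERIV_isCont by blast
  then show ?case by (simp add: continuous_at_imp_continuous_on)
next
  case (Suc k)
  obtain f' where f': "\<forall>x. (f has_real_derivative f' x) (at x)" "Ck_real (Suc k) f'"
    using Suc.prems by (rule Ck_real_SucE)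
  show ?case by (rule Ck_real_SucI[OF f'(1)[rule_format] Suc.IH[OF f'(2)]])
qed

lemma Ck_real_const: "Ck_real k (\<lambda>x. c)"
proof (induction k arbitrary: c)
  case (Suc k)
  show ?case by (rule Ck_real_SucI[OF _ Suc.IH[of 0]]) simp
qed auto

lemma Ck_real_add: "Ck_real k f \<Longrightarrow> Ck_real k g \<Longrightarrow> Ck_real k (\<lambda>x. f x + g x)"
proof (induction k arbitrary: f g)
  case (Suc k)
  obtain f' where f': "\<forall>x. (f has_real_derivative f' x) (at x)" "Ck_real k f'"
    using Suc.prems(1) by (rule Ck_real_SucE)
  obtain g' where g': "\<forall>x. (g has_real_derivative g' x) (at x)" "Ck_real k g'"
    using Suc.prems(2) by (rule Ck_real_SucE)
  show ?case by (rule Ck_real_SucI[OF DERIV_add[OF f'(1)[rule_format] g'(1)[rule_format]] Suc.IH[OF f'(2) g'(2)]])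
qed (simp add: continuous_on_add)

lemma Ck_real_mult: "Ck_real k f \<Longrightarrow> Ck_real k g \<Longrightarrow> Ck_real k (\<lambda>x. f x * g x)"
proof (induction k arbitrary: f g)
  case (Suc k)
  obtain f' where f': "\<forall>x. (f has_real_derivative f' x) (at x)" "Ck_real k f'"
    using Suc.prems(1) by (rule Ck_real_SucE)
  obtain g' where g': "\<forall>x. (g has_real_derivative g' x) (at x)" "Ck_real k g'"
    using Suc.prems(2) by (rule Ck_real_SucE)
  have "Ck_real k (\<lambda>x. f' x * g x + g' x * f x)"
    by (rule Ck_real_add[OF Suc.IH[OF f'(2) Ck_real_SucD[OF Suc.prems(2)]] Suc.IH[OF g'(2) Ck_real_SucD[OF Suc.prems(1)]]])
  with DERIV_mult[OF f'(1)[rule_format] g'(1)[rule_format]] show ?case by (rule Ck_real_SucI)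
qed (simp add: continuous_on_mult)

lemma Ck_real_affine: "Ck_real k f \<Longrightarrow> Ck_real k (\<lambda>x. f (a + c * x))"
proof (induction k arbitrary: f)
  case 0
  then have "continuous_on UNIV f" by simp
  moreover have "continuous_on UNIV (\<lambda>x. a + c * x)" by (intro continuous_intros)
  ultimately show ?case unfolding Ck_real.simps by (rule continuous_on_compose2) auto
next
  case (Suc k)
  obtain f' where f': "\<forall>x. (f has_real_derivative f' x) (at x)" "Ck_real k f'"
    using Suc.prems(1) by (rule Ck_real_SucE)
  have "((\<lambda>x. f (a + c * x)) has_real_derivative f' (a + c * x) * c) (at x)" for x
    by (rule DERIV_chain2[OF f'(1)[rule_format]]) (auto intro!: derivative_eq_intros)
  moreover have "Ck_real k (\<lambda>x. f' (a + c * x) * c)"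
    by (rule Ck_real_mult[OF Suc.IH[OF f'(2)] Ck_real_const])
  ultimately show ?case by (rule Ck_real_SucI)
qed

text \<open>The functions p(1/s) exp(-1/s), continued by 0 to s \<le> 0. With the polynomial as a
  parameter the family is closed under differentiation: the derivative belongs to X^2 (p - p'),
  written \<open>[:0, 0, 1:] * (p - pderiv p)\<close>. Smoothness of all orders is then one
  induction.\<close>

definition exp_inv :: "real poly \<Rightarrow> real \<Rightarrow> real" where
  "exp_inv p s = (if s > 0 then poly p (1/s) * exp (- (1/s)) else 0)"

lemma tendsto_poly_times_exp_minus: "((\<lambda>x::real. poly p x * exp (-x)) \<longlongrightarrow> 0) at_top"
proof -
  have "poly p x * exp (-x) = (\<Sum>i\<le>degree p. coeff p i * (x ^ i / exp x))" for x :: real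
    by (simp add: poly_altdef sum_distrib_right exp_minus divide_simps)
  moreover have "((\<lambda>x::real. \<Sum>i\<le>degree p. coeff p i * (x ^ i / exp x)) \<longlongrightarrow> (\<Sum>i\<le>degree p. coeff p i * 0)) at_top"
    by (intro tendsto_intros tendsto_power_div_exp_0)
  ultimately show ?thesis by simp
qed

lemma exp_inv_deriv:
  "(exp_inv p has_real_derivative exp_inv ([:0, 0, 1:] * (p - pderiv p)) s) (at s)"
proof -
  consider "s > 0" | "s < 0" | "s = 0" by linarith
  then show ?thesis
  proof cases
    case 1
    have "((\<lambda>s. poly p (1/s) * exp (- (1/s))) has_real_derivative
       exp_inv ([:0, 0, 1:] * (p - pderiv p)) s) (at s)"
      unfolding exp_inv_def using 1
      by (auto intro!: derivative_eq_intros DERIV_chain2[OF poly_DERIV] simp: field_simps power2_eq_square)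
    moreover have "\<forall>\<^sub>F x in nhds s. exp_inv p x = poly p (1/x) * exp (- (1/x))"
      using eventually_nhds_in_open[of "{0<..}" s] 1
      by (auto elim!: eventually_mono simp: exp_inv_def)
    ultimately show ?thesis by (subst DERIV_cong_ev) auto
  next
    case 2
    have "\<forall>\<^sub>F x in nhds s. exp_inv p x = 0"
      using eventually_nhds_in_open[of "{..<0}" s] 2
      by (auto elim!: eventually_mono simp: exp_inv_def)
    then show ?thesis using 2 by (subst DERIV_cong_ev[OF refl _ refl]) (auto simp: exp_inv_def)
  next
    case 3
    have "((\<lambda>s. exp_inv p s / s) \<longlongrightarrow> 0) (at_right 0)"
    proof -
      \<comment> \<open>Dividing by s amounts to multiplying p by X, hence \<open>pCons 0 p\<close>;
        the substitution 1/s turns the limit at 0 into polynomial growth against exponential decay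
        at infinity.\<close>
      have "((\<lambda>s::real. poly (pCons 0 p) (inverse s) * exp (- inverse s)) \<longlongrightarrow> 0) (at_right 0)"
        by (rule filterlim_compose[OF tendsto_poly_times_exp_minus filterlim_inverse_at_top_right])
      moreover have "\<forall>\<^sub>F s::real in at_right 0. poly (pCons 0 p) (inverse s) * exp (- inverse s) = exp_inv p s / s"
        by (auto simp: eventually_at_filter exp_inv_def field_simps intro!: always_eventually)
      ultimately show ?thesis by (rule Lim_transform_eventually)
    qed
    moreover have "((\<lambda>s. exp_inv p s / s) \<longlongrightarrow> 0) (at_left 0)"
      by (rule Lim_transform_eventually[OF tendsto_const])
         (auto simp: eventually_at_filter exp_inv_def intro!: always_eventually)
    ultimately have "((\<lambda>s. exp_inv p s / s) \<longlongrightarrow> 0) (at 0)"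
      using filterlim_split_at by blast
    then show ?thesis by (simp add: 3 has_field_derivative_iff exp_inv_def)
  qed
qed

lemma Ck_real_exp_inv: "Ck_real k (exp_inv p)"
proof (induction k arbitrary: p)
  case 0
  have "isCont (exp_inv p) x" for x by (rule DERIV_isCont[OF exp_inv_deriv])
  then show ?case by (simp add: continuous_at_imp_continuous_on)
next
  case (Suc k)
  show ?case by (rule Ck_real_SucI[OF exp_inv_deriv Suc.IH])
qed

lemma bump_real:
  assumes "e > 0"
  obtains g :: "real \<Rightarrow> real" where "\<And>k. Ck_real k g" "\<And>s. g s \<ge> 0" "g 0 > 0" "\<And>s. \<bar>s\<bar> \<ge> e \<Longrightarrow> g s = 0"
proof (rule that)
  \<comment> \<open>One factor is positive exactly for s > -e, the other exactly for s < e.\<close>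
  let ?g = "\<lambda>s. exp_inv 1 (e + 1 * s) * exp_inv 1 (e + (-1) * s)"
  show "Ck_real k ?g" for k
    by (rule Ck_real_mult[OF Ck_real_affine[OF Ck_real_exp_inv] Ck_real_affine[OF Ck_real_exp_inv]])
qed (use assms in \<open>auto simp: exp_inv_def\<close>)

lemma frechet_derivative_axis_eq:
  "(f has_derivative f') (at x) \<Longrightarrow> frechet_derivative f (at x) (axis j 1) = f' (axis j 1)"
  by (simp add: frechet_derivative_at[symmetric])

lemma Ck_continuous: "Ck k f \<Longrightarrow> continuous_on UNIV f"
  by (cases k) (auto intro!: differentiable_imp_continuous_on simp: differentiable_on_def)

text \<open>Partial derivatives of a product of one-variable functions are again such products, so no product
  rule for \<^const>\<open>Ck\<close> is needed.\<close>

lemma Ck_prod: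
  fixes g :: "'n::finite \<Rightarrow> real \<Rightarrow> real"
  shows "(\<And>i. Ck_real k (g i)) \<Longrightarrow> Ck k (\<lambda>x::real^'n. \<Prod>i\<in>UNIV. g i (x $ i))"
proof (induction k arbitrary: g)
  case 0
  then have "continuous_on UNIV (g i)" for i by simp
  then show ?case unfolding Ck.simps
    by (intro continuous_on_prod continuous_on_compose2[of UNIV "g _" UNIV "\<lambda>x. x $ _"]
        continuous_on_component continuous_on_id) auto
next
  case (Suc k)
  from Suc.prems have "\<forall>i. \<exists>f'. (\<forall>x. (g i has_real_derivative f' x) (at x)) \<and> Ck_real k f'"
    by (simp add: Ck_real.simps(2))
  then obtain g' where g': "\<And>i x. (g i has_real_derivative g' i x) (at x)" "\<And>i. Ck_real k (g' i)"
    by metis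
  have comp: "((\<lambda>x::real^'n. g i (x $ i)) has_derivative (\<lambda>h. g' i (x $ i) * h $ i)) (at x)" for x i
    using has_derivative_compose[of "\<lambda>x. x $ i" "\<lambda>x. x $ i" x UNIV "g i" "(*) (g' i (x $ i))"]
      g'(1)[of i "x $ i"]
    by (auto simp: has_field_derivative_def bounded_linear_imp_has_derivative bounded_linear_vec_nth)
  have d: "((\<lambda>x::real^'n. \<Prod>i\<in>UNIV. g i (x $ i)) has_derivative
     (\<lambda>h. \<Sum>i\<in>UNIV. (g' i (x $ i) * h $ i) * (\<Prod>j\<in>UNIV - {i}. g j (x $ j)))) (at x)" for x
    by (rule has_derivative_prod) (rule comp)
  have "frechet_derivative (\<lambda>x::real^'n. \<Prod>i\<in>UNIV. g i (x $ i)) (at x) (axis j 1) =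
     (\<Prod>i\<in>UNIV. (if i = j then g' i else g i) (x $ i))" for x j
  proof -
    have "frechet_derivative (\<lambda>x::real^'n. \<Prod>i\<in>UNIV. g i (x $ i)) (at x) (axis j 1) =
      (\<Sum>i\<in>UNIV. (g' i (x $ i) * axis j 1 $ i) * (\<Prod>j\<in>UNIV - {i}. g j (x $ j)))"
      by (rule frechet_derivative_axis_eq[OF d])
    also have "\<dots> = (\<Sum>i\<in>UNIV. if i = j then g' j (x $ j) * (\<Prod>i\<in>UNIV - {j}. g i (x $ i)) else 0)"
      by (rule sum.cong) (auto simp: axis_def)
    also have "\<dots> = (\<Prod>i\<in>UNIV. (if i = j then g' i else g i) (x $ i))"
      by (subst (2) prod.remove[of _ j]) (auto intro: prod.cong)
    finally show ?thesis .
  qed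
  moreover have "Ck k (\<lambda>x::real^'n. \<Prod>i\<in>UNIV. (if i = j then g' i else g i) (x $ i))" for j
    by (rule Suc.IH) (use g'(2) Ck_real_SucD[OF Suc.prems] in auto)
  moreover have "(\<lambda>x::real^'n. \<Prod>i\<in>UNIV. g i (x $ i)) differentiable (at x)" for x
    using d differentiableI by blast
  ultimately show ?case by simp
qed

lemma Ck_cmult:
  fixes f :: "real^'n \<Rightarrow> real"
  shows "Ck k f \<Longrightarrow> Ck k (\<lambda>x. c * f x)"
proof (induction k arbitrary: f)
  case (Suc k)
  have d: "(f has_derivative frechet_derivative f (at x)) (at x)" for x
    using Suc.prems by (simp add: frechet_derivative_works)
  have d': "((\<lambda>x. c * f x) has_derivative (\<lambda>h. c * frechet_derivative f (at x) h)) (at x)" for x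
    by (rule has_derivative_mult_right[OF d])
  have "frechet_derivative (\<lambda>x. c * f x) (at x) (axis j 1) = c * frechet_derivative f (at x) (axis j 1)" for x j
    by (rule frechet_derivative_axis_eq[OF d'])
  with Suc d' show ?case by (auto simp: differentiable_def)
qed (auto intro: continuous_intros)

lemma mollifier:
  assumes "e > 0"
  obtains \<rho> :: "real^'n \<Rightarrow> real" where "\<And>k. Ck k \<rho>" "\<And>x. \<rho> x \<ge> 0" "\<And>x. \<rho> x \<noteq> 0 \<Longrightarrow> norm x < e"
    "integrable lborel \<rho>" "(LINT x|lborel. \<rho> x) = 1"
proof -
  \<comment> \<open>Coordinates below e / CARD('n) in absolute value keep the l1 norm, hence the
    Euclidean norm, below e.\<close>
  define e' where "e' = e / CARD('n)"
  have "e' > 0" using assms by (simp add: e'_def)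
  obtain g where g: "\<And>k. Ck_real k g" "\<And>s. g s \<ge> 0" "g 0 > 0" "\<And>s. \<bar>s\<bar> \<ge> e' \<Longrightarrow> g s = 0"
    using bump_real[OF \<open>e' > 0\<close>] by blast
  define G where "G x = (\<Prod>i\<in>UNIV. g (x $ i))" for x :: "real^'n"
  have CG: "Ck k G" for k unfolding G_def by (rule Ck_prod) (rule g)
  have G0: "G x \<ge> 0" for x unfolding G_def by (intro prod_nonneg) (auto simp: g)
  have Gs: "norm x < e" if "G x \<noteq> 0" for x
  proof -
    have "g (x $ i) \<noteq> 0" for i using that by (simp add: G_def)
    then have "\<bar>x $ i\<bar> < e'" for i using g(4) not_le by blast
    then have "(\<Sum>i\<in>UNIV. \<bar>x $ i\<bar>) < (\<Sum>i\<in>(UNIV::'n set). e')" by (intro sum_strict_mono) auto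
    then show ?thesis using norm_le_l1_cart[of x] by (simp add: e'_def)
  qed
  have contG: "continuous_on UNIV G" using CG[of 0] by simp
  have int: "integrable lborel G"
  proof -
    have "integrable lborel (\<lambda>x. indicator (cball 0 e) x *\<^sub>R G x)"
      using borel_integrable_compact[of "cball 0 e" G] continuous_on_subset[OF contG]
      by (auto simp: set_integrable_def)
    moreover have "indicator (cball 0 e) x *\<^sub>R G x = G x" for x
      using Gs[of x] by (cases "G x = 0") (auto simp: indicator_def)
    then have "(\<lambda>x. indicator (cball 0 e) x *\<^sub>R G x) = G" by blast
    ultimately show ?thesis by simp
  qed
  define c where "c = (LINT x|lborel. G x)"
  \<comment> \<open>A vanishing integral would make the nonnegative continuous G zero almost
    everywhere, although it is positive near 0.\<close>
  have "c \<noteq> 0"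
  proof
    assume "c = 0"
    then have "AE x in lborel. G x = 0"
      unfolding c_def using integral_nonneg_eq_0_iff_AE[OF int] G0 by auto
    then obtain N where N: "{x. G x \<noteq> 0} \<subseteq> N" "N \<in> null_sets lborel"
      by (auto elim!: AE_E simp: null_sets_def)
    have "negligible N"
      unfolding negligible_iff_null_sets using N(2) by (rule null_sets_completionI)
    then have "negligible {x. G x \<noteq> 0}" using N(1) negligible_subset by blast
    moreover have "open {x. G x \<noteq> 0}"
      using contG by (intro open_Collect_neq continuous_intros) auto
    moreover have "0 \<in> {x. G x \<noteq> 0}" using g(3) by (simp add: G_def)
    ultimately show False using open_not_negligible by blast
  qed
  moreover have "c \<ge> 0" unfolding c_def using G0 by simp
  ultimately have "c > 0" by simp
  show ?thesis
  proof (rule that[of "\<lambda>x. (1/c) * G x"])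
    show "integrable lborel (\<lambda>x. (1/c) * G x)" by (rule integrable_mult_right[OF int])
    show "(LINT x|lborel. (1/c) * G x) = 1"
      using int \<open>c > 0\<close> by (simp add: c_def[symmetric])
    show "Ck k (\<lambda>x. (1/c) * G x)" for k by (rule Ck_cmult[OF CG])
    show "0 \<le> (1/c) * G x" for x using G0[of x] \<open>c > 0\<close> by simp
    show "norm x < e" if "(1/c) * G x \<noteq> 0" for x using Gs[of x] that by simp
  qed
qed

text \<open>All derivatives fall on \<rho>. The induction varies \<rho>, because a partial
  derivative of the integral is the same integral with a partial derivative of \<rho>. The domain is
  a box so that differentiation under the integral sign applies.\<close>

lemma Ck_convolution:
  fixes v :: "real^'n \<Rightarrow> real^'m"
  assumes v: "continuous_on UNIV v"
  shows "Ck k \<rho> \<Longrightarrow> Ck k (\<lambda>x. integral (cbox a b) (\<lambda>y. \<rho> (x - y) *\<^sub>R v y))"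
proof (induction k arbitrary: \<rho>)
  case 0
  then have \<rho>: "continuous_on UNIV \<rho>" by simp
  have "continuous_on (UNIV \<times> cbox a b) (\<lambda>(x, y). \<rho> (x - y) *\<^sub>R v y)"
    unfolding split_beta
    by (intro continuous_on_scaleR continuous_on_compose2[OF v] continuous_on_compose2[OF \<rho>]
        continuous_intros) auto
  from integral_continuous_on_param[OF this] show ?case by simp
next
  case (Suc k)
  let ?d = "\<lambda>x. frechet_derivative \<rho> (at x)"
  let ?D = "\<lambda>x t. Blinfun (\<lambda>h. ?d (x - t) h *\<^sub>R v t)"
  have d: "(\<rho> has_derivative ?d x) (at x)" for x
    using Suc.prems by (simp add: frechet_derivative_works)
  have bl: "bounded_linear (\<lambda>h. ?d (x - t) h *\<^sub>R v t)" for x t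
    by (intro bounded_linear_scaleR_const has_derivative_bounded_linear[OF d])
  have ap: "blinfun_apply (?D x t) = (\<lambda>h. ?d (x - t) h *\<^sub>R v t)" for x t
    by (rule bounded_linear_Blinfun_apply[OF bl])
  have cd: "continuous_on UNIV (\<lambda>x. ?d x (axis j 1))" for j
    using Suc.prems Ck_continuous by auto
  \<comment> \<open>Norm continuity of the operator-valued integrand reduces to its values on the
    unit vectors, which are partial derivatives of \<rho> times v.\<close>
  have cont: "continuous_on (UNIV \<times> cbox a b) (\<lambda>(x, t). ?D x t)"
  proof (rule continuous_on_blinfun_componentwise)
    fix i :: "real^'n" assume "i \<in> Basis"
    then obtain j where i: "i = axis j 1" by (auto simp: Basis_vec_def)
    show "continuous_on (UNIV \<times> cbox a b) (\<lambda>x. blinfun_apply (case x of (x, t) \<Rightarrow> ?D x t) i)"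
      unfolding i split_beta ap
      by (intro continuous_intros continuous_on_compose2[OF cd] continuous_on_compose2[OF v]) auto
  qed
  have der: "((\<lambda>x. integral (cbox a b) (\<lambda>y. \<rho> (x - y) *\<^sub>R v y)) has_derivative
     blinfun_apply (integral (cbox a b) (?D x))) (at x)" for x
  proof (rule leibniz_rule[where U = UNIV, OF _ _ cont])
    fix x t
    have "((\<lambda>x. \<rho> (x - t)) has_derivative (\<lambda>h. ?d (x - t) h)) (at x)"
      using has_derivative_compose[of "\<lambda>x. x - t" "\<lambda>h. h" x UNIV \<rho> "?d (x - t)"] d[of "x - t"]
      by (simp add: has_derivative_diff[OF has_derivative_ident has_derivative_const, simplified])
    then show "((\<lambda>x. \<rho> (x - t) *\<^sub>R v t) has_derivative blinfun_apply (?D x t)) (at x)"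
      unfolding ap by (rule has_derivative_scaleR_left)
  next
    fix x
    show "(\<lambda>y. \<rho> (x - y) *\<^sub>R v y) integrable_on cbox a b"
      by (intro integrable_continuous continuous_on_scaleR continuous_on_subset[OF v]
         continuous_on_compose2[OF Ck_continuous[OF Suc.prems]] continuous_intros) auto
  qed auto
  have "frechet_derivative (\<lambda>x. integral (cbox a b) (\<lambda>y. \<rho> (x - y) *\<^sub>R v y)) (at x) (axis j 1)
     = integral (cbox a b) (\<lambda>y. ?d (x - y) (axis j 1) *\<^sub>R v y)" for x j
  proof -
    have "continuous_on (cbox a b) (Pair x)" by (intro continuous_intros)
    then have "continuous_on (cbox a b) (?D x)"
      using continuous_on_compose2[OF cont, of "cbox a b" "Pair x"] by auto
    then have "?D x integrable_on cbox a b" by (rule integrable_continuous)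
    then have "blinfun_apply (integral (cbox a b) (?D x)) (axis j 1) =
        integral (cbox a b) (\<lambda>t. blinfun_apply (?D x t) (axis j 1))"
      by (rule blinfun_apply_integral)
    then show ?thesis unfolding frechet_derivative_axis_eq[OF der] ap .
  qed
  moreover have "Ck k (\<lambda>x. integral (cbox a b) (\<lambda>y. ?d (x - y) (axis j 1) *\<^sub>R v y))" for j
    by (rule Suc.IH) (use Suc.prems in auto)
  moreover have "(\<lambda>x. integral (cbox a b) (\<lambda>y. \<rho> (x - y) *\<^sub>R v y)) differentiable (at x)" for x
    using der differentiableI by blast
  ultimately show ?case by simp
qed

subsection \<open>Integration by parts\<close>

lemma integrable_continuous_bounded_support:
  fixes f :: "'a::euclidean_space \<Rightarrow> 'b::euclidean_space"
  assumes "continuous_on UNIV f" "\<And>x. norm x > R \<Longrightarrow> f x = 0"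
  shows "integrable lborel f"
proof -
  have "integrable lborel (\<lambda>x. indicator (cball 0 R) x *\<^sub>R f x)"
    by (rule borel_integrable_compact[OF compact_cball continuous_on_subset[OF assms(1) subset_UNIV]])
  moreover have "(\<lambda>x. indicator (cball 0 R) x *\<^sub>R f x) = f"
  proof
    fix x show "indicator (cball 0 R) x *\<^sub>R f x = f x"
      using assms(2)[of x] by (cases "norm x > R") auto
  qed
  ultimately show ?thesis by simp
qed

lemma lborel_integral_translate:
  fixes f :: "'a::euclidean_space \<Rightarrow> 'b::euclidean_space"
  assumes [measurable]: "f \<in> borel_measurable borel"
  shows "(LINT x|lborel. f (a + x)) = (LINT x|lborel. f x)"
proof -
  have "(LINT x|distr lborel borel ((+) a). f x) = (LINT x|lborel. f (a + x))"
    by (rule integral_distr) auto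
  then show ?thesis by (simp add: lborel_distr_plus)
qed

lemma lborel_distr_reflect:
  fixes a :: "'a::euclidean_space"
  shows "distr lborel borel (\<lambda>x. a - x) = lborel"
  by (subst (2) lborel_affine[of "-1" a]) (auto simp: density_1)

lemma lborel_integral_reflect:
  fixes f :: "'a::euclidean_space \<Rightarrow> 'b::euclidean_space"
  assumes [measurable]: "f \<in> borel_measurable borel"
  shows "(LINT x|lborel. f (a - x)) = (LINT x|lborel. f x)"
proof -
  have "(LINT x|distr lborel borel (\<lambda>x. a - x). f x) = (LINT x|lborel. f (a - x))"
    by (rule integral_distr) auto
  then show ?thesis by (simp add: lborel_distr_reflect)
qed

text \<open>The step lengths run through 1/(k + 1) so that dominated convergence can be applied to a
  sequence of quotients.\<close>

lemma difference_quotient_tendsto: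
  fixes f :: "'a::real_normed_vector \<Rightarrow> 'b::real_normed_vector"
  assumes "(f has_derivative f') (at x)"
  shows "(\<lambda>k. (f (x + inverse (real (Suc k)) *\<^sub>R e) - f x) /\<^sub>R inverse (real (Suc k))) \<longlonglongrightarrow> f' e"
proof -
  interpret bounded_linear f' by (rule has_derivative_bounded_linear[OF assms])
  have "((\<lambda>s. f (x + s *\<^sub>R e)) has_derivative (\<lambda>s. f' (s *\<^sub>R e))) (at 0)"
    by (rule has_derivative_compose[of "\<lambda>s. x + s *\<^sub>R e" "\<lambda>s. s *\<^sub>R e" 0 UNIV f f'])
       (use assms in \<open>auto intro!: derivative_eq_intros\<close>)
  then have "((\<lambda>s. f (x + s *\<^sub>R e)) has_vector_derivative f' e) (at 0)"
    by (simp add: has_vector_derivative_def scaleR)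
  then have l: "((\<lambda>s. norm (f (x + s *\<^sub>R e) - f x - s *\<^sub>R f' e) / norm s) \<longlongrightarrow> 0) (at 0)"
    by (simp add: has_vector_derivative_def has_derivative_iff_norm)
  have "norm (f (x + s *\<^sub>R e) - f x - s *\<^sub>R f' e) / norm s =
      norm ((f (x + s *\<^sub>R e) - f x) /\<^sub>R s - f' e)" if "s \<noteq> 0" for s
  proof -
    have "(f (x + s *\<^sub>R e) - f x) /\<^sub>R s - f' e = (f (x + s *\<^sub>R e) - f x - s *\<^sub>R f' e) /\<^sub>R s"
      using that by (simp add: scaleR_diff_right)
    then show ?thesis by (simp add: divide_inverse mult.commute)
  qed
  then have "((\<lambda>s. norm ((f (x + s *\<^sub>R e) - f x) /\<^sub>R s - f' e)) \<longlongrightarrow> 0) (at 0)"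
    by (intro Lim_transform_eventually[OF l]) (simp add: eventually_at_filter)
  then have "((\<lambda>s. (f (x + s *\<^sub>R e) - f x) /\<^sub>R s) \<longlongrightarrow> f' e) (at 0)"
    by (rule LIM_zero_cancel[OF tendsto_norm_zero_cancel])
  moreover have "filterlim (\<lambda>k. inverse (real (Suc k))) (at 0) sequentially"
    unfolding filterlim_at using LIMSEQ_inverse_real_of_nat by (auto intro!: always_eventually)
  ultimately show ?thesis by (rule filterlim_compose)
qed

text \<open>Translation invariance of the integral moves the difference quotient from h to \<phi>,
  where it converges. No derivative of h occurs, so the same limit serves both the bound by the
  Lipschitz constant of h and the formula for an almost everywhere differentiable h.\<close>

lemma integration_by_parts_limit:
  fixes \<phi> h :: "'a::euclidean_space \<Rightarrow> real" and e :: 'a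
  assumes \<phi>: "P-lipschitz_on UNIV \<phi>" "\<And>x. norm x > R \<Longrightarrow> \<phi> x = 0"
    and der: "\<And>x. (\<phi> has_derivative \<phi>' x) (at x)"
    and h: "continuous_on UNIV h"
  shows "(\<lambda>k. LINT x|lborel. \<phi> x * ((h (x - inverse (real (Suc k)) *\<^sub>R e) - h x) / inverse (real (Suc k))))
          \<longlonglongrightarrow> (LINT x|lborel. \<phi>' x e * h x)"
proof -
  define s where "s k = inverse (real (Suc k))" for k
  have s: "s k > 0" "s k \<le> 1" for k by (auto simp: s_def divide_simps)
  have c\<phi>: "continuous_on UNIV \<phi>" by (rule lipschitz_on_continuous_on[OF \<phi>(1)])
  have c\<phi>': "continuous_on UNIV (\<lambda>x. \<phi> (x + y))" for y
    by (rule continuous_on_compose2[OF c\<phi>]) (auto intro: continuous_intros)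
  have ch': "continuous_on UNIV (\<lambda>x. h (x - y))" for y
    by (rule continuous_on_compose2[OF h]) (auto intro: continuous_intros)
  have [measurable]: "\<phi> \<in> borel_measurable borel" "h \<in> borel_measurable borel"
    using c\<phi> h by (auto intro: borel_measurable_continuous_onI)
  let ?q = "\<lambda>k x. (\<phi> (x + s k *\<^sub>R e) - \<phi> x) /\<^sub>R s k"
  have eq: "(LINT x|lborel. \<phi> x * ((h (x - s k *\<^sub>R e) - h x) / s k)) = (LINT x|lborel. ?q k x * h x)" for k
  proof -
    have sup: "\<phi> (x + s k *\<^sub>R e) = 0" if "norm x > R + norm e" for x
    proof -
      have "norm (s k *\<^sub>R e) \<le> norm e" using s[of k] by (simp add: mult_left_le_one_le)
      then show ?thesis using that norm_diff_ineq[of x "s k *\<^sub>R e"] by (intro \<phi>(2)) linarith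
    qed
    have i1: "integrable lborel (\<lambda>x. \<phi> x * h (x - s k *\<^sub>R e))"
      by (rule integrable_continuous_bounded_support[where R = R])
         (use \<phi>(2) in \<open>auto intro!: continuous_on_mult c\<phi> ch'\<close>)
    have i2: "integrable lborel (\<lambda>x. \<phi> x * h x)"
      by (rule integrable_continuous_bounded_support[where R = R])
         (use \<phi>(2) in \<open>auto intro!: continuous_on_mult c\<phi> h\<close>)
    have i3: "integrable lborel (\<lambda>x. \<phi> (x + s k *\<^sub>R e) * h x)"
      by (rule integrable_continuous_bounded_support[where R = "R + norm e"])
         (use sup in \<open>auto intro!: continuous_on_mult c\<phi>' h\<close>)
    have "(LINT x|lborel. \<phi> x * ((h (x - s k *\<^sub>R e) - h x) / s k)) =
        ((LINT x|lborel. \<phi> x * h (x - s k *\<^sub>R e)) - (LINT x|lborel. \<phi> x * h x)) / s k"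
      using i1 i2 by (simp add: right_diff_distrib diff_divide_distrib)
    also have "(LINT x|lborel. \<phi> x * h (x - s k *\<^sub>R e)) = (LINT x|lborel. \<phi> (x + s k *\<^sub>R e) * h x)"
      using lborel_integral_translate[of "\<lambda>x. \<phi> x * h (x - s k *\<^sub>R e)" "s k *\<^sub>R e"]
      by (simp add: add.commute)
    also have "((LINT x|lborel. \<phi> (x + s k *\<^sub>R e) * h x) - (LINT x|lborel. \<phi> x * h x)) / s k =
        (LINT x|lborel. ?q k x * h x)"
      using i3 i2 by (simp add: left_diff_distrib field_simps)
    finally show ?thesis .
  qed
  have lim: "(\<lambda>k. ?q k x * h x) \<longlonglongrightarrow> \<phi>' x e * h x" for x
    unfolding s_def by (intro tendsto_mult difference_quotient_tendsto der tendsto_const)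
  have "(\<lambda>k. LINT x|lborel. ?q k x * h x) \<longlonglongrightarrow> (LINT x|lborel. \<phi>' x e * h x)"
  proof (rule integral_dominated_convergence)
    show "(\<lambda>x. \<phi>' x e * h x) \<in> borel_measurable lborel"
      by (rule borel_measurable_LIMSEQ_real[OF lim]) auto
    show "(\<lambda>x. ?q k x * h x) \<in> borel_measurable lborel" for k by auto
    show "AE x in lborel. (\<lambda>k. ?q k x * h x) \<longlonglongrightarrow> \<phi>' x e * h x" using lim by simp
    \<comment> \<open>The step lengths are at most 1, so a shifted support stays within distance
      \<open>norm e\<close> of the ball of radius R, and the quotient of \<phi> is at most
      \<open>P * norm e\<close>.\<close>
    let ?w = "\<lambda>x. indicator (cball 0 (R + norm e)) x *\<^sub>R (P * norm e * \<bar>h x\<bar>)"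
    show "integrable lborel ?w"
      by (rule borel_integrable_compact) (intro continuous_on_mult continuous_on_const continuous_on_rabs continuous_on_subset[OF h] compact_cball subset_UNIV)+
    show "AE x in lborel. norm (?q k x * h x) \<le> ?w x" for k
    proof (rule always_eventually, rule allI)
      fix x
      have P: "\<bar>\<phi> (x + s k *\<^sub>R e) - \<phi> x\<bar> \<le> P * (s k * norm e)"
        using lipschitz_onD[OF \<phi>(1), of "x + s k *\<^sub>R e" x] s[of k] by (simp add: dist_norm)
      show "norm (?q k x * h x) \<le> ?w x"
      proof (cases "norm x > R + norm e")
        case True
        have "norm (s k *\<^sub>R e) \<le> norm e" using s[of k] by (simp add: mult_left_le_one_le)
        then have "\<phi> (x + s k *\<^sub>R e) = 0"
          using True norm_diff_ineq[of x "s k *\<^sub>R e"] by (intro \<phi>(2)) linarith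
        moreover have "\<phi> x = 0" by (rule \<phi>(2)) (use True norm_ge_zero[of e] in linarith)
        ultimately show ?thesis using True by simp
      next
        case False
        have "\<bar>?q k x\<bar> \<le> P * norm e" using P s[of k] by (simp add: abs_mult field_simps)
        then show ?thesis using False by (simp add: abs_mult mult_right_mono)
      qed
    qed
  qed
  then show ?thesis unfolding eq[unfolded s_def] by (simp add: s_def)
qed

text \<open>Each difference quotient of h is bounded by \<open>H * norm e\<close> before the limit
  is taken. The right-hand side contains \<phi> but not its derivative: this is why gradients of
  uniformly small maps become negligible against Lipschitz weights.\<close>

lemma integral_deriv_lipschitz_bound:
  fixes \<phi> h :: "'a::euclidean_space \<Rightarrow> real" and e :: 'a
  assumes \<phi>: "P-lipschitz_on UNIV \<phi>" "\<And>x. norm x > R \<Longrightarrow> \<phi> x = 0"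
    and der: "\<And>x. (\<phi> has_derivative \<phi>' x) (at x)"
    and h: "H-lipschitz_on UNIV h"
  shows "\<bar>LINT x|lborel. \<phi>' x e * h x\<bar> \<le> H * norm e * (LINT x|lborel. \<bar>\<phi> x\<bar>)"
proof -
  have ch: "continuous_on UNIV h" by (rule lipschitz_on_continuous_on[OF h])
  have c\<phi>: "continuous_on UNIV \<phi>" by (rule lipschitz_on_continuous_on[OF \<phi>(1)])
  have i: "integrable lborel (\<lambda>x. \<bar>\<phi> x\<bar>)"
    by (rule integrable_continuous_bounded_support[where R = R])
       (simp_all add: \<phi>(2) continuous_on_rabs[OF c\<phi>])
  have H: "H * norm e * \<bar>\<phi> x\<bar> \<ge> 0" for x using lipschitz_on_nonneg[OF h] by simp
  note lim = integration_by_parts_limit[OF \<phi> der ch, where e = e]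
  have "\<bar>LINT x|lborel. \<phi> x * ((h (x - s *\<^sub>R e) - h x) / s)\<bar> \<le> H * norm e * (LINT x|lborel. \<bar>\<phi> x\<bar>)"
    if "s > 0" for s
  proof -
    have *: "\<bar>\<phi> x * ((h (x - s *\<^sub>R e) - h x) / s)\<bar> \<le> H * norm e * \<bar>\<phi> x\<bar>" for x
    proof -
      have "\<bar>h (x - s *\<^sub>R e) - h x\<bar> \<le> H * (s * norm e)"
        using lipschitz_onD[OF h, of "x - s *\<^sub>R e" x] that by (simp add: dist_norm)
      then have "\<bar>(h (x - s *\<^sub>R e) - h x) / s\<bar> \<le> H * norm e"
        using that by (simp add: abs_mult field_simps)
      from mult_left_mono[OF this abs_ge_zero[of "\<phi> x"]] show ?thesis
        by (simp only: abs_mult mult.commute)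
    qed
    have "\<bar>LINT x|lborel. \<phi> x * ((h (x - s *\<^sub>R e) - h x) / s)\<bar> \<le> (LINT x|lborel. H * norm e * \<bar>\<phi> x\<bar>)"
      by (rule integral_abs_bound[THEN order_trans], rule integral_mono_AE')
         (use * i H in \<open>auto intro!: integrable_mult_right\<close>)
    then show ?thesis using i by simp
  qed
  then show ?thesis by (intro LIMSEQ_le_const2[OF tendsto_rabs[OF lim]]) auto
qed

text \<open>The Lipschitz bound on h dominates its difference quotients, and their pointwise limit
  is the derivative almost everywhere that \<phi> does not vanish; the backward shift produces the
  minus sign.\<close>

lemma integration_by_parts_lipschitz:
  fixes \<phi> h :: "'a::euclidean_space \<Rightarrow> real" and e :: 'a
  assumes \<phi>: "P-lipschitz_on UNIV \<phi>" "\<And>x. norm x > R \<Longrightarrow> \<phi> x = 0"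
    and der: "\<And>x. (\<phi> has_derivative \<phi>' x) (at x)"
    and h: "H-lipschitz_on UNIV h"
    and hder: "AE x in lborel. \<phi> x \<noteq> 0 \<longrightarrow> (h has_derivative h' x) (at x)"
    and meas [measurable]: "(\<lambda>x. h' x e) \<in> borel_measurable borel"
  shows "(LINT x|lborel. \<phi>' x e * h x) = - (LINT x|lborel. \<phi> x * h' x e)"
proof -
  have ch: "continuous_on UNIV h" by (rule lipschitz_on_continuous_on[OF h])
  have c\<phi>: "continuous_on UNIV \<phi>" by (rule lipschitz_on_continuous_on[OF \<phi>(1)])
  have [measurable]: "\<phi> \<in> borel_measurable borel" "h \<in> borel_measurable borel"
    using c\<phi> ch by (auto intro: borel_measurable_continuous_onI)
  have i: "integrable lborel (\<lambda>x. \<bar>\<phi> x\<bar>)"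
    by (rule integrable_continuous_bounded_support[where R = R])
       (simp_all add: \<phi>(2) continuous_on_rabs[OF c\<phi>])
  let ?s = "\<lambda>k. inverse (real (Suc k))"
  have "(\<lambda>k. LINT x|lborel. \<phi> x * ((h (x - ?s k *\<^sub>R e) - h x) / ?s k)) \<longlonglongrightarrow> (LINT x|lborel. \<phi> x * (- h' x e))"
  proof (rule integral_dominated_convergence)
    show "integrable lborel (\<lambda>x. H * norm e * \<bar>\<phi> x\<bar>)" using i by (rule integrable_mult_right)
    show "AE x in lborel. norm (\<phi> x * ((h (x - ?s k *\<^sub>R e) - h x) / ?s k)) \<le> H * norm e * \<bar>\<phi> x\<bar>" for k
    proof (rule always_eventually, rule allI)
      fix x
      have *: "\<bar>(h (x - s *\<^sub>R e) - h x) / s\<bar> \<le> H * norm e" if "s > 0" for s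
        using lipschitz_onD[OF h, of "x - s *\<^sub>R e" x] that by (simp add: dist_norm field_simps)
      have "\<bar>(h (x - ?s k *\<^sub>R e) - h x) / ?s k\<bar> \<le> H * norm e" by (rule *) simp
      from mult_left_mono[OF this abs_ge_zero[of "\<phi> x"]]
      show "norm (\<phi> x * ((h (x - ?s k *\<^sub>R e) - h x) / ?s k)) \<le> H * norm e * \<bar>\<phi> x\<bar>"
        by (simp only: abs_mult mult.commute real_norm_def)
    qed
    show "AE x in lborel. (\<lambda>k. \<phi> x * ((h (x - ?s k *\<^sub>R e) - h x) / ?s k)) \<longlonglongrightarrow> \<phi> x * (- h' x e)"
      using hder
    proof eventually_elim
      case (elim x)
      show ?case
      proof (cases "\<phi> x = 0")
        case False
        with elim have d: "(h has_derivative h' x) (at x)" by simp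
        have "h' x (- e) = - h' x e"
          using has_derivative_bounded_linear[OF d] by (simp add: linear_simps)
        then have "(\<lambda>k. (h (x - ?s k *\<^sub>R e) - h x) / ?s k) \<longlonglongrightarrow> - h' x e"
          using difference_quotient_tendsto[OF d, of "- e"] by (simp add: divide_inverse mult.commute)
        then show ?thesis by (intro tendsto_mult tendsto_const)
      qed simp
    qed
  qed auto
  from LIMSEQ_unique[OF integration_by_parts_limit[OF \<phi> der ch, where e = e] this]
  show ?thesis by simp
qed

subsection \<open>Mollification and test functions\<close>

text \<open>V is an average of translates of v with weights of total mass 1, so it keeps the
  Lipschitz constant and stays within L \<epsilon> of v. The average of translates of an affine map
  is affine with the same matrix and another constant; hence at depth more than \<epsilon> inside an
  affine region the gradient is preserved exactly, not just approximately.\<close>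

lemma mollification:
  fixes v :: "real^'n \<Rightarrow> real^'m"
  assumes lip: "L-lipschitz_on UNIV v" and sup: "\<And>x. norm x > R \<Longrightarrow> v x = 0" and "\<epsilon> > 0"
  obtains V where "\<And>k. Ck k V" "L-lipschitz_on UNIV V" "\<And>x. norm (V x - v x) \<le> L * \<epsilon>"
    "\<And>x. V x \<noteq> 0 \<Longrightarrow> \<exists>y. dist x y < \<epsilon> \<and> v y \<noteq> 0"
    "\<And>x r M b. (\<And>y. y \<in> ball x r \<Longrightarrow> v y = M *v y + b) \<Longrightarrow> \<epsilon> < r \<Longrightarrow> loc_affine V x M"
proof -
  obtain \<rho> :: "real^'n \<Rightarrow> real" where \<rho>: "\<And>k. Ck k \<rho>" "\<And>x. \<rho> x \<ge> 0" "\<And>x. \<rho> x \<noteq> 0 \<Longrightarrow> norm x < \<epsilon>"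
    "integrable lborel \<rho>" "(LINT x|lborel. \<rho> x) = 1"
    using mollifier[OF \<open>\<epsilon> > 0\<close>] by metis
  have L: "L \<ge> 0" by (rule lipschitz_on_nonneg[OF lip])
  have c\<rho>: "continuous_on UNIV \<rho>" using \<rho>(1)[of 0] by simp
  have cv: "continuous_on UNIV v" by (rule lipschitz_on_continuous_on[OF lip])
  have cv': "continuous_on UNIV (\<lambda>z. v (x - z))" for x
    by (rule continuous_on_compose2[OF cv]) (auto intro: continuous_intros)
  have v: "norm (v x - v y) \<le> L * norm (x - y)" for x y
    using lipschitz_onD[OF lip, of x y] by (simp add: dist_norm)
  have int: "integrable lborel (\<lambda>z. \<rho> z *\<^sub>R g z)" if "continuous_on UNIV g" for g :: "real^'n \<Rightarrow> real^'m"
  proof (rule integrable_continuous_bounded_support[where R = \<epsilon>])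
    show "continuous_on UNIV (\<lambda>z. \<rho> z *\<^sub>R g z)" by (rule continuous_on_scaleR[OF c\<rho> that])
    show "\<rho> x *\<^sub>R g x = 0" if "norm x > \<epsilon>" for x using \<rho>(3)[of x] that by auto
  qed
  have bound: "norm (LINT z|lborel. \<rho> z *\<^sub>R g z) \<le> C"
    if "continuous_on UNIV g" "\<And>z. norm z < \<epsilon> \<Longrightarrow> norm (g z) \<le> C" for g :: "real^'n \<Rightarrow> real^'m" and C
  proof -
    have "norm (LINT z|lborel. \<rho> z *\<^sub>R g z) \<le> (LINT z|lborel. norm (\<rho> z *\<^sub>R g z))"
      by (rule integral_norm_bound)
    also have "\<dots> \<le> (LINT z|lborel. \<rho> z * C)"
    proof (rule integral_mono)
      show "integrable lborel (\<lambda>z. norm (\<rho> z *\<^sub>R g z))" using int[OF that(1)] by (rule integrable_norm)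
      show "integrable lborel (\<lambda>z. \<rho> z * C)" using \<rho>(4) by (rule integrable_mult_left)
      show "norm (\<rho> z *\<^sub>R g z) \<le> \<rho> z * C" for z
        using \<rho>(2,3)[of z] that(2)[of z] by (cases "\<rho> z = 0") (auto intro: mult_left_mono)
    qed
    also have "\<dots> = C" using \<rho>(4,5) by simp
    finally show ?thesis .
  qed
  have one: "(LINT z|lborel. \<rho> z *\<^sub>R c) = c" for c :: "real^'m" using \<rho>(4,5) by simp
  define V where "V x = (LINT z|lborel. \<rho> z *\<^sub>R v (x - z))" for x
  have V_diff: "V x - (LINT z|lborel. \<rho> z *\<^sub>R g z) = (LINT z|lborel. \<rho> z *\<^sub>R (v (x - z) - g z))"
    if "continuous_on UNIV g" for x and g :: "real^'n \<Rightarrow> real^'m"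
    unfolding V_def using int[OF cv'] int[OF that] by (simp add: scaleR_diff_right)
  show ?thesis
  proof (rule that[of V])
    show "L-lipschitz_on UNIV V"
    proof (rule lipschitz_onI[OF _ L])
      fix x y :: "real^'n"
      have "norm (V x - V y) \<le> L * norm (x - y)"
        unfolding V_def[of y] V_diff[OF cv']
      proof (rule bound)
        show "continuous_on UNIV (\<lambda>z. v (x - z) - v (y - z))" by (rule continuous_on_diff[OF cv' cv'])
        show "norm (v (x - z) - v (y - z)) \<le> L * norm (x - y)" for z using v[of "x - z" "y - z"] by simp
      qed
      then show "dist (V x) (V y) \<le> L * dist x y" by (simp add: dist_norm)
    qed
    show "norm (V x - v x) \<le> L * \<epsilon>" for x
    proof -
      have "norm (V x - (LINT z|lborel. \<rho> z *\<^sub>R v x)) \<le> L * \<epsilon>"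
        unfolding V_diff[OF continuous_on_const]
      proof (rule bound)
        show "continuous_on UNIV (\<lambda>z. v (x - z) - v x)"
          by (rule continuous_on_diff[OF cv' continuous_on_const])
        show "norm (v (x - z) - v x) \<le> L * \<epsilon>" if "norm z < \<epsilon>" for z
          using v[of "x - z" "x"] mult_left_mono[of "norm z" \<epsilon> L] that L by simp
      qed
      then show ?thesis by (simp only: one)
    qed
    show "\<exists>y. dist x y < \<epsilon> \<and> v y \<noteq> 0" if "V x \<noteq> 0" for x
    proof (rule ccontr)
      assume *: "\<not> ?thesis"
      have "\<rho> z *\<^sub>R v (x - z) = 0" for z
      proof (cases "\<rho> z = 0")
        case False
        then have "dist x (x - z) < \<epsilon>" using \<rho>(3) by (simp add: dist_norm)
        with * show ?thesis by auto
      qed simp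
      then have "(\<lambda>z. \<rho> z *\<^sub>R v (x - z)) = (\<lambda>z. 0)" by (rule ext)
      then have "V x = 0" unfolding V_def by simp
      with that show False by simp
    qed
    show "loc_affine V x M" if aff: "\<And>y. y \<in> ball x r \<Longrightarrow> v y = M *v y + b" and r: "\<epsilon> < r" for x r M b
    proof -
      have cM: "continuous_on UNIV (\<lambda>z. M *v z)" by (rule matrix_vector_mult_linear_continuous_on)
      have "V y = M *v y + (b - (LINT z|lborel. \<rho> z *\<^sub>R (M *v z)))" if y: "y \<in> ball x (r - \<epsilon>)" for y
      proof -
        have "\<rho> z *\<^sub>R v (y - z) = \<rho> z *\<^sub>R (M *v y + b) - \<rho> z *\<^sub>R (M *v z)" for z
        proof (cases "\<rho> z = 0")
          case False
          then have "norm z < \<epsilon>" by (rule \<rho>(3))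
          then have "y - z \<in> ball x r" using y norm_triangle_ineq[of "x - y" z] by (simp add: dist_norm diff_diff_eq2 diff_add_eq)
          then show ?thesis by (simp add: aff matrix_vector_mult_diff_distrib algebra_simps)
        qed simp
        then have "V y = (LINT z|lborel. \<rho> z *\<^sub>R (M *v y + b)) - (LINT z|lborel. \<rho> z *\<^sub>R (M *v z))"
          unfolding V_def using int[OF cM] int[OF continuous_on_const] by simp
        then show ?thesis unfolding one by simp
      qed
      moreover have "\<forall>\<^sub>F y in nhds x. y \<in> ball x (r - \<epsilon>)"
        using r by (intro eventually_nhds_in_open) auto
      ultimately have "\<forall>\<^sub>F y in nhds x. V y = M *v y + (b - (LINT z|lborel. \<rho> z *\<^sub>R (M *v z)))"
        by (simp add: eventually_mono)
      then show ?thesis unfolding loc_affine_def by (rule exI)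
    qed
    show "Ck k V" for k
    proof -
      obtain a where a: "cball (0::real^'n) R \<subseteq> cbox (-a) a"
        using bounded_subset_cbox_symmetric[OF bounded_cball] by blast
      have off: "v y = 0" if "y \<notin> cbox (-a) a" for y using that a sup[of y] by force
      \<comment> \<open>The reflection y = x - z moves the dependence on x from v to \<rho>, and the
        box contains the support of v.\<close>
      have "V x = integral (cbox (-a) a) (\<lambda>y. \<rho> (x - y) *\<^sub>R v y)" for x
      proof -
        have c: "continuous_on UNIV (\<lambda>y. \<rho> (x - y) *\<^sub>R v y)"
          by (intro continuous_on_scaleR cv continuous_on_compose2[OF c\<rho>]) (auto intro: continuous_intros)
        have "continuous_on UNIV (\<lambda>z. \<rho> z *\<^sub>R v (x - z))" by (rule continuous_on_scaleR[OF c\<rho> cv'])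
        then have "(\<lambda>z. \<rho> z *\<^sub>R v (x - z)) \<in> borel_measurable borel"
          by (rule borel_measurable_continuous_onI)
        from lborel_integral_reflect[OF this, of x]
        have "V x = (LINT y|lborel. \<rho> (x - y) *\<^sub>R v y)" unfolding V_def by simp
        also have "(\<lambda>y. \<rho> (x - y) *\<^sub>R v y) = (\<lambda>y. indicator (cbox (-a) a) y *\<^sub>R (\<rho> (x - y) *\<^sub>R v y))"
          by (rule ext) (use off in \<open>auto simp: indicator_def\<close>)
        also have "(LINT y|lborel. indicator (cbox (-a) a) y *\<^sub>R (\<rho> (x - y) *\<^sub>R v y)) =
           integral (cbox (-a) a) (\<lambda>y. \<rho> (x - y) *\<^sub>R v y)"
          unfolding set_lebesgue_integral_def[symmetric]
          by (rule set_borel_integral_eq_integral, unfold set_integrable_def)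
             (rule borel_integrable_compact[OF compact_cbox continuous_on_subset[OF c subset_UNIV]])
        finally show ?thesis .
      qed
      then have "V = (\<lambda>x. integral (cbox (-a) a) (\<lambda>y. \<rho> (x - y) *\<^sub>R v y))" by blast
      then show ?thesis using Ck_convolution[OF cv \<rho>(1)] by simp
    qed
  qed
qed

section \<open>Supports and Lipschitz bounds of test functions\<close>

lemma test_function_bounded_support:
  fixes \<phi> :: "real^'n \<Rightarrow> 'b::real_normed_vector"
  assumes "\<phi> \<in> test_functions \<Omega>"
  obtains R where "\<And>x. norm x > R \<Longrightarrow> \<phi> x = 0"
proof -
  have "bounded (closure {x. \<phi> x \<noteq> 0})" using assms compact_imp_bounded by (auto simp: test_functions_def)
  then obtain R where R: "\<forall>x\<in>closure {x. \<phi> x \<noteq> 0}. norm x \<le> R" unfolding bounded_iff ..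
  show ?thesis
  proof (rule that)
    fix x :: "real^'n" assume "norm x > R"
    then have "x \<notin> closure {x. \<phi> x \<noteq> 0}" using R by force
    then show "\<phi> x = 0" using closure_subset[of "{x. \<phi> x \<noteq> 0}"] by blast
  qed
qed

lemma test_function_has_derivative:
  assumes "\<phi> \<in> test_functions \<Omega>"
  shows "(\<phi> has_derivative frechet_derivative \<phi> (at x)) (at x)"
proof -
  have "Ck (Suc 0) \<phi>" using assms by (simp add: test_functions_def)
  then show ?thesis by (simp add: frechet_derivative_works)
qed

lemma test_function_continuous_derivative:
  assumes "\<phi> \<in> test_functions \<Omega>"
  shows "continuous_on UNIV (\<lambda>x. frechet_derivative \<phi> (at x) (axis j 1))"
proof -
  have "Ck (Suc 0) \<phi>" using assms by (simp add: test_functions_def)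
  then show ?thesis by simp
qed

lemma test_function_derivative_off:
  assumes "\<phi> \<in> test_functions \<Omega>" "x \<notin> \<Omega>"
  shows "\<phi> x = 0" "frechet_derivative \<phi> (at x) = (\<lambda>h. 0)"
proof -
  have x: "x \<notin> closure {x. \<phi> x \<noteq> 0}" using assms by (auto simp: test_functions_def)
  then show "\<phi> x = 0" using closure_subset[of "{x. \<phi> x \<noteq> 0}"] by blast
  have *: "\<forall>y\<in>- closure {x. \<phi> x \<noteq> 0}. \<phi> y = 0" using closure_subset[of "{x. \<phi> x \<noteq> 0}"] by blast
  have "(\<phi> has_derivative (\<lambda>h. 0)) (at x)"
  proof (rule has_derivative_transform_within_open[OF has_derivative_const])
    show "open (- closure {x. \<phi> x \<noteq> 0})" by (rule open_Compl) (rule closed_closure)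
    show "x \<in> - closure {x. \<phi> x \<noteq> 0}" using x by blast
    show "0 = \<phi> y" if "y \<in> - closure {x. \<phi> x \<noteq> 0}" for y using *[THEN bspec, OF that] by (rule sym)
  qed
  then show "frechet_derivative \<phi> (at x) = (\<lambda>h. 0)"
    using frechet_derivative_at[of \<phi> "\<lambda>h. 0" x] by simp
qed

lemma test_function_lipschitz:
  fixes \<phi> :: "real^'n \<Rightarrow> 'b::real_normed_vector"
  assumes \<phi>: "\<phi> \<in> test_functions \<Omega>"
  obtains B where "B-lipschitz_on UNIV \<phi>"
proof -
  let ?S = "closure {x. \<phi> x \<noteq> 0}"
  let ?D = "\<lambda>j x. frechet_derivative \<phi> (at x) (axis j 1)"
  have S: "compact ?S" using \<phi> by (simp add: test_functions_def)
  \<comment> \<open>As a test function of its own support, \<phi> has derivative 0 off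
    \<open>?S\<close> and not only off \<Omega>.\<close>
  have \<phi>S: "\<phi> \<in> test_functions ?S" using \<phi> by (simp add: test_functions_def)
  have "\<exists>B. \<forall>x. norm (?D j x) \<le> B" for j
  proof -
    have "compact (?D j ` ?S)"
      by (rule compact_continuous_image[OF continuous_on_subset[OF test_function_continuous_derivative[OF \<phi>]] S]) auto
    then obtain B where "\<forall>y\<in>?D j ` ?S. norm y \<le> B"
      using compact_imp_bounded bounded_iff by blast
    \<comment> \<open>The maximum with 0 covers points off the support, and also an empty support,
      for which B may be negative.\<close>
    then have "norm (?D j x) \<le> max B 0" for x
      using test_function_derivative_off(2)[OF \<phi>S, of x] by (cases "x \<in> ?S") (auto simp: le_max_iff_disj)
    then show ?thesis by blast
  qed
  then obtain B where B: "\<And>j x. norm (?D j x) \<le> B j" by metis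
  have B0: "B j \<ge> 0" for j by (rule order_trans[OF norm_ge_zero B])
  have on: "onorm (frechet_derivative \<phi> (at x)) \<le> (\<Sum>j\<in>UNIV. B j)" for x
  proof (rule onorm_bound)
    interpret bounded_linear "frechet_derivative \<phi> (at x)"
      by (rule has_derivative_bounded_linear[OF test_function_has_derivative[OF \<phi>]])
    fix h :: "real^'n"
    have "frechet_derivative \<phi> (at x) h = frechet_derivative \<phi> (at x) (\<Sum>j\<in>UNIV. h $ j *\<^sub>R axis j 1)"
      using basis_expansion[of h] by (simp add: scalar_mult_eq_scaleR)
    also have "norm \<dots> \<le> (\<Sum>j\<in>UNIV. norm (h $ j *\<^sub>R ?D j x))"
      unfolding sum scaleR by (rule norm_sum)
    also have "\<dots> \<le> (\<Sum>j\<in>UNIV. B j * norm h)"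
    proof (rule sum_mono)
      fix j
      have "\<bar>h $ j\<bar> * norm (?D j x) \<le> norm h * B j"
        by (rule mult_mono[OF component_le_norm_cart B]) auto
      then show "norm (h $ j *\<^sub>R ?D j x) \<le> B j * norm h" by (simp add: mult.commute)
    qed
    finally show "norm (frechet_derivative \<phi> (at x) h) \<le> (\<Sum>j\<in>UNIV. B j) * norm h"
      by (simp add: sum_distrib_right)
  qed (simp add: sum_nonneg B0)
  have "(\<Sum>j\<in>UNIV. B j)-lipschitz_on UNIV \<phi>"
    by (rule bounded_derivative_imp_lipschitz[OF test_function_has_derivative[OF \<phi>] _ on])
       (simp_all add: sum_nonneg B0)
  then show ?thesis by (rule that)
qed

section \<open>Measurability, bounds and weak gradients of Lipschitz maps\<close>

lemma borel_measurable_lebesgue_on: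
  assumes "f \<in> borel_measurable borel"
  shows "f \<in> borel_measurable (lebesgue_on \<Omega>)"
proof -
  have "f \<in> borel_measurable lborel" using assms by simp
  then show ?thesis by (intro measurable_restrict_space1 measurable_completion)
qed

lemma integrable_lebesgue_on_bounded:
  fixes f :: "real^'n \<Rightarrow> 'b::euclidean_space"
  assumes "\<Omega> \<in> lmeasurable" "f \<in> borel_measurable (lebesgue_on \<Omega>)" "\<And>x. x \<in> \<Omega> \<Longrightarrow> norm (f x) \<le> C"
  shows "integrable (lebesgue_on \<Omega>) f"
proof -
  interpret finite_measure "lebesgue_on \<Omega>" by (rule finite_measure_lebesgue_on[OF assms(1)])
  have "AE x in lebesgue_on \<Omega>. norm (f x) \<le> C" using assms(3) by (intro AE_I2) simp
  then show ?thesis using assms(2) by (rule integrable_const_bound)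
qed

lemma L_inf_bounded:
  fixes f :: "real^'n \<Rightarrow> 'b::euclidean_space"
  assumes "f \<in> borel_measurable borel" "\<And>x. x \<in> \<Omega> \<Longrightarrow> norm (f x) \<le> C"
  shows "f \<in> L_inf \<Omega>"
proof -
  have "AE x in lebesgue_on \<Omega>. norm (f x) \<le> C" using assms(2) by (intro AE_I2) simp
  then show ?thesis using borel_measurable_lebesgue_on[OF assms(1)] unfolding L_inf_def by blast
qed

lemma integral_lebesgue_on_eq_lborel:
  fixes f :: "'a::euclidean_space \<Rightarrow> real"
  assumes \<Omega>: "\<Omega> \<in> sets borel" and [measurable]: "f \<in> borel_measurable borel"
    and off: "\<And>x. x \<notin> \<Omega> \<Longrightarrow> f x = 0"
  shows "(LINT x|lebesgue_on \<Omega>. f x) = (LINT x|lborel. f x)"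
proof -
  have "\<Omega> \<inter> space lebesgue \<in> sets lebesgue" using \<Omega> by simp
  from integral_restrict_space[OF this, of f]
  have "(LINT x|lebesgue_on \<Omega>. f x) = (LINT x|lebesgue. indicator \<Omega> x *\<^sub>R f x)" .
  also have "(\<lambda>x. indicator \<Omega> x *\<^sub>R f x) = f"
    by (rule ext) (use off in \<open>auto simp: indicator_def\<close>)
  also have "(LINT x|lebesgue. f x) = (LINT x|lborel. f x)" by (rule integral_completion) simp
  finally show ?thesis .
qed

lemma lipschitz_derivative_component:
  fixes u :: "real^'n \<Rightarrow> real^'m"
  assumes lip: "L-lipschitz_on UNIV u" and der: "(u has_derivative u') (at x)"
  shows "\<bar>u' (axis j 1) $ i\<bar> \<le> L"
proof -
  let ?q = "\<lambda>k. (u (x + inverse (real (Suc k)) *\<^sub>R axis j 1) - u x) /\<^sub>R inverse (real (Suc k))"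
  have "?q \<longlonglongrightarrow> u' (axis j 1)"
    by (rule difference_quotient_tendsto[OF der])
  then have "(\<lambda>k. norm (?q k)) \<longlonglongrightarrow> norm (u' (axis j 1))" by (rule tendsto_norm)
  moreover have *: "norm ((u (x + s *\<^sub>R axis j 1) - u x) /\<^sub>R s) \<le> L" if "s > 0" for s
  proof -
    have "norm (u (x + s *\<^sub>R axis j 1) - u x) \<le> L * s"
      using lipschitz_onD[OF lip, of "x + s *\<^sub>R axis j 1" x] that by (simp add: dist_norm)
    then have "norm (u (x + s *\<^sub>R axis j 1) - u x) / s \<le> L" using that by (simp add: field_simps)
    then show ?thesis using that by (simp only: norm_scaleR) (simp add: divide_inverse mult.commute)
  qed
  have "norm (?q k) \<le> L" for k by (rule *) simp
  ultimately have "norm (u' (axis j 1)) \<le> L" by (intro LIMSEQ_le_const2) auto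
  then show ?thesis using component_le_norm_cart order_trans by metis
qed

text \<open>Valid at every point, since \<open>grad\<close> is 0 where the map is not locally
  affine.\<close>

lemma grad_component_bound:
  fixes u :: "real^'n \<Rightarrow> real^'m"
  assumes lip: "L-lipschitz_on UNIV u"
  shows "\<bar>grad u x $ i $ j\<bar> \<le> L"
proof (cases "\<exists>M. loc_affine u x M")
  case True
  then obtain M where M: "loc_affine u x M" by blast
  have "grad u x $ i $ j = (M *v axis j 1) $ i"
    by (simp add: grad_eq[OF M] matrix_vector_mult_basis column_def)
  then show ?thesis
    using lipschitz_derivative_component[OF lip loc_affine_has_derivative[OF M], of j i] by simp
next
  case False
  then show ?thesis using lipschitz_on_nonneg[OF lip] by (simp add: grad_def)
qed

lemma norm_matrix_le:
  fixes A :: "real^'n^'m"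
  assumes "\<And>i j. \<bar>A $ i $ j\<bar> \<le> L"
  shows "norm A \<le> real CARD('m) * (real CARD('n) * L)"
proof -
  have "norm (A $ i) \<le> real CARD('n) * L" for i
  proof -
    have "norm (A $ i) \<le> (\<Sum>j\<in>UNIV. \<bar>A $ i $ j\<bar>)" by (rule norm_le_l1_cart)
    also have "\<dots> \<le> (\<Sum>j\<in>(UNIV::'n set). L)" by (rule sum_mono) (rule assms)
    finally show ?thesis by simp
  qed
  then have "(\<Sum>i\<in>UNIV. norm (A $ i)) \<le> (\<Sum>i\<in>(UNIV::'m set). real CARD('n) * L)" by (intro sum_mono)
  moreover have "norm A \<le> (\<Sum>i\<in>UNIV. norm (A $ i))" unfolding norm_vec_def by (rule L2_set_le_sum) simp
  ultimately show ?thesis by simp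
qed

lemma grad_norm_bound:
  fixes u :: "real^'n \<Rightarrow> real^'m"
  assumes "L-lipschitz_on UNIV u"
  shows "norm (grad u x) \<le> real CARD('m) * (real CARD('n) * L)"
  by (rule norm_matrix_le) (rule grad_component_bound[OF assms])

lemma borel_measurable_cart2 [measurable]:
  fixes F :: "'a \<Rightarrow> real^'n^'m"
  assumes "F \<in> borel_measurable M"
  shows "(\<lambda>x. F x $ i $ j) \<in> borel_measurable M"
proof -
  have "continuous_on UNIV (\<lambda>A::real^'n^'m. A $ i $ j)" by (intro continuous_intros)
  from borel_measurable_continuous_on[OF this assms] show ?thesis .
qed

lemma lipschitz_component:
  fixes u :: "'a::metric_space \<Rightarrow> real^'m"
  assumes "L-lipschitz_on UNIV u"
  shows "L-lipschitz_on UNIV (\<lambda>x. u x $ i)"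
proof (rule lipschitz_onI)
  fix x y
  have "dist (u x $ i) (u y $ i) \<le> dist (u x) (u y)" by (rule dist_vec_nth_le)
  also have "\<dots> \<le> L * dist x y" using lipschitz_onD[OF assms] by blast
  finally show "dist (u x $ i) (u y $ i) \<le> L * dist x y" .
qed (rule lipschitz_on_nonneg[OF assms])

lemma lipschitz_bounded_on:
  fixes u :: "'a::real_normed_vector \<Rightarrow> 'b::real_normed_vector"
  assumes "L-lipschitz_on UNIV u" "bounded S"
  obtains C where "\<And>x. x \<in> S \<Longrightarrow> norm (u x) \<le> C"
proof -
  obtain R where R: "\<forall>x\<in>S. norm x \<le> R" using \<open>bounded S\<close> unfolding bounded_iff ..
  show ?thesis
  proof (rule that)
    fix x assume "x \<in> S"
    have "norm (u x - u 0) \<le> L * norm x" using lipschitz_onD[OF assms(1), of x 0] by (simp add: dist_norm)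
    also have "\<dots> \<le> L * R" using R \<open>x \<in> S\<close> lipschitz_on_nonneg[OF assms(1)] by (intro mult_left_mono) auto
    finally show "norm (u x) \<le> norm (u 0) + L * R" using norm_triangle_ineq2[of "u x" "u 0"] by linarith
  qed
qed

lemma lipschitz_borel:
  fixes u :: "'a::real_normed_vector \<Rightarrow> 'b::real_normed_vector"
  assumes "L-lipschitz_on UNIV u" shows "u \<in> borel_measurable borel"
  by (rule borel_measurable_continuous_onI[OF lipschitz_on_continuous_on[OF assms]])

lemma loc_affine_component_derivative:
  assumes "loc_affine u x M"
  shows "((\<lambda>y. u y $ i) has_derivative (\<lambda>h. (M *v h) $ i)) (at x)"
  using has_derivative_compose[OF loc_affine_has_derivative[OF assms]
      bounded_linear_imp_has_derivative[OF bounded_linear_vec_nth]] by simp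

text \<open>The Lipschitz bound makes integration by parts valid across the interfaces of the
  pieces, so that the distributional gradient has no part concentrated there. Test functions vanish
  off \<Omega>, so the integrals over \<Omega> may be taken over the whole space.\<close>

lemma has_weak_gradient_grad:
  fixes u :: "real^'n \<Rightarrow> real^'m"
  assumes lip: "L-lipschitz_on UNIV u" and "open \<Omega>"
    and aff: "negligible {x\<in>\<Omega>. \<nexists>M. loc_affine u x M}"
  shows "has_weak_gradient \<Omega> u (grad u)"
  unfolding has_weak_gradient_def
proof (intro conjI allI impI ballI)
  fix C :: "(real^'n) set" assume C: "compact C \<and> C \<subseteq> \<Omega>"
  then have lm: "C \<in> lmeasurable" by (simp add: lmeasurable_compact)
  then have *: "C \<inter> space lebesgue \<in> sets lebesgue" by (simp add: fmeasurableD)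
  obtain B where B: "\<And>x. x \<in> C \<Longrightarrow> norm (u x) \<le> B"
    using lipschitz_bounded_on[OF lip] C compact_imp_bounded by metis
  have "integrable (lebesgue_on C) u"
    by (rule integrable_lebesgue_on_bounded[OF lm borel_measurable_lebesgue_on[OF lipschitz_borel[OF lip]] B])
  then show "u absolutely_integrable_on C"
    unfolding set_integrable_def using integrable_restrict_space[OF *] by blast
  have "integrable (lebesgue_on C) (grad u)"
    by (rule integrable_lebesgue_on_bounded[OF lm borel_measurable_lebesgue_on[OF grad_borel] grad_norm_bound[OF lip]])
  then show "grad u absolutely_integrable_on C"
    unfolding set_integrable_def using integrable_restrict_space[OF *] by blast
next
  fix \<phi> :: "real^'n \<Rightarrow> real" and i j assume \<phi>: "\<phi> \<in> test_functions \<Omega>"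
  let ?D = "\<lambda>x. frechet_derivative \<phi> (at x)"
  obtain P where P: "P-lipschitz_on UNIV \<phi>" by (rule test_function_lipschitz[OF \<phi>])
  obtain R where R: "\<And>x. norm x > R \<Longrightarrow> \<phi> x = 0" by (rule test_function_bounded_support[OF \<phi>]) blast
  note off = test_function_derivative_off[OF \<phi>]
  have [measurable]: "(\<lambda>x. ?D x (axis j 1)) \<in> borel_measurable borel" "\<phi> \<in> borel_measurable borel"
    "(\<lambda>x. u x $ i) \<in> borel_measurable borel"
    using borel_measurable_continuous_onI[OF test_function_continuous_derivative[OF \<phi>]]
      lipschitz_borel[OF P] lipschitz_borel[OF lipschitz_component[OF lip]] by auto
  have e: "(grad u x *v axis j 1) $ i = grad u x $ i $ j" for x
    by (simp add: matrix_vector_mult_basis column_def)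
  have "AE x in lebesgue. x \<notin> {x\<in>\<Omega>. \<nexists>M. loc_affine u x M}"
    using aff unfolding negligible_iff_null_sets by (rule AE_not_in)
  then have "AE x in lborel. x \<notin> {x\<in>\<Omega>. \<nexists>M. loc_affine u x M}" by (simp only: AE_completion_iff)
  then have der: "AE x in lborel. \<phi> x \<noteq> 0 \<longrightarrow> ((\<lambda>y. u y $ i) has_derivative (\<lambda>h. (grad u x *v h) $ i)) (at x)"
  proof eventually_elim
    case (elim x)
    show ?case
    proof
      assume "\<phi> x \<noteq> 0"
      then have "x \<in> \<Omega>" using off(1) by blast
      then obtain M where M: "loc_affine u x M" using elim by blast
      show "((\<lambda>y. u y $ i) has_derivative (\<lambda>h. (grad u x *v h) $ i)) (at x)"
        unfolding grad_eq[OF M] by (rule loc_affine_component_derivative[OF M])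
    qed
  qed
  have "(LINT x|lborel. ?D x (axis j 1) * u x $ i) = - (LINT x|lborel. \<phi> x * (grad u x *v axis j 1) $ i)"
    by (rule integration_by_parts_lipschitz[OF P R test_function_has_derivative[OF \<phi>] lipschitz_component[OF lip] der])
      (unfold e, measurable)
  then have 1: "(LINT x|lborel. u x $ i * ?D x (axis j 1)) = - (LINT x|lborel. grad u x $ i $ j * \<phi> x)"
    by (simp only: e mult.commute)
  have 2: "(LINT x|lebesgue_on \<Omega>. u x $ i * ?D x (axis j 1)) = (LINT x|lborel. u x $ i * ?D x (axis j 1))"
    by (rule integral_lebesgue_on_eq_lborel) (use \<open>open \<Omega>\<close> off in auto)
  have 3: "(LINT x|lebesgue_on \<Omega>. grad u x $ i $ j * \<phi> x) = (LINT x|lborel. grad u x $ i $ j * \<phi> x)"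
    by (rule integral_lebesgue_on_eq_lborel) (use \<open>open \<Omega>\<close> off in auto)
  show "(LINT x|lebesgue_on \<Omega>. u x $ i * ?D x (axis j 1)) = - (LINT x|lebesgue_on \<Omega>. grad u x $ i $ j * \<phi> x)"
    unfolding 1 2 3 ..
qed

subsection \<open>Lipschitz maps vanishing off a domain\<close>

text \<open>Applied to the components of a map vanishing off \<open>\<Omega>\<close>, this makes the support a compact subset of
  \<open>\<Omega>\<close> without changing the gradient where the component is large.\<close>

definition soft_threshold :: "real \<Rightarrow> real \<Rightarrow> real" where
  "soft_threshold \<eta> s = s - max (- \<eta>) (min \<eta> s)"

lemma soft_threshold_lipschitz: "\<bar>soft_threshold \<eta> s - soft_threshold \<eta> t\<bar> \<le> \<bar>s - t\<bar>"
  by (auto simp: soft_threshold_def max_def min_def)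

lemma soft_threshold_close: "\<eta> \<ge> 0 \<Longrightarrow> \<bar>soft_threshold \<eta> s - s\<bar> \<le> \<eta>"
  by (auto simp: soft_threshold_def max_def min_def)

lemma soft_threshold_support: "soft_threshold \<eta> s \<noteq> 0 \<Longrightarrow> \<bar>s\<bar> > \<eta>"
  by (auto simp: soft_threshold_def max_def min_def split: if_splits)

lemma soft_threshold_eq:
  "0 \<le> \<eta> \<Longrightarrow> \<eta> \<le> s \<Longrightarrow> soft_threshold \<eta> s = s - \<eta>" "0 \<le> \<eta> \<Longrightarrow> s \<le> - \<eta> \<Longrightarrow> soft_threshold \<eta> s = s + \<eta>"
  "0 \<le> \<eta> \<Longrightarrow> soft_threshold \<eta> 0 = 0"
  by (auto simp: soft_threshold_def max_def min_def)

text \<open>On an affine piece these points lie in a hyperplane. They must be excluded because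
  thresholding replaces the component by 0 near them and so destroys its gradient; if component and
  row both vanish, the component is 0 nearby and thresholding changes nothing.\<close>

lemma negligible_zero_component:
  fixes w :: "real^'n \<Rightarrow> real^'m"
  shows "negligible {x. \<exists>M. loc_affine w x M \<and> w x $ i = 0 \<and> M $ i \<noteq> 0}"
proof -
  have op: "open {x. \<exists>M. loc_affine w x M}" using open_loc_affine[of UNIV w] by simp
  obtain \<D> where \<D>: "countable \<D>" "\<Union>\<D> = {x. \<exists>M. loc_affine w x M}" "\<And>U. U \<in> \<D> \<Longrightarrow> open U"
    "\<And>U. U \<in> \<D> \<Longrightarrow> \<exists>M b. \<forall>x\<in>U. w x = M *v x + b"
    by (rule affine_pieces[OF op, of w]) (simp, blast)
  let ?Z = "\<lambda>U. {x\<in>U. \<exists>M. loc_affine w x M \<and> w x $ i = 0 \<and> M $ i \<noteq> 0}"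
  have "negligible (?Z U)" if U: "U \<in> \<D>" for U
  proof -
    obtain M b where Mb: "\<And>x. x \<in> U \<Longrightarrow> w x = M *v x + b" using \<D>(4)[OF U] by blast
    have "N = M" if "x \<in> U" "loc_affine w x N" for x N
    proof (rule loc_affine_unique[OF that(2)])
      show "loc_affine w x M"
        using loc_affine_cong_on[OF \<D>(3)[OF U] that(1), of w "\<lambda>y. M *v y + b" M] Mb loc_affine_affine by simp
    qed
    then have sub: "?Z U \<subseteq> {x. M $ i \<bullet> x = - b $ i}" "M $ i \<noteq> 0" if "?Z U \<noteq> {}"
      using that by (auto simp: Mb matrix_vector_mul_component eq_neg_iff_add_eq_0)
    show ?thesis
    proof (cases "?Z U = {}")
      case True
      then show ?thesis by (simp only: negligible_empty)
    next
      case False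
      have "negligible {x. M $ i \<bullet> x = - b $ i}" by (rule negligible_hyperplane) (use sub(2)[OF False] in simp)
      then show ?thesis using sub(1)[OF False] by (rule negligible_subset)
    qed
  qed
  then have "negligible (\<Union>(?Z ` \<D>))" using \<D>(1) by (intro negligible_countable_Union) auto
  moreover have "{x. \<exists>M. loc_affine w x M \<and> w x $ i = 0 \<and> M $ i \<noteq> 0} \<subseteq> \<Union>(?Z ` \<D>)"
    using \<D>(2) by blast
  ultimately show ?thesis by (rule negligible_subset)
qed

text \<open>The margin c holds on a whole neighbourhood: for thresholds up to c, soft thresholding
  acts there as one constant shift.\<close>

lemma eventually_sign:
  fixes f :: "'a::t2_space \<Rightarrow> real"
  assumes "isCont f x"
  obtains c where "c > 0"
    "(\<forall>\<^sub>F y in nhds x. f y > c) \<or> (\<forall>\<^sub>F y in nhds x. f y < - c) \<or> f x = 0"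
proof -
  have lim: "(f \<longlongrightarrow> f x) (nhds x)" using assms by (simp add: isCont_def tendsto_at_iff_tendsto_nhds)
  consider "f x > 0" | "f x < 0" | "f x = 0" by linarith
  then show ?thesis
  proof cases
    case 1
    then have "\<forall>\<^sub>F y in nhds x. f y > f x / 2" by (intro order_tendstoD(1)[OF lim]) simp
    with 1 show ?thesis by (intro that[of "f x / 2"]) auto
  next
    case 2
    then have "\<forall>\<^sub>F y in nhds x. f y < f x / 2" by (intro order_tendstoD(2)[OF lim]) simp
    with 2 show ?thesis by (intro that[of "- f x / 2"]) auto
  qed (auto intro: that[of 1])
qed

text \<open>Thresholding the components at a level tending to 0 pulls the support into \<Omega>, and
  mollifying on a smaller scale makes the result smooth. Near almost every point both operations
  only add constants once k is large, so the derivatives eventually equal \<open>grad w\<close>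
  instead of merely converging to it.\<close>

lemma test_function_approximation:
  fixes w :: "real^'n \<Rightarrow> real^'m"
  assumes lip: "L-lipschitz_on UNIV w" and "open \<Omega>" "bounded \<Omega>"
    and off: "\<And>x. x \<notin> \<Omega> \<Longrightarrow> w x = 0"
    and aff: "negligible {x\<in>\<Omega>. \<nexists>M. loc_affine w x M}"
  obtains \<phi> C where "\<And>k::nat. \<phi> k \<in> test_functions \<Omega>" "\<And>k. L-lipschitz_on UNIV (\<phi> k)"
    "\<And>k x. norm (\<phi> k x - w x) \<le> C * inverse (real (Suc k))"
    "AE x in lebesgue_on \<Omega>. \<forall>\<^sub>F k in sequentially. frechet_derivative (\<phi> k) (at x) = (*v) (grad w x)"
proof -
  have L: "L \<ge> 0" by (rule lipschitz_on_nonneg[OF lip])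
  have cw: "continuous_on UNIV w" by (rule lipschitz_on_continuous_on[OF lip])
  define \<eta> where "\<eta> k = inverse (real (Suc k))" for k
  \<comment> \<open>Over the mollification radius w varies by at most \<eta>/2. As thresholding
    leaves only points with |w| > \<eta>, the mollified support lies in the closed set |w| \<ge>
    \<eta>/2, which is inside \<Omega>.\<close>
  define \<epsilon> where "\<epsilon> k = \<eta> k / (2 * (L + 1))" for k
  have \<eta>: "\<eta> k > 0" for k by (simp add: \<eta>_def)
  have \<epsilon>: "\<epsilon> k > 0" "L * \<epsilon> k \<le> \<eta> k / 2" "\<epsilon> k \<le> \<eta> k" for k
    using \<eta>[of k] L by (auto simp: \<epsilon>_def field_simps)
  define v where "v k x = (\<chi> i. soft_threshold (\<eta> k) (w x $ i))" for k x
  have v_lip: "L-lipschitz_on UNIV (v k)" for k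
  proof (rule lipschitz_onI[OF _ L])
    fix x y
    have "norm (v k x - v k y) \<le> norm (w x - w y)"
      by (rule norm_le_componentwise_cart) (simp add: v_def soft_threshold_lipschitz)
    then show "dist (v k x) (v k y) \<le> L * dist x y"
      using lipschitz_onD[OF lip, of x y] by (simp add: dist_norm)
  qed
  have v_sup: "norm (w x) > \<eta> k" if "v k x \<noteq> 0" for k x
  proof -
    have "\<exists>i. soft_threshold (\<eta> k) (w x $ i) \<noteq> 0" using that by (simp add: v_def vec_eq_iff)
    then obtain i where "soft_threshold (\<eta> k) (w x $ i) \<noteq> 0" ..
    then show ?thesis using soft_threshold_support component_le_norm_cart[of "w x" i] by force
  qed
  obtain R where R: "\<forall>x\<in>\<Omega>. norm x \<le> R" using \<open>bounded \<Omega>\<close> unfolding bounded_iff ..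
  have w_off: "w x = 0" if "norm x > R" for x using off[of x] R that by force
  have v_off: "v k x = 0" if "norm x > R" for k x using v_sup[of k x] w_off[OF that] \<eta>[of k] by fastforce
  define P where "P k V \<longleftrightarrow> (\<forall>n. Ck n V) \<and> L-lipschitz_on UNIV V \<and> (\<forall>x. norm (V x - v k x) \<le> L * \<epsilon> k) \<and>
    (\<forall>x. V x \<noteq> 0 \<longrightarrow> (\<exists>y. dist x y < \<epsilon> k \<and> v k y \<noteq> 0)) \<and>
    (\<forall>x r M b. (\<forall>y\<in>ball x r. v k y = M *v y + b) \<longrightarrow> \<epsilon> k < r \<longrightarrow> loc_affine V x M)" for k V
  have "\<exists>V. P k V" for k
  proof (rule mollification[OF v_lip[of k] v_off[where k = k] \<epsilon>(1)[of k]])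
    show "norm x > R \<Longrightarrow> norm x > R" for x :: "real^'n" .
  next
    fix V
    assume "\<And>n. Ck n V" "L-lipschitz_on UNIV V" "\<And>x. norm (V x - v k x) \<le> L * \<epsilon> k"
      "\<And>x. V x \<noteq> 0 \<Longrightarrow> \<exists>y. dist x y < \<epsilon> k \<and> v k y \<noteq> 0"
      "\<And>x r M b. (\<And>y. y \<in> ball x r \<Longrightarrow> v k y = M *v y + b) \<Longrightarrow> \<epsilon> k < r \<Longrightarrow> loc_affine V x M"
    then have "P k V" unfolding P_def by (intro conjI allI impI) (simp, simp, simp, simp, blast)
    then show "\<exists>V. P k V" by (rule exI[of "P k" V])
  qed
  then obtain V where PV: "\<And>k. P k (V k)" by metis
  have V: "Ck n (V k)" "L-lipschitz_on UNIV (V k)" "norm (V k x - v k x) \<le> L * \<epsilon> k"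
    "V k x \<noteq> 0 \<Longrightarrow> \<exists>y. dist x y < \<epsilon> k \<and> v k y \<noteq> 0"
    "(\<forall>y\<in>ball x r. v k y = M *v y + b) \<Longrightarrow> \<epsilon> k < r \<Longrightarrow> loc_affine (V k) x M" for k n x r M b
    using PV[of k] unfolding P_def by blast+
  show ?thesis
  \<comment> \<open>One \<eta> for thresholding each of the components, one more for the
    mollification.\<close>
  proof (rule that[of V "real CARD('m) + 1"])
    show "V k \<in> test_functions \<Omega>" for k
    proof -
      let ?S = "{x. norm (w x) \<ge> \<eta> k / 2}"
      have "closed ?S" by (intro closed_Collect_le continuous_intros cw)
      have "?S \<subseteq> \<Omega>" using off \<eta>[of k] by force
      have "{x. V k x \<noteq> 0} \<subseteq> ?S"
      proof clarify
        fix x assume "V k x \<noteq> 0"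
        then obtain y where y: "dist x y < \<epsilon> k" "v k y \<noteq> 0" using V(4) by blast
        have "norm (w x - w y) \<le> L * dist x y" using lipschitz_onD[OF lip, of x y] by (simp add: dist_norm)
        also have "\<dots> \<le> L * \<epsilon> k" using y(1) L by (intro mult_left_mono) auto
        finally have "norm (w x - w y) \<le> \<eta> k / 2" using \<epsilon>(2)[of k] by linarith
        moreover have "norm (w y) - norm (w x) \<le> norm (w x - w y)"
          using norm_triangle_ineq2[of "w y" "w x"] by (simp add: norm_minus_commute)
        ultimately show "norm (w x) \<ge> \<eta> k / 2" using v_sup[OF y(2)] by linarith
      qed
      then have cl: "closure {x. V k x \<noteq> 0} \<subseteq> ?S" using \<open>closed ?S\<close> by (rule closure_minimal)
      have "bounded (closure {x. V k x \<noteq> 0})"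
        using cl \<open>?S \<subseteq> \<Omega>\<close> bounded_subset[OF \<open>bounded \<Omega>\<close>] by blast
      then have "compact (closure {x. V k x \<noteq> 0})" by (simp add: compact_eq_bounded_closed)
      with cl \<open>?S \<subseteq> \<Omega>\<close> V(1) show ?thesis unfolding test_functions_def by blast
    qed
    show "norm (V k x - w x) \<le> (real CARD('m) + 1) * inverse (real (Suc k))" for k x
    proof -
      have "norm (v k x - w x) \<le> (\<Sum>i\<in>UNIV. \<bar>(v k x - w x) $ i\<bar>)" by (rule norm_le_l1_cart)
      also have "\<dots> \<le> (\<Sum>i\<in>(UNIV::'m set). \<eta> k)"
        by (rule sum_mono) (use \<eta>[of k] in \<open>simp add: v_def soft_threshold_close\<close>)
      finally have "norm (v k x - w x) \<le> real CARD('m) * \<eta> k" by simp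
      moreover have "norm (V k x - v k x) \<le> \<eta> k" using V(3)[of k x] \<epsilon>(2)[of k] \<eta>[of k] by linarith
      ultimately have "norm (V k x - w x) \<le> real CARD('m) * \<eta> k + \<eta> k"
        using norm_triangle_ineq[of "V k x - v k x" "v k x - w x"] by simp
      then show ?thesis by (simp only: \<eta>_def distrib_right mult_1)
    qed
    let ?N = "{x\<in>\<Omega>. \<nexists>M. loc_affine w x M} \<union> (\<Union>i. {x. \<exists>M. loc_affine w x M \<and> w x $ i = 0 \<and> M $ i \<noteq> 0})"
    have "negligible ?N"
      using aff negligible_zero_component[of w] by (intro negligible_Un negligible_Union) auto
    then have AE: "AE x in lebesgue. x \<notin> ?N" unfolding negligible_iff_null_sets by (rule AE_not_in)
    have "\<Omega> \<inter> space lebesgue \<in> sets lebesgue" using \<open>open \<Omega>\<close> by simp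
    note restr = AE_restrict_space_iff[OF this]
    show "AE x in lebesgue_on \<Omega>. \<forall>\<^sub>F k in sequentially. frechet_derivative (V k) (at x) = (*v) (grad w x)"
      unfolding restr using AE
    proof eventually_elim
      case (elim x)
      show ?case
      proof
        assume "x \<in> \<Omega>"
        then obtain M where M: "loc_affine w x M" using elim by blast
        have M0: "M $ i = 0" if "w x $ i = 0" for i using elim M that by blast
        obtain b where b: "\<forall>\<^sub>F y in nhds x. w y = M *v y + b" using M unfolding loc_affine_def by blast
        have b0: "b $ i = 0" if "w x $ i = 0" for i
          using eventually_nhds_x_imp_x[OF b] that M0[OF that] by (simp add: matrix_vector_mul_component)
        have "isCont (\<lambda>y. w y $ i) x" for i
          using cw by (auto intro!: continuous_intros simp: continuous_on_eq_continuous_at)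
        then have "\<exists>c>0. (\<forall>\<^sub>F y in nhds x. w y $ i > c) \<or> (\<forall>\<^sub>F y in nhds x. w y $ i < - c) \<or> w x $ i = 0" for i
          using eventually_sign[of x "\<lambda>y. w y $ i"] by metis
        then obtain c where c: "\<And>i. c i > 0"
          "\<And>i. (\<forall>\<^sub>F y in nhds x. w y $ i > c i) \<or> (\<forall>\<^sub>F y in nhds x. w y $ i < - c i) \<or> w x $ i = 0"
          by metis
        \<comment> \<open>The constant by which thresholding at level \<open>\<eta> k\<close> shifts
          component i near x, decided by the sign of the component at x; a component vanishing at x
          is identically 0 nearby and is not moved.\<close>
        define \<beta> where "\<beta> k i = (if w x $ i = 0 then 0 else if w x $ i > 0 then - \<eta> k else \<eta> k)" for k i
        have "\<forall>\<^sub>F y in nhds x. \<forall>k. \<eta> k \<le> c i \<longrightarrow> v k y $ i = w y $ i + \<beta> k i" for i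
        proof -
          consider "\<forall>\<^sub>F y in nhds x. w y $ i > c i" | "\<forall>\<^sub>F y in nhds x. w y $ i < - c i" | "w x $ i = 0"
            using c(2) by blast
          then show ?thesis
          proof cases
            case 1
            with eventually_nhds_x_imp_x[OF 1] c(1)[of i] have "\<beta> k i = - \<eta> k" for k by (simp add: \<beta>_def)
            with 1 show ?thesis using \<eta>
              by (elim eventually_mono) (auto simp: v_def soft_threshold_eq less_imp_le)
          next
            case 2
            with eventually_nhds_x_imp_x[OF 2] c(1)[of i] have "\<beta> k i = \<eta> k" for k by (simp add: \<beta>_def)
            with 2 show ?thesis using \<eta>
              by (elim eventually_mono) (auto simp: v_def soft_threshold_eq less_imp_le)
          next
            case 3
            then have "\<beta> k i = 0" for k by (simp add: \<beta>_def)
            with b M0[OF 3] b0[OF 3] show ?thesis using \<eta>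
              by (elim eventually_mono) (auto simp: v_def soft_threshold_eq less_imp_le matrix_vector_mul_component)
          qed
        qed
        then have "\<forall>\<^sub>F y in nhds x. \<forall>i k. \<eta> k \<le> c i \<longrightarrow> v k y $ i = w y $ i + \<beta> k i"
          by (rule eventually_all_finite)
        with b have "\<forall>\<^sub>F y in nhds x. \<forall>k. (\<forall>i. \<eta> k \<le> c i) \<longrightarrow> v k y = M *v y + (b + (\<chi> i. \<beta> k i))"
          by eventually_elim (simp add: vec_eq_iff)
        then obtain r where r: "r > 0"
          "\<And>y k. y \<in> ball x r \<Longrightarrow> (\<forall>i. \<eta> k \<le> c i) \<Longrightarrow> v k y = M *v y + (b + (\<chi> i. \<beta> k i))"
          unfolding eventually_nhds_metric by (auto simp: dist_commute)
        have ev: "\<forall>\<^sub>F k in sequentially. \<eta> k < a" if "a > 0" for a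
          unfolding \<eta>_def by (rule order_tendstoD(2)[OF LIMSEQ_inverse_real_of_nat that])
        have "\<forall>\<^sub>F k in sequentially. \<forall>i. \<eta> k < c i"
          by (rule eventually_all_finite) (rule ev[OF c(1)])
        with ev[OF r(1)] show "\<forall>\<^sub>F k in sequentially. frechet_derivative (V k) (at x) = (*v) (grad w x)"
        proof eventually_elim
          case (elim k)
          have "loc_affine (V k) x M"
          proof (rule V(5))
            show "\<forall>y\<in>ball x r. v k y = M *v y + (b + (\<chi> i. \<beta> k i))" using r(2) elim(2) less_imp_le by blast
            show "\<epsilon> k < r" using elim(1) \<epsilon>(3)[of k] by linarith
          qed
          from loc_affine_has_derivative[OF this] show ?case
            unfolding grad_eq[OF M] by (simp add: frechet_derivative_at[symmetric])
        qed
      qed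
    qed
  qed (rule V(2))
qed

lemma tendsto_nn_integral_norm_diff:
  fixes f :: "nat \<Rightarrow> 'a \<Rightarrow> 'b::euclidean_space"
  assumes "finite_measure M" and [measurable]: "\<And>k. f k \<in> borel_measurable M" "g \<in> borel_measurable M"
    and bnd: "\<And>k. AE x in M. norm (f k x - g x) \<le> B"
    and lim: "AE x in M. (\<lambda>k. f k x) \<longlonglongrightarrow> g x"
  shows "(\<lambda>k. \<integral>\<^sup>+x. ennreal (norm (f k x - g x)) \<partial>M) \<longlonglongrightarrow> 0"
proof -
  interpret finite_measure M by fact
  have "(\<lambda>k. \<integral>\<^sup>+x. ennreal (norm (f k x - g x)) \<partial>M) \<longlonglongrightarrow> (\<integral>\<^sup>+x. 0 \<partial>M)"
  proof (rule nn_integral_dominated_convergence[where w = "\<lambda>x. ennreal B"])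
    show "AE x in M. ennreal (norm (f k x - g x)) \<le> ennreal B" for k
      using bnd[of k] by eventually_elim (rule ennreal_leI)
    show "(\<integral>\<^sup>+x. ennreal B \<partial>M) < \<infinity>"
      by (simp add: ennreal_mult_eq_top_iff less_top[symmetric])
    show "AE x in M. (\<lambda>k. ennreal (norm (f k x - g x))) \<longlonglongrightarrow> 0"
      using lim
    proof eventually_elim
      case (elim x)
      then have "(\<lambda>k. norm (f k x - g x)) \<longlonglongrightarrow> 0" by (intro tendsto_norm_zero LIM_zero)
      from tendsto_ennrealI[OF this] show ?case by simp
    qed
  qed auto
  then show ?thesis by simp
qed

lemma jacobian_component: "jacobian f net $ i $ j = frechet_derivative f net (axis j 1) $ i"
  by (simp add: jacobian_def matrix_def)

lemma test_function_jacobian_borel: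
  fixes \<phi> :: "real^'n \<Rightarrow> real^'m"
  assumes "\<phi> \<in> test_functions \<Omega>"
  shows "(\<lambda>x. jacobian \<phi> (at x)) \<in> borel_measurable borel"
  unfolding jacobian_def matrix_def
  by (intro borel_measurable_continuous_onI continuous_on_vec_lambda continuous_on_component
      test_function_continuous_derivative[OF assms])

text \<open>The approximating test functions converge uniformly, and their gradients are uniformly
  bounded and almost everywhere eventually equal to \<open>grad w\<close>; as \<Omega> has finite
  measure, dominated convergence gives convergence in W^{1,1}.\<close>

lemma W11_0_lipschitz:
  fixes w :: "real^'n \<Rightarrow> real^'m"
  assumes lip: "L-lipschitz_on UNIV w" and "open \<Omega>" "bounded \<Omega>"
    and off: "\<And>x. x \<notin> \<Omega> \<Longrightarrow> w x = 0"
    and aff: "negligible {x\<in>\<Omega>. \<nexists>M. loc_affine w x M}"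
  shows "w \<in> W11_0 \<Omega>"
proof -
  obtain \<phi> C where \<phi>: "\<And>k::nat. \<phi> k \<in> test_functions \<Omega>" "\<And>k. L-lipschitz_on UNIV (\<phi> k)"
    "\<And>k x. norm (\<phi> k x - w x) \<le> C * inverse (real (Suc k))"
    "AE x in lebesgue_on \<Omega>. \<forall>\<^sub>F k in sequentially. frechet_derivative (\<phi> k) (at x) = (*v) (grad w x)"
    by (rule test_function_approximation[OF assms], assumption, rule that)
  have lm: "\<Omega> \<in> lmeasurable" using \<open>bounded \<Omega>\<close> \<open>open \<Omega>\<close> by (rule lmeasurable_open)
  have fin: "finite_measure (lebesgue_on \<Omega>)" by (rule finite_measure_lebesgue_on[OF lm])
  have C: "C \<ge> 0" using order_trans[OF norm_ge_zero \<phi>(3)[of 0 undefined]] by simp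
  have mw: "w \<in> borel_measurable (lebesgue_on \<Omega>)"
    by (rule borel_measurable_lebesgue_on[OF lipschitz_borel[OF lip]])
  have mg: "grad w \<in> borel_measurable (lebesgue_on \<Omega>)"
    by (rule borel_measurable_lebesgue_on[OF grad_borel])
  obtain B where B: "\<And>x. x \<in> \<Omega> \<Longrightarrow> norm (w x) \<le> B"
    by (rule lipschitz_bounded_on[OF lip \<open>bounded \<Omega>\<close>]) blast
  have c0: "(\<lambda>k. C * inverse (real (Suc k))) \<longlonglongrightarrow> 0"
    using tendsto_mult[OF tendsto_const LIMSEQ_inverse_real_of_nat, of C] by simp
  have "(\<lambda>k. \<integral>\<^sup>+x. ennreal (norm (\<phi> k x - w x)) \<partial>lebesgue_on \<Omega>) \<longlonglongrightarrow> 0"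
  proof (rule tendsto_nn_integral_norm_diff[OF fin _ mw])
    show "\<phi> k \<in> borel_measurable (lebesgue_on \<Omega>)" for k
      by (rule borel_measurable_lebesgue_on[OF lipschitz_borel[OF \<phi>(2)]])
    have "norm (\<phi> k x - w x) \<le> C" for k x
    proof (rule order_trans[OF \<phi>(3)])
      have "inverse (real (Suc k)) \<le> 1" by (simp add: divide_simps)
      then show "C * inverse (real (Suc k)) \<le> C" using C by (rule mult_left_le)
    qed
    then show "AE x in lebesgue_on \<Omega>. norm (\<phi> k x - w x) \<le> C" for k by (intro AE_I2)
    have "(\<lambda>k. \<phi> k x) \<longlonglongrightarrow> w x" for x
      by (rule LIM_zero_cancel, rule Lim_null_comparison[OF _ c0]) (use \<phi>(3) in auto)
    then show "AE x in lebesgue_on \<Omega>. (\<lambda>k. \<phi> k x) \<longlonglongrightarrow> w x" by (intro AE_I2)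
  qed
  moreover have "(\<lambda>k. \<integral>\<^sup>+x. ennreal (norm (jacobian (\<phi> k) (at x) - grad w x)) \<partial>lebesgue_on \<Omega>) \<longlonglongrightarrow> 0"
  proof (rule tendsto_nn_integral_norm_diff[OF fin _ mg])
    show "(\<lambda>x. jacobian (\<phi> k) (at x)) \<in> borel_measurable (lebesgue_on \<Omega>)" for k
      by (rule borel_measurable_lebesgue_on[OF test_function_jacobian_borel[OF \<phi>(1)]])
    let ?B = "real CARD('m) * (real CARD('n) * L)"
    have "norm (jacobian (\<phi> k) (at x) - grad w x) \<le> ?B + ?B" for k x
    proof (rule order_trans[OF norm_triangle_ineq4 add_mono])
      show "norm (grad w x) \<le> ?B" by (rule grad_norm_bound[OF lip])
      show "norm (jacobian (\<phi> k) (at x)) \<le> ?B"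
      proof (rule norm_matrix_le)
        show "\<bar>jacobian (\<phi> k) (at x) $ i $ j\<bar> \<le> L" for i j
          unfolding jacobian_component
          by (rule lipschitz_derivative_component[OF \<phi>(2) test_function_has_derivative[OF \<phi>(1)]])
      qed
    qed
    then show "AE x in lebesgue_on \<Omega>. norm (jacobian (\<phi> k) (at x) - grad w x) \<le> ?B + ?B" for k
      by (intro AE_I2)
    show "AE x in lebesgue_on \<Omega>. (\<lambda>k. jacobian (\<phi> k) (at x)) \<longlonglongrightarrow> grad w x"
      using \<phi>(4)
    proof eventually_elim
      case (elim x)
      then have "\<forall>\<^sub>F k in sequentially. jacobian (\<phi> k) (at x) = grad w x"
        by eventually_elim (simp add: jacobian_def)
      then show ?case by (rule tendsto_eventually)
    qed
  qed
  moreover have "integrable (lebesgue_on \<Omega>) w" by (rule integrable_lebesgue_on_bounded[OF lm mw B])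
  moreover have "integrable (lebesgue_on \<Omega>) (grad w)"
    by (rule integrable_lebesgue_on_bounded[OF lm mg grad_norm_bound[OF lip]])
  moreover have "has_weak_gradient \<Omega> w (grad w)" by (rule has_weak_gradient_grad[OF lip \<open>open \<Omega>\<close> aff])
  ultimately show ?thesis using \<phi>(1) unfolding W11_0_def by blast
qed

text \<open>The bound passes from test functions to w in the limit. It involves the supremum bound s
  of w but not its Lipschitz constant L, so it can be applied along a sequence with unbounded
  L.\<close>

lemma integral_grad_lipschitz_bound:
  fixes w :: "real^'n \<Rightarrow> real^'m" and h :: "real^'n \<Rightarrow> real"
  assumes lip: "L-lipschitz_on UNIV w" and "open \<Omega>" "bounded \<Omega>"
    and off: "\<And>x. x \<notin> \<Omega> \<Longrightarrow> w x = 0"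
    and aff: "negligible {x\<in>\<Omega>. \<nexists>M. loc_affine w x M}"
    and h: "H-lipschitz_on UNIV h" and small: "\<And>x. norm (w x) \<le> s"
  shows "\<bar>LINT x|lebesgue_on \<Omega>. grad w x $ i $ j * h x\<bar> \<le> H * (s * measure lebesgue \<Omega>)"
proof -
  obtain \<phi> C where \<phi>: "\<And>k::nat. \<phi> k \<in> test_functions \<Omega>" "\<And>k. L-lipschitz_on UNIV (\<phi> k)"
    "\<And>k x. norm (\<phi> k x - w x) \<le> C * inverse (real (Suc k))"
    "AE x in lebesgue_on \<Omega>. \<forall>\<^sub>F k in sequentially. frechet_derivative (\<phi> k) (at x) = (*v) (grad w x)"
    by (rule test_function_approximation[OF assms(1-5)], assumption, rule that)
  have lm: "\<Omega> \<in> lmeasurable" using \<open>bounded \<Omega>\<close> \<open>open \<Omega>\<close> by (rule lmeasurable_open)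
  have fin: "finite_measure (lebesgue_on \<Omega>)" by (rule finite_measure_lebesgue_on[OF lm])
  have \<Omega>b: "\<Omega> \<in> sets borel" using \<open>open \<Omega>\<close> by simp
  have H: "H \<ge> 0" by (rule lipschitz_on_nonneg[OF h])
  obtain B where B: "\<And>x. x \<in> \<Omega> \<Longrightarrow> norm (h x) \<le> B"
    by (rule lipschitz_bounded_on[OF h \<open>bounded \<Omega>\<close>]) blast
  have hb [measurable]: "h \<in> borel_measurable borel" by (rule lipschitz_borel[OF h])
  let ?J = "\<lambda>k x. frechet_derivative (\<phi> k) (at x) (axis j 1) $ i"
  have Jb [measurable]: "?J k \<in> borel_measurable borel" for k
    by (intro borel_measurable_continuous_onI continuous_on_component test_function_continuous_derivative[OF \<phi>(1)])
  have \<phi>b: "(\<lambda>x. \<bar>\<phi> k x $ i\<bar>) \<in> borel_measurable borel" for k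
    using lipschitz_borel[OF lipschitz_component[OF \<phi>(2)]] by measurable
  have bound: "\<bar>LINT x|lebesgue_on \<Omega>. ?J k x * h x\<bar> \<le> H * ((s + C * inverse (real (Suc k))) * measure lebesgue \<Omega>)" for k
  proof -
    note off\<phi> = test_function_derivative_off[OF \<phi>(1)[of k]]
    obtain R where R: "\<And>x. norm x > R \<Longrightarrow> \<phi> k x = 0" by (rule test_function_bounded_support[OF \<phi>(1)]) blast
    have d: "((\<lambda>y. \<phi> k y $ i) has_derivative (\<lambda>v. frechet_derivative (\<phi> k) (at x) v $ i)) (at x)" for x
      using has_derivative_compose[OF test_function_has_derivative[OF \<phi>(1)[of k]]
        bounded_linear_imp_has_derivative[OF bounded_linear_vec_nth]] by simp
    have "(LINT x|lebesgue_on \<Omega>. ?J k x * h x) = (LINT x|lborel. ?J k x * h x)"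
      by (rule integral_lebesgue_on_eq_lborel[OF \<Omega>b]) (use off\<phi>(2) in auto)
    also have "\<bar>\<dots>\<bar> \<le> H * norm (axis j 1 :: real^'n) * (LINT x|lborel. \<bar>\<phi> k x $ i\<bar>)"
      by (rule integral_deriv_lipschitz_bound[OF lipschitz_component[OF \<phi>(2)] _ d h, where R = R]) (simp add: R)
    also have "(LINT x|lborel. \<bar>\<phi> k x $ i\<bar>) = (LINT x|lebesgue_on \<Omega>. \<bar>\<phi> k x $ i\<bar>)"
      by (rule integral_lebesgue_on_eq_lborel[OF \<Omega>b \<phi>b, symmetric]) (use off\<phi>(1) in auto)
    also have "\<dots> \<le> (LINT x|lebesgue_on \<Omega>. s + C * inverse (real (Suc k)))"
    proof (rule integral_mono)
      have le: "\<bar>\<phi> k x $ i\<bar> \<le> s + C * inverse (real (Suc k))" for x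
        using \<phi>(3)[of k x] small[of x] component_le_norm_cart[of "\<phi> k x" i] norm_triangle_ineq2[of "\<phi> k x" "w x"]
        by linarith
      then show "\<bar>\<phi> k x $ i\<bar> \<le> s + C * inverse (real (Suc k))" for x .
      show "integrable (lebesgue_on \<Omega>) (\<lambda>x. \<bar>\<phi> k x $ i\<bar>)"
        by (rule integrable_lebesgue_on_bounded[OF lm borel_measurable_lebesgue_on[OF \<phi>b]]) (use le in simp)
      show "integrable (lebesgue_on \<Omega>) (\<lambda>x. s + C * inverse (real (Suc k)))"
        by (rule finite_measure.integrable_const[OF fin])
    qed
    also have "\<dots> = (s + C * inverse (real (Suc k))) * measure lebesgue \<Omega>"
      using lm by (simp add: measure_restrict_space fmeasurableD)
    finally show ?thesis using H by (simp add: mult_left_mono)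
  qed
  have "(\<lambda>k. LINT x|lebesgue_on \<Omega>. ?J k x * h x) \<longlonglongrightarrow> (LINT x|lebesgue_on \<Omega>. grad w x $ i $ j * h x)"
  proof (rule integral_dominated_convergence[where w = "\<lambda>x. L * B"])
    show "(\<lambda>x. grad w x $ i $ j * h x) \<in> borel_measurable (lebesgue_on \<Omega>)"
      by (rule borel_measurable_lebesgue_on) measurable
    show "(\<lambda>x. ?J k x * h x) \<in> borel_measurable (lebesgue_on \<Omega>)" for k
      by (rule borel_measurable_lebesgue_on) measurable
    show "integrable (lebesgue_on \<Omega>) (\<lambda>x. L * B)"
      by (rule finite_measure.integrable_const[OF fin])
    show "AE x in lebesgue_on \<Omega>. norm (?J k x * h x) \<le> L * B" for k
    proof (rule AE_I2)
      fix x assume "x \<in> space (lebesgue_on \<Omega>)"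
      then have "\<bar>h x\<bar> \<le> B" using B[of x] by simp
      then show "norm (?J k x * h x) \<le> L * B"
        using lipschitz_derivative_component[OF \<phi>(2) test_function_has_derivative[OF \<phi>(1)], of k x j i]
          lipschitz_on_nonneg[OF lip]
        by (simp add: abs_mult mult_mono)
    qed
    show "AE x in lebesgue_on \<Omega>. (\<lambda>k. ?J k x * h x) \<longlonglongrightarrow> grad w x $ i $ j * h x"
      using \<phi>(4)
    proof eventually_elim
      case (elim x)
      then have "\<forall>\<^sub>F k in sequentially. ?J k x * h x = grad w x $ i $ j * h x"
        by eventually_elim (simp add: matrix_vector_mult_basis column_def)
      then show ?case by (rule tendsto_eventually)
    qed
  qed
  moreover have "(\<lambda>k. H * ((s + C * inverse (real (Suc k))) * measure lebesgue \<Omega>)) \<longlonglongrightarrow> H * ((s + C * 0) * measure lebesgue \<Omega>)"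
    by (intro tendsto_intros LIMSEQ_inverse_real_of_nat)
  ultimately have "\<bar>LINT x|lebesgue_on \<Omega>. grad w x $ i $ j * h x\<bar> \<le> H * ((s + C * 0) * measure lebesgue \<Omega>)"
    using bound by (intro LIMSEQ_le[OF tendsto_rabs]) auto
  then show ?thesis by simp
qed

text \<open>The weight 1 has Lipschitz constant 0, which makes the preceding bound 0.\<close>

lemma integral_grad_zero:
  fixes w :: "real^'n \<Rightarrow> real^'m"
  assumes lip: "L-lipschitz_on UNIV w" and "open \<Omega>" "bounded \<Omega>"
    and off: "\<And>x. x \<notin> \<Omega> \<Longrightarrow> w x = 0"
    and aff: "negligible {x\<in>\<Omega>. \<nexists>M. loc_affine w x M}"
  shows "(LINT x|lebesgue_on \<Omega>. grad w x $ i $ j) = 0"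
proof -
  obtain B where "\<And>x. x \<in> \<Omega> \<Longrightarrow> norm (w x) \<le> B"
    by (rule lipschitz_bounded_on[OF lip \<open>bounded \<Omega>\<close>]) blast
  then have "norm (w x) \<le> max B 0" for x using off[of x] by (cases "x \<in> \<Omega>") (auto simp: le_max_iff_disj)
  moreover have "0-lipschitz_on UNIV (\<lambda>x::real^'n. 1::real)" by (auto intro: lipschitz_onI)
  ultimately have "\<bar>LINT x|lebesgue_on \<Omega>. grad w x $ i $ j * 1\<bar> \<le> 0 * (max B 0 * measure lebesgue \<Omega>)"
    by (intro integral_grad_lipschitz_bound[OF assms])
  then show ?thesis by simp
qed

subsection \<open>Weak* convergence of gradients\<close>

text \<open>Since the \<open>g k\<close> are uniformly bounded, the weights against which they tend
  to 0 form a closed set in L^1.\<close>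

lemma tendsto_integral_mult_closure:
  fixes g :: "nat \<Rightarrow> 'a \<Rightarrow> real"
  assumes g: "\<And>k. g k \<in> borel_measurable M" "\<And>k. AE x in M. \<bar>g k x\<bar> \<le> B"
    and h: "integrable M h"
    and approx: "\<And>e. e > 0 \<Longrightarrow> \<exists>h'. integrable M h' \<and> (\<lambda>k. LINT x|M. g k x * h' x) \<longlonglongrightarrow> 0 \<and>
        (LINT x|M. \<bar>h x - h' x\<bar>) < e"
  shows "(\<lambda>k. LINT x|M. g k x * h x) \<longlonglongrightarrow> 0"
proof (rule LIMSEQ_I)
  fix e :: real assume "e > 0"
  define B' where "B' = max B 0 + 1"
  have B': "B' > 0" by (simp add: B'_def)
  have gB: "AE x in M. \<bar>g k x\<bar> \<le> B'" for k using g(2)[of k] by eventually_elim (simp add: B'_def)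
  have gi: "integrable M (\<lambda>x. g k x * f x)" if "integrable M f" for k and f :: "'a \<Rightarrow> real"
  proof (rule Bochner_Integration.integrable_bound)
    show "integrable M (\<lambda>x. B' * f x)" using that by (rule integrable_mult_right)
    show "(\<lambda>x. g k x * f x) \<in> borel_measurable M" using g(1) that by measurable
    show "AE x in M. norm (g k x * f x) \<le> norm (B' * f x)"
      using gB[of k] by eventually_elim (use B' in \<open>simp add: abs_mult mult_right_mono\<close>)
  qed
  have "e / (2 * B') > 0" using \<open>e > 0\<close> B' by simp
  then obtain h' where h': "integrable M h'" "(\<lambda>k. LINT x|M. g k x * h' x) \<longlonglongrightarrow> 0"
    "(LINT x|M. \<bar>h x - h' x\<bar>) < e / (2 * B')" using approx by blast
  obtain K where K: "\<And>k. k \<ge> K \<Longrightarrow> norm ((LINT x|M. g k x * h' x) - 0) < e / 2"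
    using LIMSEQ_D[OF h'(2), of "e / 2"] \<open>e > 0\<close> by auto
  have "norm ((LINT x|M. g k x * h x) - 0) < e" if "k \<ge> K" for k
  proof -
    have "\<bar>(LINT x|M. g k x * h x) - (LINT x|M. g k x * h' x)\<bar> = \<bar>LINT x|M. g k x * (h x - h' x)\<bar>"
      using gi[OF h, of k] gi[OF h'(1), of k] by (simp add: right_diff_distrib)
    also have "\<dots> \<le> (LINT x|M. \<bar>g k x * (h x - h' x)\<bar>)" by (rule integral_abs_bound)
    also have "\<dots> \<le> (LINT x|M. B' * \<bar>h x - h' x\<bar>)"
    proof (rule integral_mono_AE)
      show "integrable M (\<lambda>x. \<bar>g k x * (h x - h' x)\<bar>)" using gi h h'(1) by (intro integrable_abs) auto
      show "integrable M (\<lambda>x. B' * \<bar>h x - h' x\<bar>)" using h h'(1) by (intro integrable_mult_right integrable_abs) auto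
      show "AE x in M. \<bar>g k x * (h x - h' x)\<bar> \<le> B' * \<bar>h x - h' x\<bar>"
        using gB[of k] by eventually_elim (simp add: abs_mult mult_right_mono)
    qed
    also have "\<dots> = B' * (LINT x|M. \<bar>h x - h' x\<bar>)" by simp
    also have "\<dots> < B' * (e / (2 * B'))" using h'(3) B' by (intro mult_strict_left_mono)
    also have "\<dots> = e / 2" using B' by simp
    finally show ?thesis using K[OF that] unfolding real_norm_def diff_zero by linarith
  qed
  then show "\<exists>no. \<forall>k\<ge>no. norm ((LINT x|M. g k x * h x) - 0) < e" by blast
qed

text \<open>For closed nonempty F these functions decrease to its indicator. Their Lipschitz
  constants grow with n, which is harmless because n is fixed before the index of the sequence tends
  to infinity.\<close>

lemma lipschitz_bump_infdist:
  fixes F :: "'a::metric_space set"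
  shows "(real n)-lipschitz_on UNIV (\<lambda>x. max 0 (1 - real n * infdist x F))"
proof (rule lipschitz_onI)
  fix x y
  have *: "\<bar>infdist x F - infdist y F\<bar> \<le> dist x y" by (rule infdist_triangle_abs)
  have "\<bar>real n * infdist x F - real n * infdist y F\<bar> \<le> real n * dist x y"
    using mult_left_mono[OF * of_nat_0_le_iff[of n]] by (simp add: abs_mult flip: right_diff_distrib)
  then show "dist (max 0 (1 - real n * infdist x F)) (max 0 (1 - real n * infdist y F)) \<le> real n * dist x y"
    by (auto simp: dist_real_def max_def)
qed simp

text \<open>Density in stages: Lipschitz functions give indicators of closed sets, inner regularity
  gives measurable sets, and the induction principle for integrable functions gives the rest. Each
  passage to a limit is an L^1 approximation of the weight.\<close>

lemma tendsto_integral_mult_lipschitz_dense: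
  fixes g :: "nat \<Rightarrow> real^'n \<Rightarrow> real"
  assumes \<Omega>: "\<Omega> \<in> lmeasurable"
    and g: "\<And>k. g k \<in> borel_measurable (lebesgue_on \<Omega>)" "\<And>k. AE x in lebesgue_on \<Omega>. \<bar>g k x\<bar> \<le> B"
    and lip: "\<And>H h. H-lipschitz_on UNIV h \<Longrightarrow> (\<lambda>k. LINT x|lebesgue_on \<Omega>. g k x * h x) \<longlonglongrightarrow> 0"
    and h: "integrable (lebesgue_on \<Omega>) h"
  shows "(\<lambda>k. LINT x|lebesgue_on \<Omega>. g k x * h x) \<longlonglongrightarrow> 0"
proof -
  let ?M = "lebesgue_on \<Omega>"
  have \<Omega>': "\<Omega> \<inter> space lebesgue \<in> sets lebesgue" using \<Omega> by (simp add: fmeasurableD)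
  interpret finite_measure ?M by (rule finite_measure_lebesgue_on[OF \<Omega>])
  note closure = tendsto_integral_mult_closure[OF g]
  \<comment> \<open>Nonempty, because \<open>infdist\<close> to the empty set is 0 and the bumps
    would then be 1 everywhere; the empty set has indicator 0 and is treated where it
    occurs.\<close>
  have closed: "(\<lambda>k. LINT x|?M. g k x * indicator F x) \<longlonglongrightarrow> 0" if F: "closed F" "F \<noteq> {}" for F :: "(real^'n) set"
  proof (rule closure)
    have bF: "(indicator F :: _ \<Rightarrow> real) \<in> borel_measurable ?M"
      by (rule borel_measurable_lebesgue_on) (use F in simp)
    show "integrable ?M (indicator F :: _ \<Rightarrow> real)"
      by (rule integrable_lebesgue_on_bounded[OF \<Omega> bF, where C = 1]) (simp add: indicator_def)
    fix e :: real assume "e > 0"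
    let ?h = "\<lambda>n x. max 0 (1 - real n * infdist x F)"
    have bh: "?h n \<in> borel_measurable ?M" for n
      by (rule borel_measurable_lebesgue_on[OF lipschitz_borel[OF lipschitz_bump_infdist]])
    have h1: "\<bar>?h n x\<bar> \<le> 1" for n x by (simp add: infdist_nonneg)
    have ih: "integrable ?M (?h n)" for n
      by (rule integrable_lebesgue_on_bounded[OF \<Omega> bh, where C = 1]) (use h1 in simp)
    have "(\<lambda>n. LINT x|?M. \<bar>indicator F x - ?h n x\<bar>) \<longlonglongrightarrow> (LINT x|?M. 0)"
    proof (rule integral_dominated_convergence[where w = "\<lambda>x. 2"])
      show "AE x in ?M. norm \<bar>indicator F x - ?h n x\<bar> \<le> 2" for n
      proof (rule AE_I2)
        fix x
        have "\<bar>indicator F x :: real\<bar> \<le> 1" by (simp add: indicator_def)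
        with h1[of n x] show "norm \<bar>indicator F x - ?h n x\<bar> \<le> 2"
          unfolding real_norm_def by linarith
      qed
      show "AE x in ?M. (\<lambda>n. \<bar>indicator F x - ?h n x\<bar>) \<longlonglongrightarrow> 0"
      proof (rule AE_I2)
        fix x
        show "(\<lambda>n. \<bar>indicator F x - ?h n x\<bar>) \<longlonglongrightarrow> 0"
        proof (cases "x \<in> F")
          case True
          then show ?thesis by simp
        next
          case False
          then have pos: "infdist x F > 0" using in_closed_iff_infdist_zero[OF F, of x] infdist_nonneg[of x F] by linarith
          obtain N where N: "inverse (infdist x F) < real N" using reals_Archimedean2 by blast
          have "\<bar>indicator F x - ?h n x\<bar> = 0" if "n \<ge> N" for n
          proof -
            have "inverse (infdist x F) \<le> real n" using N that by (simp add: less_le_trans less_imp_le)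
            then have "1 \<le> real n * infdist x F" using pos by (simp add: field_simps)
            then show ?thesis using False by simp
          qed
          then show ?thesis by (intro tendsto_eventually) (auto simp: eventually_sequentially)
        qed
      qed
      show "(\<lambda>x. \<bar>indicator F x - ?h n x\<bar>) \<in> borel_measurable ?M" for n
        using bF bh by measurable
    qed auto
    then have "\<forall>\<^sub>F n in sequentially. (LINT x|?M. \<bar>indicator F x - ?h n x\<bar>) < e"
      using \<open>e > 0\<close> by (intro order_tendstoD(2)) auto
    then obtain n where "(LINT x|?M. \<bar>indicator F x - ?h n x\<bar>) < e" by (auto simp: eventually_sequentially)
    then show "\<exists>h'. integrable ?M h' \<and> (\<lambda>k. LINT x|?M. g k x * h' x) \<longlonglongrightarrow> 0 \<and> (LINT x|?M. \<bar>indicator F x - h' x\<bar>) < e"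
      using ih lip[OF lipschitz_bump_infdist] by blast
  qed
  have ind: "(\<lambda>k. LINT x|?M. g k x * indicator A x) \<longlonglongrightarrow> 0" if A: "A \<in> sets ?M" for A
  proof (rule closure)
    show "integrable ?M (indicator A :: _ \<Rightarrow> real)"
      by (rule integrable_real_indicator) (use A in \<open>auto simp: emeasure_finite less_top[symmetric]\<close>)
    fix e :: real assume "e > 0"
    have A': "A \<in> sets lebesgue" using A sets_restrict_space_iff[OF \<Omega>'] by blast
    obtain F where F: "closed F" "F \<subseteq> A" "A - F \<in> lmeasurable" "emeasure lebesgue (A - F) < ennreal e"
      by (rule sets_lebesgue_inner_closed[OF A' \<open>e > 0\<close>])
    have bF: "(indicator F :: _ \<Rightarrow> real) \<in> borel_measurable ?M"
      by (rule borel_measurable_lebesgue_on) (use F in simp)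
    have iF: "integrable ?M (indicator F :: _ \<Rightarrow> real)"
      by (rule integrable_lebesgue_on_bounded[OF \<Omega> bF, where C = 1]) (simp add: indicator_def)
    have "A \<subseteq> \<Omega>" using A sets_restrict_space_iff[OF \<Omega>'] by blast
    have "(\<lambda>x. \<bar>indicator A x - indicator F x :: real\<bar>) = indicator (A - F)"
      by (rule ext) (use F(2) in \<open>auto simp: indicator_def\<close>)
    then have "(LINT x|?M. \<bar>indicator A x - indicator F x :: real\<bar>) = measure ?M (A - F)"
      using Int_absorb2[of "A - F" \<Omega>] \<open>A \<subseteq> \<Omega>\<close> by (simp add: Diff_subset[THEN subset_trans])
    also have "\<dots> = measure lebesgue (A - F)"
      using \<open>A \<subseteq> \<Omega>\<close> by (intro measure_restrict_space[OF \<Omega>']) auto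
    also have "\<dots> < e" using F(3,4) \<open>e > 0\<close>
      by (simp add: emeasure_eq_measure2 ennreal_less_iff)
    finally have "(LINT x|?M. \<bar>indicator A x - indicator F x :: real\<bar>) < e" .
    moreover have "(\<lambda>k. LINT x|?M. g k x * indicator F x) \<longlonglongrightarrow> 0"
      using closed[OF F(1)] by (cases "F = {}") auto
    ultimately show "\<exists>h'. integrable ?M h' \<and> (\<lambda>k. LINT x|?M. g k x * h' x) \<longlonglongrightarrow> 0 \<and> (LINT x|?M. \<bar>indicator A x - h' x\<bar>) < e"
      using iF by blast
  qed
  from h show ?thesis
  proof (induct rule: integrable_induct)
    case (base A c)
    have "(\<lambda>k. (LINT x|?M. g k x * indicator A x) * c) \<longlonglongrightarrow> 0 * c"
      by (rule tendsto_mult[OF ind[OF base(1)] tendsto_const])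
    moreover have "(LINT x|?M. g k x * indicator A x) * c = (LINT x|?M. g k x * (indicator A x *\<^sub>R c))" for k
      by (subst integral_mult_left_zero[symmetric]) (simp add: mult.assoc)
    ultimately show ?case by simp
  next
    case (add f h)
    have gi: "integrable ?M (\<lambda>x. g k x * f x)" if "integrable ?M f" for k f
    proof (rule Bochner_Integration.integrable_bound)
      show "integrable ?M (\<lambda>x. B * f x)" using that by (rule integrable_mult_right)
      show "(\<lambda>x. g k x * f x) \<in> borel_measurable ?M" using g(1) that by measurable
      show "AE x in ?M. norm (g k x * f x) \<le> norm (B * f x)"
        using g(2)[of k] by eventually_elim (simp add: abs_mult mult_right_mono)
    qed
    have "(LINT x|?M. g k x * (f x + h x)) = (LINT x|?M. g k x * f x) + (LINT x|?M. g k x * h x)" for k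
      using gi[OF add(1), of k] gi[OF add(3), of k] by (simp add: distrib_left)
    then show ?case using tendsto_add[OF add(2,4)] by simp
  next
    case (lim f s)
    show ?case
    proof (rule closure[OF lim(5)])
      fix e :: real assume "e > 0"
      have "(\<lambda>n. LINT x|?M. \<bar>f x - s n x\<bar>) \<longlonglongrightarrow> (LINT x|?M. 0)"
      proof (rule integral_dominated_convergence[where w = "\<lambda>x. 3 * \<bar>f x\<bar>"])
        show "AE x in ?M. (\<lambda>n. \<bar>f x - s n x\<bar>) \<longlonglongrightarrow> 0"
        proof (rule AE_I2)
          fix x assume "x \<in> space ?M"
          from tendsto_rabs[OF tendsto_diff[OF tendsto_const[of "f x"] lim(3)[OF this]]]
          show "(\<lambda>n. \<bar>f x - s n x\<bar>) \<longlonglongrightarrow> 0" by simp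
        qed
        show "AE x in ?M. norm \<bar>f x - s n x\<bar> \<le> 3 * \<bar>f x\<bar>" for n
        proof (rule AE_I2)
          fix x assume "x \<in> space ?M"
          from lim(4)[OF this, of n] show "norm \<bar>f x - s n x\<bar> \<le> 3 * \<bar>f x\<bar>" by simp
        qed
        show "(\<lambda>x. \<bar>f x - s n x\<bar>) \<in> borel_measurable ?M" for n using lim(1)[of n] lim(5) by measurable
        show "integrable ?M (\<lambda>x. 3 * \<bar>f x\<bar>)" using lim(5) by auto
      qed auto
      then have "\<forall>\<^sub>F n in sequentially. (LINT x|?M. \<bar>f x - s n x\<bar>) < e"
        using \<open>e > 0\<close> by (intro order_tendstoD(2)) auto
      then obtain n where "(LINT x|?M. \<bar>f x - s n x\<bar>) < e" by (auto simp: eventually_sequentially)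
      then show "\<exists>h'. integrable ?M h' \<and> (\<lambda>k. LINT x|?M. g k x * h' x) \<longlonglongrightarrow> 0 \<and> (LINT x|?M. \<bar>f x - h' x\<bar>) < e"
        using lim(1,2) by blast
    qed
  qed
qed

subsection \<open>Covering a domain by copies of a convex set\<close>

definition affine_copy :: "(real^'n) set \<Rightarrow> (real^'n) \<times> real \<Rightarrow> (real^'n) set" where
  "affine_copy D p = (\<lambda>x. fst p + snd p *\<^sub>R x) ` D"

text \<open>A Vitali covering fills \<Omega> with disjoint balls, finitely many of which carry at
  least half of the measure. Each ball holds a scaled copy of D that fills a fixed proportion of it.
  Closures of copies are used so that removing finitely many leaves an open set, to which the lemma
  applies again with the same c.\<close>

lemma copies_cover_fraction:
  fixes D :: "(real^'n) set"
  assumes D: "open D" "bounded D" "0 \<in> D"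
  obtains c where "0 < c" "c \<le> 1"
    "\<And>\<eta> \<Omega>. \<eta> > 0 \<Longrightarrow> open \<Omega> \<Longrightarrow> bounded \<Omega> \<Longrightarrow> \<exists>C. finite C \<and> (\<forall>p\<in>C. 0 < snd p \<and> snd p < \<eta> \<and> closure (affine_copy D p) \<subseteq> \<Omega>) \<and>
       pairwise (\<lambda>p q. disjnt (closure (affine_copy D p)) (closure (affine_copy D q))) C \<and>
       c * measure lebesgue \<Omega> \<le> measure lebesgue (\<Union>p\<in>C. closure (affine_copy D p))"
proof -
  obtain \<rho> where \<rho>: "\<rho> > 0" "ball 0 \<rho> \<subseteq> D" using D open_contains_ball by blast
  obtain R' where R': "\<forall>x\<in>D. norm x \<le> R'" using D(2) unfolding bounded_iff ..
  \<comment> \<open>R strictly exceeds the radius of D, so that the closure of a copy at scale s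
    lies in the open ball of radius R s.\<close>
  define R where "R = max R' \<rho> + 1"
  have R: "R > 0" "R' < R" "\<rho> \<le> R" using \<rho> by (auto simp: R_def)
  let ?N = "CARD('n)"
  \<comment> \<open>A copy contains the ball of radius \<rho> s inside the one of radius R s; the
    factor 1/2 pays for keeping finitely many balls.\<close>
  define c where "c = (\<rho> / R) ^ ?N / 2"
  have c: "0 < c" "c \<le> 1"
  proof -
    have "(\<rho> / R) ^ ?N \<le> 1" using R \<rho> by (intro power_le_one) auto
    then show "c \<le> 1" by (simp add: c_def)
    show "0 < c" using R \<rho> by (simp add: c_def)
  qed
  have inner: "ball x (\<rho> * s) \<subseteq> affine_copy D (x, s)" if "s > 0" for x s
  proof
    fix y assume y: "y \<in> ball x (\<rho> * s)"
    have "norm (y - x) / s < \<rho>" using y that by (simp add: dist_norm norm_minus_commute field_simps)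
    moreover have "norm ((y - x) /\<^sub>R s) = norm (y - x) / s"
      using that by (simp only: norm_scaleR) (simp add: divide_inverse mult.commute)
    ultimately have "norm ((y - x) /\<^sub>R s) < \<rho>" by simp
    then have "(y - x) /\<^sub>R s \<in> D" using \<rho>(2) by auto
    moreover have "y = x + s *\<^sub>R ((y - x) /\<^sub>R s)" using that by simp
    ultimately show "y \<in> affine_copy D (x, s)" unfolding affine_copy_def fst_conv snd_conv by (rule rev_image_eqI)
  qed
  have outer: "closure (affine_copy D (x, s)) \<subseteq> ball x (R * s)" if "s > 0" for x s
  proof -
    have "affine_copy D (x, s) \<subseteq> cball x (R' * s)"
      using R' that by (auto simp: affine_copy_def dist_norm mult.commute mult_left_mono)
    then have "closure (affine_copy D (x, s)) \<subseteq> cball x (R' * s)" by (rule closure_minimal) simp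
    also have "\<dots> \<subseteq> ball x (R * s)" using mult_strict_right_mono[OF R(2) that] by auto
    finally show ?thesis .
  qed
  show ?thesis
  proof (rule that[OF c])
    fix \<eta> :: real and \<Omega> :: "(real^'n) set" assume \<eta>: "\<eta> > 0" and \<Omega>: "open \<Omega>" "bounded \<Omega>"
    have lm: "\<Omega> \<in> lmeasurable" using \<Omega> by (simp add: lmeasurable_open)
    \<comment> \<open>A ball of radius s receives a copy at scale s / R, hence the bound \<eta> R on
      the radii.\<close>
    define K where "K = {p :: (real^'n) \<times> real. 0 < snd p \<and> snd p < \<eta> * R \<and> ball (fst p) (snd p) \<subseteq> \<Omega>}"
    have "\<exists>i. i \<in> K \<and> x \<in> ball (fst i) (snd i) \<and> snd i < d" if x: "x \<in> \<Omega>" and d: "0 < d" for x d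
    proof -
      obtain k where k: "k > 0" "ball x k \<subseteq> \<Omega>" using \<Omega>(1) x open_contains_ball by blast
      define s where "s = min k (min (d/2) (\<eta> * R / 2))"
      have s: "s > 0" "s \<le> k" "s < d" "s < \<eta> * R" using k d \<eta> R by (auto simp: s_def min_def)
      then have "(x, s) \<in> K" using k subset_ball[of s k x] by (auto simp: K_def)
      then show ?thesis using s by (intro exI[of _ "(x, s)"]) auto
    qed
    then obtain C0 where C0: "countable C0" "C0 \<subseteq> K"
      "pairwise (\<lambda>i j. disjnt (ball (fst i) (snd i)) (ball (fst j) (snd j))) C0"
      "negligible (\<Omega> - (\<Union>i\<in>C0. ball (fst i) (snd i)))"
      by (rule Vitali_covering_theorem_balls[of \<Omega> K fst snd])
    let ?B = "\<lambda>i. ball (fst i) (snd i)"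
    have sub: "(\<Union>i\<in>C0. ?B i) \<subseteq> \<Omega>" using C0(2) by (auto simp: K_def)
    have m: "measure lebesgue (\<Union>i\<in>C0. ?B i) = measure lebesgue \<Omega>"
    proof (rule measure_negligible_symdiff[OF lm])
      have "\<Omega> - (\<Union>i\<in>C0. ?B i) \<union> ((\<Union>i\<in>C0. ?B i) - \<Omega>) = \<Omega> - (\<Union>i\<in>C0. ?B i)" using sub by blast
      then show "negligible (\<Omega> - (\<Union>i\<in>C0. ?B i) \<union> ((\<Union>i\<in>C0. ?B i) - \<Omega>))" using C0(4) by simp
    qed
    have "\<exists>C. finite C \<and> C \<subseteq> C0 \<and> measure lebesgue \<Omega> / 2 \<le> measure lebesgue (\<Union>i\<in>C. ?B i)"
    proof (cases "measure lebesgue \<Omega> > 0")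
      case True
      have B1: "measure lebesgue (\<Union>D') \<le> measure lebesgue \<Omega>" if "D' \<subseteq> ?B ` C0" "finite D'" for D'
      proof (rule measure_mono_fmeasurable[OF _ _ lm])
        show "\<Union>D' \<subseteq> \<Omega>" using that sub by blast
        have "open (\<Union>D')" using that(1) by (intro open_Union) auto
        then show "\<Union>D' \<in> sets lebesgue" by simp
      qed
      have B2: "d \<in> lmeasurable" if "d \<in> ?B ` C0" for d using that by auto
      have half: "measure lebesgue \<Omega> / 2 > 0" using True by simp
      obtain D' where D': "D' \<subseteq> ?B ` C0" "finite D'"
        "measure lebesgue (\<Union>(?B ` C0)) - measure lebesgue \<Omega> / 2 < measure lebesgue (\<Union>D')"
        by (rule measure_countable_Union_approachable[OF countable_image[OF C0(1)] half B2 B1])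
      obtain C where C: "C \<subseteq> C0" "finite C" "D' = ?B ` C" using finite_subset_image[OF D'(2,1)] by blast
      then show ?thesis using D'(3) m by (intro exI[of _ C]) auto
    next
      case False
      then show ?thesis using measure_nonneg[of lebesgue \<Omega>] by (intro exI[of _ "{}"]) auto
    qed
    then obtain C1 where C1: "finite C1" "C1 \<subseteq> C0" "measure lebesgue \<Omega> / 2 \<le> measure lebesgue (\<Union>i\<in>C1. ?B i)"
      by blast
    have K1: "0 < snd i" "snd i < \<eta> * R" "?B i \<subseteq> \<Omega>" if "i \<in> C1" for i
      using that C1(2) C0(2) by (auto simp: K_def)
    let ?p = "\<lambda>i. (fst i, snd i / R)"
    have cl: "closure (affine_copy D (?p i)) \<subseteq> ?B i" if "i \<in> C1" for i
      using outer[of "snd i / R" "fst i"] K1(1)[OF that] R by simp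
    have pw: "disjnt (?B i) (?B j)" if "i \<in> C1" "j \<in> C1" "i \<noteq> j" for i j
      using C0(3) C1(2) that by (auto simp: pairwise_def)
    have disj: "disjnt (closure (affine_copy D (?p i))) (closure (affine_copy D (?p j)))" if "i \<in> C1" "j \<in> C1" "i \<noteq> j" for i j
      using pw[OF that] cl[OF that(1)] cl[OF that(2)] unfolding disjnt_def by blast
    have lm_cl: "closure (affine_copy D (?p i)) \<in> lmeasurable" if "i \<in> C1" for i
      using bounded_subset[OF bounded_ball cl[OF that]] by (intro lmeasurable_compact) (simp add: compact_eq_bounded_closed)
    have "measure lebesgue \<Omega> / 2 \<le> (\<Sum>i\<in>C1. measure lebesgue (?B i))"
      by (rule order_trans[OF C1(3) measure_UNION_le[OF C1(1)]]) simp
    then have "c * measure lebesgue \<Omega> \<le> (\<rho> / R) ^ ?N * (\<Sum>i\<in>C1. measure lebesgue (?B i))"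
      using R \<rho> by (simp add: c_def mult_left_mono flip: times_divide_eq_right)
    also have "\<dots> = (\<Sum>i\<in>C1. measure lebesgue (ball (fst i) (\<rho> * (snd i / R))))"
      unfolding sum_distrib_left
    proof (rule sum.cong[OF refl])
      fix i assume "i \<in> C1"
      from K1(1)[OF this] show "(\<rho> / R) ^ ?N * measure lebesgue (?B i) = measure lebesgue (ball (fst i) (\<rho> * (snd i / R)))"
        using R \<rho> by (simp add: content_ball power_mult_distrib power_divide)
    qed
    also have "\<dots> \<le> (\<Sum>i\<in>C1. measure lebesgue (closure (affine_copy D (?p i))))"
    proof (rule sum_mono)
      fix i assume i: "i \<in> C1"
      have "ball (fst i) (\<rho> * (snd i / R)) \<subseteq> closure (affine_copy D (?p i))"
        using inner[of "snd i / R" "fst i"] K1(1)[OF i] R closure_subset by fastforce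
      then show "measure lebesgue (ball (fst i) (\<rho> * (snd i / R))) \<le> measure lebesgue (closure (affine_copy D (?p i)))"
        by (rule measure_mono_fmeasurable) (auto intro!: lm_cl[OF i])
    qed
    also have "\<dots> = measure lebesgue (\<Union>i\<in>C1. closure (affine_copy D (?p i)))"
    proof (rule measure_negligible_finite_Union_image[symmetric, OF C1(1) lm_cl])
      show "pairwise (\<lambda>i j. negligible (closure (affine_copy D (?p i)) \<inter> closure (affine_copy D (?p j)))) C1"
        using disj unfolding pairwise_def disjnt_def by simp
    qed
    finally have meas: "c * measure lebesgue \<Omega> \<le> measure lebesgue (\<Union>i\<in>C1. closure (affine_copy D (?p i)))" .
    show "\<exists>C. finite C \<and> (\<forall>p\<in>C. 0 < snd p \<and> snd p < \<eta> \<and> closure (affine_copy D p) \<subseteq> \<Omega>) \<and>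
       pairwise (\<lambda>p q. disjnt (closure (affine_copy D p)) (closure (affine_copy D q))) C \<and>
       c * measure lebesgue \<Omega> \<le> measure lebesgue (\<Union>p\<in>C. closure (affine_copy D p))"
    proof (intro exI[of _ "?p ` C1"] conjI ballI)
      show "finite (?p ` C1)" using C1(1) by simp
      show "pairwise (\<lambda>p q. disjnt (closure (affine_copy D p)) (closure (affine_copy D q))) (?p ` C1)"
        using disj unfolding pairwise_def by blast
      show "c * measure lebesgue \<Omega> \<le> measure lebesgue (\<Union>p\<in>?p ` C1. closure (affine_copy D p))"
        using meas by (simp only: image_image)
      fix p assume "p \<in> ?p ` C1"
      then obtain i where i: "i \<in> C1" "p = ?p i" by blast
      show "0 < snd p" "snd p < \<eta>" using K1(1,2)[OF i(1)] R by (auto simp: i(2) field_simps)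
      show "closure (affine_copy D p) \<subseteq> \<Omega>" unfolding i(2) using cl[OF i(1)] K1(3)[OF i(1)] by (rule subset_trans)
    qed
  qed
qed

text \<open>Each round covers at least the fraction c of what is left, so after n rounds the
  remainder has at most (1 - c)^n times the measure of \<Omega>. The rounds use closures; replacing
  them by the open copies loses the frontiers, which are null because D is convex.\<close>

lemma Vitali_covering_copies:
  fixes D \<Omega> :: "(real^'n) set"
  assumes D: "open D" "bounded D" "0 \<in> D" "convex D" and \<Omega>: "open \<Omega>" "bounded \<Omega>" and \<eta>: "\<eta> > 0"
  obtains C where "\<And>p. p \<in> C \<Longrightarrow> 0 < snd p \<and> snd p < \<eta> \<and> affine_copy D p \<subseteq> \<Omega>"
    "pairwise (\<lambda>p q. disjnt (affine_copy D p) (affine_copy D q)) C" "negligible (\<Omega> - (\<Union>p\<in>C. affine_copy D p))" "countable C"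
proof -
  obtain c where c: "0 < c" "c \<le> 1"
    and step: "\<And>\<Omega>. open \<Omega> \<Longrightarrow> bounded \<Omega> \<Longrightarrow> \<exists>C. finite C \<and> (\<forall>p\<in>C. 0 < snd p \<and> snd p < \<eta> \<and> closure (affine_copy D p) \<subseteq> \<Omega>) \<and>
       pairwise (\<lambda>p q. disjnt (closure (affine_copy D p)) (closure (affine_copy D q))) C \<and>
       c * measure lebesgue \<Omega> \<le> measure lebesgue (\<Union>p\<in>C. closure (affine_copy D p))"
    using copies_cover_fraction[OF D(1-3)] \<eta> by metis
  let ?cl = "\<lambda>p. closure (affine_copy D p)"
  define rem where "rem S = \<Omega> - (\<Union>p\<in>S. ?cl p)" for S
  define Inv where "Inv S \<longleftrightarrow> finite S \<and> (\<forall>p\<in>S. 0 < snd p \<and> snd p < \<eta> \<and> ?cl p \<subseteq> \<Omega>) \<and>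
     pairwise (\<lambda>p q. disjnt (?cl p) (?cl q)) S" for S
  have op: "open (rem S)" "bounded (rem S)" if "finite S" for S
    using that \<Omega> unfolding rem_def by (auto intro!: open_Diff closed_UN bounded_subset[OF \<Omega>(2)])
  have ex: "\<exists>S'. (Inv S' \<and> measure lebesgue (rem S') \<le> (1 - c) ^ Suc n * measure lebesgue \<Omega>) \<and> S \<subseteq> S'"
    if S: "Inv S \<and> measure lebesgue (rem S) \<le> (1 - c) ^ n * measure lebesgue \<Omega>" for S n
  proof -
    have fS: "finite S" using S by (simp add: Inv_def)
    obtain C where C: "finite C" "\<forall>p\<in>C. 0 < snd p \<and> snd p < \<eta> \<and> ?cl p \<subseteq> rem S"
      "pairwise (\<lambda>p q. disjnt (?cl p) (?cl q)) C"
      "c * measure lebesgue (rem S) \<le> measure lebesgue (\<Union>p\<in>C. ?cl p)"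
      using step[OF op[OF fS]] by blast
    have "Inv (S \<union> C)"
      unfolding Inv_def
    proof (intro conjI)
      show "finite (S \<union> C)" using fS C(1) by simp
      show "\<forall>p\<in>S \<union> C. 0 < snd p \<and> snd p < \<eta> \<and> ?cl p \<subseteq> \<Omega>"
        using S C(2) unfolding Inv_def rem_def by blast
      have 1: "disjnt (?cl p) (?cl q)" if "p \<in> S" "q \<in> C" for p q
        using C(2) that unfolding rem_def disjnt_def by blast
      then have 2: "disjnt (?cl q) (?cl p)" if "p \<in> S" "q \<in> C" for p q
        using that disjnt_sym by blast
      have 3: "pairwise (\<lambda>p q. disjnt (?cl p) (?cl q)) S" using S by (simp add: Inv_def)
      show "pairwise (\<lambda>p q. disjnt (?cl p) (?cl q)) (S \<union> C)"
        unfolding pairwise_def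
      proof (intro ballI impI)
        fix p q assume "p \<in> S \<union> C" "q \<in> S \<union> C" "p \<noteq> q"
        then show "disjnt (?cl p) (?cl q)" using 1 2 pairwiseD[OF 3] pairwiseD[OF C(3)] by blast
      qed
    qed
    moreover have "measure lebesgue (rem (S \<union> C)) \<le> (1 - c) ^ Suc n * measure lebesgue \<Omega>"
    proof -
      have lmS: "rem S \<in> lmeasurable" using op[OF fS] by (simp add: lmeasurable_open)
      have sub: "(\<Union>p\<in>C. ?cl p) \<subseteq> rem S" using C(2) by blast
      have "closed (\<Union>p\<in>C. ?cl p)" using C(1) by (intro closed_UN) auto
      then have "(\<Union>p\<in>C. ?cl p) \<in> sets lebesgue" by simp
      then have lmC: "(\<Union>p\<in>C. ?cl p) \<in> lmeasurable" using sub lmS by (metis fmeasurableI2)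
      have "rem (S \<union> C) = rem S - (\<Union>p\<in>C. ?cl p)" by (auto simp: rem_def)
      then have "measure lebesgue (rem (S \<union> C)) = measure lebesgue (rem S) - measure lebesgue (\<Union>p\<in>C. ?cl p)"
        using measurable_measure_Diff[OF lmS fmeasurableD[OF lmC] sub] by simp
      also have "\<dots> \<le> (1 - c) * measure lebesgue (rem S)" using C(4) by (simp add: left_diff_distrib)
      also have "\<dots> \<le> (1 - c) * ((1 - c) ^ n * measure lebesgue \<Omega>)" using S c by (intro mult_left_mono) auto
      finally show ?thesis by simp
    qed
    ultimately show ?thesis by (intro exI[of _ "S \<union> C"]) auto
  qed
  have "\<exists>S. Inv S \<and> measure lebesgue (rem S) \<le> (1 - c) ^ 0 * measure lebesgue \<Omega>"
    by (intro exI[of _ "{}"]) (simp add: Inv_def rem_def)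
  from dependent_nat_choice[of "\<lambda>n S. Inv S \<and> measure lebesgue (rem S) \<le> (1 - c) ^ n * measure lebesgue \<Omega>" "\<lambda>n S S'. S \<subseteq> S'", OF this ex]
  obtain S where S: "\<forall>n. (Inv (S n) \<and> measure lebesgue (rem (S n)) \<le> (1 - c) ^ n * measure lebesgue \<Omega>) \<and> S n \<subseteq> S (Suc n)"
    by blast
  have mono: "S m \<subseteq> S n" if "m \<le> n" for m n using lift_Suc_mono_le[of S m n] S that by blast
  have Inv: "finite (S n)" "\<And>p. p \<in> S n \<Longrightarrow> 0 < snd p \<and> snd p < \<eta> \<and> ?cl p \<subseteq> \<Omega>"
     "pairwise (\<lambda>p q. disjnt (?cl p) (?cl q)) (S n)" for n
    using S[rule_format, of n] unfolding Inv_def by blast+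
  let ?C = "\<Union>n. S n"
  show ?thesis
  proof (rule that[of ?C])
    show "countable ?C" using Inv(1) by (intro countable_UN) (auto intro: countable_finite)
    show "0 < snd p \<and> snd p < \<eta> \<and> affine_copy D p \<subseteq> \<Omega>" if "p \<in> ?C" for p
      using that Inv(2) closure_subset[of "affine_copy D p"] by blast
    show "pairwise (\<lambda>p q. disjnt (affine_copy D p) (affine_copy D q)) ?C"
      unfolding pairwise_def
    proof (intro ballI impI)
      fix p q assume "p \<in> ?C" "q \<in> ?C" "p \<noteq> q"
      then obtain m n where "p \<in> S m" "q \<in> S n" by blast
      then have "p \<in> S (max m n)" "q \<in> S (max m n)" using mono[of m "max m n"] mono[of n "max m n"] by auto
      then have "disjnt (?cl p) (?cl q)" using pairwiseD[OF Inv(3)] \<open>p \<noteq> q\<close> by blast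
      then show "disjnt (affine_copy D p) (affine_copy D q)" using closure_subset unfolding disjnt_def by blast
    qed
    have "negligible (\<Inter>n. rem (S n))"
      unfolding negligible_outer_le
    proof (intro allI impI)
      fix e :: real assume "e > 0"
      have "(\<lambda>n. (1 - c) ^ n * measure lebesgue \<Omega>) \<longlonglongrightarrow> 0 * measure lebesgue \<Omega>"
        using c by (intro tendsto_mult LIMSEQ_power_zero tendsto_const) auto
      then have "\<forall>\<^sub>F n in sequentially. (1 - c) ^ n * measure lebesgue \<Omega> < e"
        using \<open>e > 0\<close> by (intro order_tendstoD(2)) auto
      then obtain n where "(1 - c) ^ n * measure lebesgue \<Omega> < e" by (auto simp: eventually_sequentially)
      then have "measure lebesgue (rem (S n)) \<le> e" using S[rule_format, of n] by linarith
      moreover have "rem (S n) \<in> lmeasurable" using op[OF Inv(1)] by (simp add: lmeasurable_open)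
      ultimately show "\<exists>T. (\<Inter>n. rem (S n)) \<subseteq> T \<and> T \<in> lmeasurable \<and> measure lebesgue T \<le> e" by blast
    qed
    moreover have "negligible (\<Union>((\<lambda>p. frontier (affine_copy D p)) ` ?C))"
    proof (rule negligible_countable_Union)
      show "countable ((\<lambda>p. frontier (affine_copy D p)) ` ?C)"
        using Inv(1) by (intro countable_image countable_UN) (auto intro: countable_finite)
      show "negligible F" if "F \<in> (\<lambda>p. frontier (affine_copy D p)) ` ?C" for F
        using that convex_affinity[OF D(4)] negligible_convex_frontier unfolding affine_copy_def by blast
    qed
    ultimately have "negligible ((\<Inter>n. rem (S n)) \<union> \<Union>((\<lambda>p. frontier (affine_copy D p)) ` ?C))"
      by (rule negligible_Un)
    moreover have "\<Omega> - (\<Union>p\<in>?C. affine_copy D p) \<subseteq> (\<Inter>n. rem (S n)) \<union> \<Union>((\<lambda>p. frontier (affine_copy D p)) ` ?C)"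
    proof
      fix x assume x: "x \<in> \<Omega> - (\<Union>p\<in>?C. affine_copy D p)"
      show "x \<in> (\<Inter>n. rem (S n)) \<union> \<Union>((\<lambda>p. frontier (affine_copy D p)) ` ?C)"
      proof (cases "\<exists>p\<in>?C. x \<in> ?cl p")
        case True
        then obtain p where p: "p \<in> ?C" "x \<in> ?cl p" by blast
        have "x \<notin> interior (affine_copy D p)" using x p(1) interior_subset by blast
        then show ?thesis using p by (auto simp: frontier_def)
      next
        case False
        then show ?thesis using x by (auto simp: rem_def)
      qed
    qed
    ultimately show "negligible (\<Omega> - (\<Union>p\<in>?C. affine_copy D p))" by (rule negligible_subset)
  qed
qed

subsection \<open>Simple laminates\<close>

definition outer_product :: "real^'m \<Rightarrow> real^'n \<Rightarrow> real^'n^'m" where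
  "outer_product a e = (\<chi> i j. a $ i * e $ j)"

lemma outer_product_mult: "outer_product a p *v y = (p \<bullet> y) *\<^sub>R a"
  by (simp add: vec_eq_iff outer_product_def matrix_vector_mult_def inner_vec_def sum_distrib_right sum_distrib_left mult_ac)

text \<open>With \<open>q = gauge_fun t \<delta> e\<close>, the function \<open>max 0 (1 - q)\<close> vanishes off the bounded convex set \<open>q < 1\<close>,
  and inside its gradient is within \<open>O(\<delta>)\<close> of \<open>(1 - t) e\<close> or \<open>- t e\<close>. The \<open>\<delta>\<close>-term is what makes the
  set bounded.\<close>

definition gauge_fun :: "real \<Rightarrow> real \<Rightarrow> real^'n \<Rightarrow> real^'n \<Rightarrow> real" where
  "gauge_fun t \<delta> e x = \<delta> * (\<Sum>j\<in>UNIV. \<bar>x $ j\<bar>) + max (t * (e \<bullet> x)) (- ((1 - t) * (e \<bullet> x)))"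

text \<open>Together with homogeneity this makes the set q < 1 convex; it also reduces the Lipschitz
  estimate to the linear upper bound.\<close>

lemma gauge_fun_add:
  assumes "\<delta> \<ge> 0"
  shows "gauge_fun t \<delta> e (x + y) \<le> gauge_fun t \<delta> e x + gauge_fun t \<delta> e y"
proof -
  have "(\<Sum>j\<in>UNIV. \<bar>(x + y) $ j\<bar>) \<le> (\<Sum>j\<in>UNIV. \<bar>x $ j\<bar> + \<bar>y $ j\<bar>)" by (rule sum_mono) simp
  then have "\<delta> * (\<Sum>j\<in>UNIV. \<bar>(x + y) $ j\<bar>) \<le> \<delta> * (\<Sum>j\<in>UNIV. \<bar>x $ j\<bar>) + \<delta> * (\<Sum>j\<in>UNIV. \<bar>y $ j\<bar>)"
    using assms by (simp add: sum.distrib mult_left_mono flip: distrib_left)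
  moreover have "max (t * (e \<bullet> (x + y))) (- ((1 - t) * (e \<bullet> (x + y)))) \<le>
     max (t * (e \<bullet> x)) (- ((1 - t) * (e \<bullet> x))) + max (t * (e \<bullet> y)) (- ((1 - t) * (e \<bullet> y)))"
    by (simp add: inner_add_right distrib_left max_def)
  ultimately show ?thesis unfolding gauge_fun_def by linarith
qed

lemma gauge_fun_scale:
  assumes "c \<ge> 0"
  shows "gauge_fun t \<delta> e (c *\<^sub>R x) = c * gauge_fun t \<delta> e x"
proof -
  have "max (t * (c * (e \<bullet> x))) (- ((1 - t) * (c * (e \<bullet> x)))) = c * max (t * (e \<bullet> x)) (- ((1 - t) * (e \<bullet> x)))"
    using assms by (simp add: max_mult_distrib_left mult_ac)
  then show ?thesis
    using assms by (simp add: gauge_fun_def abs_mult distrib_left sum_distrib_left mult_ac)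
qed

text \<open>One of t (e \<bullet> x) and -(1 - t) (e \<bullet> x) is nonnegative, which leaves the
  \<delta>-term as a lower bound and makes the base of the tent bounded. The factor in the upper
  bound becomes the Lipschitz constant.\<close>

lemma gauge_fun_bounds:
  assumes "\<delta> \<ge> 0" "0 < t" "t < 1"
  shows "\<delta> * norm x \<le> gauge_fun t \<delta> e x"
    "gauge_fun t \<delta> e x \<le> (\<delta> * real CARD('n) + norm e) * norm (x :: real^'n)"
proof -
  have "0 \<le> max (t * (e \<bullet> x)) (- ((1 - t) * (e \<bullet> x)))"
    using assms by (cases "e \<bullet> x \<ge> 0") (auto simp: le_max_iff_disj mult_nonneg_nonpos)
  moreover have "\<delta> * norm x \<le> \<delta> * (\<Sum>j\<in>UNIV. \<bar>x $ j\<bar>)" by (rule mult_left_mono[OF norm_le_l1_cart assms(1)])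
  ultimately show "\<delta> * norm x \<le> gauge_fun t \<delta> e x" by (simp add: gauge_fun_def)
  have "(\<Sum>j\<in>UNIV. \<bar>x $ j\<bar>) \<le> (\<Sum>j\<in>(UNIV::'n set). norm x)" by (rule sum_mono) (rule component_le_norm_cart)
  then have "\<delta> * (\<Sum>j\<in>UNIV. \<bar>x $ j\<bar>) \<le> \<delta> * (real CARD('n) * norm x)"
    using assms(1) by (intro mult_left_mono) auto
  moreover have "max (t * (e \<bullet> x)) (- ((1 - t) * (e \<bullet> x))) \<le> norm e * norm x"
  proof -
    have "\<bar>e \<bullet> x\<bar> \<le> norm e * norm x" by (rule Cauchy_Schwarz_ineq2)
    moreover have "t * (e \<bullet> x) \<le> \<bar>e \<bullet> x\<bar>" "- ((1 - t) * (e \<bullet> x)) \<le> \<bar>e \<bullet> x\<bar>"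
      using assms abs_le_D1[of "t * (e \<bullet> x)" "\<bar>e \<bullet> x\<bar>"] abs_le_D2[of "(1 - t) * (e \<bullet> x)" "\<bar>e \<bullet> x\<bar>"]
      by (auto simp: abs_mult mult_left_le_one_le)
    ultimately show ?thesis by linarith
  qed
  ultimately show "gauge_fun t \<delta> e x \<le> (\<delta> * real CARD('n) + norm e) * norm x"
    unfolding gauge_fun_def distrib_right mult.assoc by (rule add_mono)
qed

text \<open>The tent is \<open>max 0 (1 - q)\<close> times a. On the two sides of the hyperplane e
  \<bullet> x = 0 the gradient of 1 - q is - t e or (1 - t) e, up to an error proportional to
  \<delta>. Kinks inside D occur only on this hyperplane and on the coordinate hyperplanes.\<close>

lemma laminate_base:
  fixes a :: "real^'m" and e :: "real^'n"
  assumes t: "0 < t" "t < 1" and "e \<noteq> 0" and "\<delta>' > 0"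
  obtains D w L B where "open D" "bounded D" "convex D" "0 \<in> D" "L-lipschitz_on UNIV w"
    "\<And>x. x \<notin> D \<Longrightarrow> w x = 0" "\<And>x. norm (w x) \<le> B"
    "negligible {x\<in>D. \<not> (\<exists>M\<in>ball ((1 - t) *\<^sub>R outer_product a e) \<delta>' \<union> ball ((- t) *\<^sub>R outer_product a e) \<delta>'. loc_affine w x M)}"
proof -
  let ?c = "real CARD('m) * (real CARD('n) * norm a)"
  \<comment> \<open>The entries of the error matrix are at most \<open>norm a * \<delta>\<close>;
    this choice brings its norm below \<delta>'.\<close>
  define \<delta> where "\<delta> = \<delta>' / (?c + 1)"
  have c1: "?c + 1 > 0" by (simp add: add_nonneg_pos)
  have \<delta>: "\<delta> > 0" "?c * \<delta> < \<delta>'"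
    using \<open>\<delta>' > 0\<close> c1 by (auto simp: \<delta>_def field_simps)
  let ?q = "gauge_fun t \<delta> e"
  define D where "D = {x. ?q x < 1}"
  define \<phi> where "\<phi> x = max 0 (1 - ?q x)" for x
  define w where "w x = \<phi> x *\<^sub>R a" for x
  define L where "L = \<delta> * real CARD('n) + norm e"
  have L: "L \<ge> 0" using \<delta> by (simp add: L_def)
  note b = gauge_fun_bounds[OF less_imp_le[OF \<delta>(1)] t]
  have q0: "?q 0 = 0" by (simp add: gauge_fun_def)
  have q_lip: "?q x - ?q y \<le> L * norm (x - y)" for x y
    using gauge_fun_add[OF less_imp_le[OF \<delta>(1)], of t e y "x - y"] b(2)[of e "x - y"] unfolding L_def by simp
  have q_abs: "\<bar>?q x - ?q y\<bar> \<le> L * norm (x - y)" for x y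
    using q_lip[of x y] q_lip[of y x] by (auto simp: abs_le_iff norm_minus_commute)
  then have "L-lipschitz_on UNIV ?q" using L by (intro lipschitz_onI) (auto simp: dist_norm)
  then have cq: "continuous_on UNIV ?q" by (rule lipschitz_on_continuous_on)
  have D: "open D" unfolding D_def by (rule open_Collect_less[OF cq continuous_on_const])
  have \<phi>_lip: "\<bar>\<phi> x - \<phi> y\<bar> \<le> L * norm (x - y)" for x y
    using q_abs[of x y] by (auto simp: \<phi>_def max_def)
  have "dist (w x) (w y) \<le> (L * norm a) * dist x y" for x y
  proof -
    have "dist (w x) (w y) = \<bar>\<phi> x - \<phi> y\<bar> * norm a" by (simp add: w_def dist_norm flip: scaleR_diff_left)
    also have "\<dots> \<le> (L * norm (x - y)) * norm a" by (rule mult_right_mono) (use \<phi>_lip in auto)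
    finally show ?thesis by (simp add: dist_norm mult_ac)
  qed
  then have w_lip: "(L * norm a)-lipschitz_on UNIV w" using L by (intro lipschitz_onI) auto
  have \<phi>1: "\<bar>\<phi> x\<bar> \<le> 1" for x
  proof -
    have "0 \<le> \<delta> * norm x" using \<delta>(1) by simp
    then have "?q x \<ge> 0" using b(1)[where x = x and e = e] by linarith
    then show ?thesis by (simp add: \<phi>_def)
  qed
  show ?thesis
  proof (rule that[OF D _ _ _ w_lip])
    show "bounded D"
      unfolding bounded_iff
    proof (intro exI ballI)
      fix x assume "x \<in> D"
      then have "\<delta> * norm x \<le> 1" using b(1)[where x = x and e = e] by (simp add: D_def)
      then show "norm x \<le> 1 / \<delta>" using \<delta>(1) by (simp add: field_simps)
    qed
    show "convex D"
    proof (rule convexI)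
      fix x y u v assume *: "x \<in> D" "y \<in> D" "0 \<le> (u::real)" "0 \<le> v" "u + v = 1"
      have "?q (u *\<^sub>R x + v *\<^sub>R y) \<le> u * ?q x + v * ?q y"
        using gauge_fun_add[OF less_imp_le[OF \<delta>(1)], of t e "u *\<^sub>R x" "v *\<^sub>R y"]
          gauge_fun_scale[OF *(3), of t \<delta> e x] gauge_fun_scale[OF *(4), of t \<delta> e y] by simp
      also have "\<dots> < 1" by (rule convex_bound_lt) (use * in \<open>auto simp: D_def\<close>)
      finally show "u *\<^sub>R x + v *\<^sub>R y \<in> D" by (simp add: D_def)
    qed
    show "0 \<in> D" by (simp add: D_def q0)
    show "w x = 0" if "x \<notin> D" for x using that by (simp add: D_def w_def \<phi>_def)
    show "norm (w x) \<le> norm a" for x using \<phi>1[of x] by (simp add: w_def mult_left_le_one_le)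
    let ?T = "ball ((1 - t) *\<^sub>R outer_product a e) \<delta>' \<union> ball ((- t) *\<^sub>R outer_product a e) \<delta>'"
    let ?Z = "(\<Union>j. {x :: real^'n. axis j 1 \<bullet> x = 0}) \<union> {x. e \<bullet> x = 0}"
    have "negligible ?Z"
      using \<open>e \<noteq> 0\<close> by (intro negligible_Un negligible_Union negligible_hyperplane) (auto intro!: negligible_hyperplane simp: axis_eq_0_iff)
    moreover have "\<exists>M\<in>?T. loc_affine w x M" if x: "x \<in> D" "x \<notin> ?Z" for x
    proof -
      have xj: "x $ j \<noteq> 0" for j
      proof -
        have "axis j 1 \<bullet> x \<noteq> 0" using x(2) by blast
        then show ?thesis by (simp add: inner_axis')
      qed
      have ex: "e \<bullet> x \<noteq> 0" using x(2) by blast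
      \<comment> \<open>Near x the function 1 - q is affine; p will be its gradient, and \<kappa> is
        the coefficient of e in p.\<close>
      define \<kappa> where "\<kappa> = (if e \<bullet> x > 0 then - t else 1 - t)"
      define p where "p = (\<chi> j. - \<delta> * sgn (x $ j)) + \<kappa> *\<^sub>R e"
      have sign: "\<forall>\<^sub>F y in nhds x. sgn (f y) = sgn (f x)"
        if "continuous_on UNIV f" "f x \<noteq> 0" for f :: "real^'n \<Rightarrow> real"
      proof (cases "f x > 0")
        case True
        have "open {y. 0 < f y}" using that(1) by (intro open_Collect_less continuous_on_const)
        from eventually_nhds_in_open[OF this, of x] True show ?thesis by (auto elim: eventually_mono)
      next
        case False
        have "open {y. f y < 0}" using that(1) by (intro open_Collect_less continuous_on_const)
        from eventually_nhds_in_open[OF this, of x] False that(2) show ?thesis by (auto elim: eventually_mono)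
      qed
      have "\<forall>\<^sub>F y in nhds x. sgn (y $ j) = sgn (x $ j)" for j
        by (rule sign[OF continuous_on_component[OF continuous_on_id] xj])
      then have "\<forall>\<^sub>F y in nhds x. \<forall>j. sgn (y $ j) = sgn (x $ j)" by (rule eventually_all_finite)
      moreover have "\<forall>\<^sub>F y in nhds x. sgn (e \<bullet> y) = sgn (e \<bullet> x)"
        by (rule sign[OF continuous_on_inner[OF continuous_on_const continuous_on_id] ex])
      moreover have "\<forall>\<^sub>F y in nhds x. y \<in> D" by (rule eventually_nhds_in_open[OF D x(1)])
      ultimately have "\<forall>\<^sub>F y in nhds x. w y = outer_product a p *v y + a"
      proof eventually_elim
        case (elim y)
        have "\<delta> * (\<Sum>j\<in>UNIV. \<bar>y $ j\<bar>) = - (\<Sum>j\<in>UNIV. (- \<delta> * sgn (x $ j)) * y $ j)"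
        proof -
          have "\<bar>y $ j\<bar> = sgn (x $ j) * y $ j" for j using elim(1) by (metis abs_sgn mult.commute)
          then show ?thesis by (simp add: sum_distrib_left sum_negf mult.assoc)
        qed
        moreover have "max (t * (e \<bullet> y)) (- ((1 - t) * (e \<bullet> y))) = - (\<kappa> * (e \<bullet> y))"
        proof (cases "e \<bullet> x > 0")
          case True
          then have y: "e \<bullet> y > 0" using elim(2) by (simp add: sgn_if split: if_splits)
          then have "- ((1 - t) * (e \<bullet> y)) \<le> t * (e \<bullet> y)" by (simp add: algebra_simps)
          then show ?thesis using True by (simp add: \<kappa>_def max_def)
        next
          case False
          then have y: "e \<bullet> y < 0" using ex elim(2) by (simp add: sgn_if split: if_splits)
          then have "t * (e \<bullet> y) \<le> - ((1 - t) * (e \<bullet> y))" by (simp add: algebra_simps)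
          then show ?thesis using False by (simp add: \<kappa>_def max_def)
        qed
        moreover have "p \<bullet> y = (\<Sum>j\<in>UNIV. (- \<delta> * sgn (x $ j)) * y $ j) + \<kappa> * (e \<bullet> y)"
        proof -
          have "(\<chi> j. - \<delta> * sgn (x $ j)) \<bullet> y = (\<Sum>j\<in>UNIV. (- \<delta> * sgn (x $ j)) * y $ j)"
            by (simp add: inner_vec_def)
          then show ?thesis unfolding p_def by (simp only: inner_add_left inner_scaleR_left)
        qed
        ultimately have "?q y = - (p \<bullet> y)" unfolding gauge_fun_def by linarith
        moreover have "?q y < 1" using elim(3) by (simp add: D_def)
        ultimately have "\<phi> y = 1 + p \<bullet> y" by (simp add: \<phi>_def)
        then show ?case by (simp add: w_def outer_product_mult scaleR_add_left)
      qed
      then have "loc_affine w x (outer_product a p)" unfolding loc_affine_def by (rule exI)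
      moreover have "norm (outer_product a p - \<kappa> *\<^sub>R outer_product a e) \<le> real CARD('m) * (real CARD('n) * (norm a * \<delta>))"
      proof (rule norm_matrix_le)
        fix i j
        have "(outer_product a p - \<kappa> *\<^sub>R outer_product a e) $ i $ j = a $ i * (- \<delta> * sgn (x $ j))"
          by (simp add: outer_product_def p_def algebra_simps)
        also have "\<bar>\<dots>\<bar> = \<bar>a $ i\<bar> * \<delta>" using \<delta>(1) xj[of j] by (simp add: abs_mult abs_sgn_eq)
        also have "\<dots> \<le> norm a * \<delta>" using \<delta>(1) component_le_norm_cart[of a i] by (intro mult_right_mono) auto
        finally show "\<bar>(outer_product a p - \<kappa> *\<^sub>R outer_product a e) $ i $ j\<bar> \<le> norm a * \<delta>" .
      qed
      then have "outer_product a p \<in> ball (\<kappa> *\<^sub>R outer_product a e) \<delta>'"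
        using \<delta>(2) by (simp add: dist_norm norm_minus_commute mult.assoc)
      then have "outer_product a p \<in> ?T" by (auto simp: \<kappa>_def split: if_splits)
      ultimately show ?thesis by blast
    qed
    then have "{x\<in>D. \<not> (\<exists>M\<in>?T. loc_affine w x M)} \<subseteq> ?Z" by blast
    ultimately show "negligible {x\<in>D. \<not> (\<exists>M\<in>?T. loc_affine w x M)}" by (rule negligible_subset)
  qed
qed

text \<open>Scaling domain and values by the same factor leaves gradients alone while the size
  shrinks with r: this is how perturbations become uniformly small.\<close>

lemma loc_affine_rescale:
  assumes "loc_affine w ((x - p) /\<^sub>R r) M" "r > 0"
  shows "loc_affine (\<lambda>y. r *\<^sub>R w ((y - p) /\<^sub>R r)) x M"
proof -
  obtain b where b: "\<forall>\<^sub>F z in nhds ((x - p) /\<^sub>R r). w z = M *v z + b"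
    using assms(1) unfolding loc_affine_def by blast
  have "filterlim (\<lambda>y. (y - p) /\<^sub>R r) (nhds ((x - p) /\<^sub>R r)) (nhds x)"
    by (intro tendsto_intros filterlim_ident)
  from eventually_compose_filterlim[OF b this]
  have "\<forall>\<^sub>F y in nhds x. r *\<^sub>R w ((y - p) /\<^sub>R r) = M *v y + (r *\<^sub>R b - M *v p)"
  proof eventually_elim
    case (elim y)
    have "r *\<^sub>R (M *v ((y - p) /\<^sub>R r)) = M *v y - M *v p"
      using assms(2) by (simp add: matrix_vector_mult_scaleR matrix_vector_mult_diff_distrib)
    then show ?case using elim by (simp add: scaleR_add_right)
  qed
  then show ?thesis unfolding loc_affine_def by (rule exI)
qed

text \<open>Copies of w at scales below \<eta> fill \<Omega> up to a null set. Each keeps the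
  gradients and the Lipschitz constant of w and has size at most \<eta> B. Gluing doubles the
  constant, and the result does not depend on \<Omega>.\<close>

lemma transfer_to_domain:
  fixes w :: "real^'n \<Rightarrow> real^'m"
  assumes D: "open D" "bounded D" "0 \<in> D" "convex D" and lip: "L-lipschitz_on UNIV w"
    and off: "\<And>x. x \<notin> D \<Longrightarrow> w x = 0" and B: "\<And>x. norm (w x) \<le> B"
    and neg: "negligible {x\<in>D. \<not> (\<exists>M\<in>T. loc_affine w x M)}"
    and \<Omega>: "open \<Omega>" "bounded \<Omega>" and "\<epsilon> > 0"
  obtains u where "(2 * L)-lipschitz_on UNIV u" "\<And>x. x \<notin> \<Omega> \<Longrightarrow> u x = 0" "\<And>x. norm (u x) \<le> \<epsilon>"
    "negligible {x\<in>\<Omega>. \<not> (\<exists>M\<in>T. loc_affine u x M)}"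
proof -
  have B0: "B \<ge> 0" by (rule order_trans[OF norm_ge_zero B])
  have L: "L \<ge> 0" by (rule lipschitz_on_nonneg[OF lip])
  define \<eta> where "\<eta> = \<epsilon> / (B + 1)"
  have \<eta>: "\<eta> > 0" "\<eta> * B \<le> \<epsilon>" using \<open>\<epsilon> > 0\<close> B0 by (auto simp: \<eta>_def field_simps)
  obtain C where C: "\<And>p. p \<in> C \<Longrightarrow> 0 < snd p \<and> snd p < \<eta> \<and> affine_copy D p \<subseteq> \<Omega>"
    "pairwise (\<lambda>p q. disjnt (affine_copy D p) (affine_copy D q)) C" "negligible (\<Omega> - (\<Union>p\<in>C. affine_copy D p))" "countable C"
    by (rule Vitali_covering_copies[OF D \<Omega> \<eta>(1)]) blast
  have ne: "affine_copy D p \<noteq> {}" for p using D(3) by (auto simp: affine_copy_def)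
  have inj: "p = q" if "p \<in> C" "q \<in> C" "affine_copy D p = affine_copy D q" for p q
    using C(2) that ne[of q] by (auto simp: pairwise_def disjnt_def)
  \<comment> \<open>\<open>lipschitz_glue\<close> indexes by sets. Disjoint nonempty copies have
    distinct underlying sets, so centre and scale can be recovered from the set.\<close>
  define param where "param U = (SOME p. p \<in> C \<and> affine_copy D p = U)" for U
  have param: "param (affine_copy D p) = p" if "p \<in> C" for p
    unfolding param_def using inj that by (intro some_equality) blast+
  define W where "W U x = snd (param U) *\<^sub>R w ((x - fst (param U)) /\<^sub>R snd (param U))" for U x
  have W: "W (affine_copy D p) x = snd p *\<^sub>R w ((x - fst p) /\<^sub>R snd p)" if "p \<in> C" for p x
    by (simp add: W_def param[OF that])
  have mem: "(x - fst p) /\<^sub>R snd p \<in> D \<longleftrightarrow> x \<in> affine_copy D p" if "p \<in> C" for p x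
  proof -
    have s: "snd p > 0" using C(1)[OF that] by blast
    show ?thesis
    proof
      assume "(x - fst p) /\<^sub>R snd p \<in> D"
      moreover have "x = fst p + snd p *\<^sub>R ((x - fst p) /\<^sub>R snd p)" using s by simp
      ultimately show "x \<in> affine_copy D p" unfolding affine_copy_def by (rule rev_image_eqI)
    next
      assume "x \<in> affine_copy D p"
      then show "(x - fst p) /\<^sub>R snd p \<in> D" using s by (auto simp: affine_copy_def)
    qed
  qed
  let ?\<D> = "affine_copy D ` C"
  have dis: "disjoint ?\<D>"
    unfolding disjoint_def
  proof (intro ballI impI)
    fix U V assume "U \<in> ?\<D>" "V \<in> ?\<D>" "U \<noteq> V"
    then obtain p q where "p \<in> C" "q \<in> C" "p \<noteq> q" "U = affine_copy D p" "V = affine_copy D q" by blast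
    then show "U \<inter> V = {}" using pairwiseD[OF C(2)] unfolding disjnt_def by blast
  qed
  have W_lip: "L-lipschitz_on UNIV (W U)" and W_off: "\<And>x. x \<notin> U \<Longrightarrow> W U x = 0" if U: "U \<in> ?\<D>" for U
  proof -
    obtain p where p: "p \<in> C" "U = affine_copy D p" using U by blast
    have s: "snd p > 0" using C(1)[OF p(1)] by blast
    show "L-lipschitz_on UNIV (W U)"
    proof (rule lipschitz_onI[OF _ L])
      fix x y
      have "dist (w ((x - fst p) /\<^sub>R snd p)) (w ((y - fst p) /\<^sub>R snd p)) \<le> L * dist ((x - fst p) /\<^sub>R snd p) ((y - fst p) /\<^sub>R snd p)"
        by (rule lipschitz_onD[OF lip]) auto
      also have "dist ((x - fst p) /\<^sub>R snd p) ((y - fst p) /\<^sub>R snd p) = dist x y / snd p"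
        using s by (simp add: dist_norm divide_inverse mult.commute flip: scaleR_diff_right)
      finally have "snd p * dist (w ((x - fst p) /\<^sub>R snd p)) (w ((y - fst p) /\<^sub>R snd p)) \<le> L * dist x y"
        using s by (simp add: field_simps)
      then show "dist (W U x) (W U y) \<le> L * dist x y"
        using s unfolding p(2) W[OF p(1)] by (simp add: dist_norm flip: scaleR_diff_right)
    qed
    show "W U x = 0" if "x \<notin> U" for x
      using that mem[OF p(1), of x] off unfolding p(2) W[OF p(1)] by simp
  qed
  obtain u where u: "(2 * L)-lipschitz_on UNIV u" "\<And>U x. U \<in> ?\<D> \<Longrightarrow> x \<in> U \<Longrightarrow> u x = W U x"
    "\<And>x. x \<notin> \<Union>?\<D> \<Longrightarrow> u x = 0"
    by (rule lipschitz_glue[OF dis W_lip W_off L], assumption+, rule that)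
  show ?thesis
  proof (rule that[OF u(1)])
    have sub: "\<Union>?\<D> \<subseteq> \<Omega>" using C(1) by blast
    show "u x = 0" if "x \<notin> \<Omega>" for x using u(3)[of x] sub that by blast
    show "norm (u x) \<le> \<epsilon>" for x
    proof (cases "x \<in> \<Union>?\<D>")
      case True
      then obtain p where p: "p \<in> C" "x \<in> affine_copy D p" by blast
      have s: "snd p > 0" "snd p < \<eta>" using C(1)[OF p(1)] by blast+
      have "u x = snd p *\<^sub>R w ((x - fst p) /\<^sub>R snd p)" using u(2)[OF _ p(2)] p(1) W[OF p(1)] by auto
      then have "norm (u x) = snd p * norm (w ((x - fst p) /\<^sub>R snd p))" using s by simp
      also have "\<dots> \<le> \<eta> * B" using s B B0 by (intro mult_mono) auto
      finally show ?thesis using \<eta>(2) by simp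
    next
      case False
      then show ?thesis using u(3)[of x] \<open>\<epsilon> > 0\<close> by simp
    qed
    let ?bad = "{x\<in>D. \<not> (\<exists>M\<in>T. loc_affine w x M)}"
    have "negligible (\<Union>((\<lambda>p. (\<lambda>x. fst p + snd p *\<^sub>R x) ` ?bad) ` C))"
    proof (rule negligible_countable_Union)
      show "countable ((\<lambda>p. (\<lambda>x. fst p + snd p *\<^sub>R x) ` ?bad) ` C)" using C(4) by simp
      fix S assume "S \<in> (\<lambda>p. (\<lambda>x. fst p + snd p *\<^sub>R x) ` ?bad) ` C"
      then obtain p where p: "S = (\<lambda>x. fst p + snd p *\<^sub>R x) ` ?bad" by blast
      show "negligible S" unfolding p
      proof (rule negligible_locally_Lipschitz_image[OF order_refl neg])
        fix x
        have "norm ((fst p + snd p *\<^sub>R y) - (fst p + snd p *\<^sub>R x)) \<le> \<bar>snd p\<bar> * norm (y - x)" for y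
          by (simp flip: scaleR_diff_right)
        then show "\<exists>T B. open T \<and> x \<in> T \<and>
            (\<forall>y\<in>?bad \<inter> T. norm ((fst p + snd p *\<^sub>R y) - (fst p + snd p *\<^sub>R x)) \<le> B * norm (y - x))"
          by (intro exI[of _ UNIV] exI[of _ "\<bar>snd p\<bar>"]) auto
      qed
    qed
    then have "negligible ((\<Omega> - \<Union>?\<D>) \<union> \<Union>((\<lambda>p. (\<lambda>x. fst p + snd p *\<^sub>R x) ` ?bad) ` C))"
      using C(3) by (intro negligible_Un) auto
    moreover have "{x\<in>\<Omega>. \<not> (\<exists>M\<in>T. loc_affine u x M)} \<subseteq> (\<Omega> - \<Union>?\<D>) \<union> \<Union>((\<lambda>p. (\<lambda>x. fst p + snd p *\<^sub>R x) ` ?bad) ` C)"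
    proof (rule subsetI, rule ccontr)
      fix x assume x: "x \<in> {x\<in>\<Omega>. \<not> (\<exists>M\<in>T. loc_affine u x M)}"
      assume n: "x \<notin> (\<Omega> - \<Union>?\<D>) \<union> \<Union>((\<lambda>p. (\<lambda>x. fst p + snd p *\<^sub>R x) ` ?bad) ` C)"
      then obtain p where p: "p \<in> C" "x \<in> affine_copy D p" using x by blast
      have s: "snd p > 0" using C(1)[OF p(1)] by blast
      have "x = fst p + snd p *\<^sub>R ((x - fst p) /\<^sub>R snd p)" using s by simp
      then have "(x - fst p) /\<^sub>R snd p \<notin> ?bad" using n p(1) by blast
      then obtain M where M: "M \<in> T" "loc_affine w ((x - fst p) /\<^sub>R snd p) M" using mem[OF p(1), of x] p(2) by blast
      have "open (affine_copy D p)" unfolding affine_copy_def using D(1) s by (intro open_affinity) auto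
      moreover have "u y = snd p *\<^sub>R w ((y - fst p) /\<^sub>R snd p)" if "y \<in> affine_copy D p" for y
        using u(2)[OF _ that] p(1) W[OF p(1)] by auto
      ultimately have "loc_affine u x M"
        using loc_affine_cong_on[of "affine_copy D p" x u "\<lambda>y. snd p *\<^sub>R w ((y - fst p) /\<^sub>R snd p)" M] p(2)
          loc_affine_rescale[OF M(2) s] by blast
      then show False using x M(1) by blast
    qed
    ultimately show "negligible {x\<in>\<Omega>. \<not> (\<exists>M\<in>T. loc_affine u x M)}" by (rule negligible_subset)
  qed
qed

text \<open>The row space is spanned by a single vector e, and a collects the coefficients of the
  rows.\<close>

lemma rank_one_outer:
  fixes X :: "real^'n^'m"
  assumes "rank X = 1"
  obtains a e where "X = outer_product a e" "e \<noteq> 0" "X \<noteq> 0"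
proof -
  have dim: "dim (rows X) = 1" using assms by (simp add: row_rank_def)
  obtain B where B: "B \<subseteq> rows X" "independent B" "rows X \<subseteq> span B" "card B = dim (rows X)"
    by (rule basis_exists)
  then obtain e where e: "B = {e}" unfolding dim by (elim card_1_singletonE)
  have "e \<noteq> 0" using B(2) dependent_zero[of B] unfolding e by blast
  have "\<exists>c. X $ i = c *\<^sub>R e" for i
  proof -
    have "row i X \<in> span {e}" using B(3) e by (auto simp: rows_def)
    then show ?thesis by (auto simp: span_singleton row_def)
  qed
  then obtain c where c: "\<And>i. X $ i = c i *\<^sub>R e" by metis
  have "X = outer_product (\<chi> i. c i) e" by (simp add: vec_eq_iff outer_product_def c)
  moreover have "X \<noteq> 0" using assms by (metis rank_0 zero_neq_one)
  ultimately show ?thesis using that \<open>e \<noteq> 0\<close> by blast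
qed

section \<open>Volume fractions of the two phases\<close>

lemma matrix_component_bound:
  fixes A :: "real^'n^'m"
  shows "\<bar>A $ i $ j\<bar> \<le> norm A"
  using component_le_norm_cart[of "A $ i" j] Finite_Cartesian_Product.norm_nth_le[of A i] by linarith

lemma open_loc_affine_in:
  fixes u :: "real^'n \<Rightarrow> real^'m"
  assumes "open \<Omega>"
  shows "open {x\<in>\<Omega>. \<exists>M\<in>T. loc_affine u x M}"
proof -
  have "{x\<in>\<Omega>. \<exists>M\<in>T. loc_affine u x M} = \<Omega> \<inter> {x. \<exists>M\<in>T. loc_affine u x M}" by blast
  then show ?thesis using open_Int[OF assms open_loc_affine[of T u]] by simp
qed

text \<open>The gradient has mean zero because \<open>w\<close> vanishes off \<open>\<Omega>\<close>; this alone fixes the volume fractions.\<close>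

lemma laminate_fractions:
  fixes w :: "real^'n \<Rightarrow> real^'m" and X :: "real^'n^'m"
  assumes lip: "L-lipschitz_on UNIV w" and \<Omega>: "open \<Omega>" "bounded \<Omega>" and off: "\<And>x. x \<notin> \<Omega> \<Longrightarrow> w x = 0"
    and neg: "negligible {x\<in>\<Omega>. \<not> (\<exists>M\<in>ball ((1 - t) *\<^sub>R X) \<delta> \<union> ball ((- t) *\<^sub>R X) \<delta>. loc_affine w x M)}"
    and disj: "ball ((1 - t) *\<^sub>R X) \<delta> \<inter> ball ((- t) *\<^sub>R X) \<delta> = {}"
  defines "A \<equiv> {x\<in>\<Omega>. \<exists>M\<in>ball ((1 - t) *\<^sub>R X) \<delta>. loc_affine w x M}"
    and "B \<equiv> {x\<in>\<Omega>. \<exists>M\<in>ball ((- t) *\<^sub>R X) \<delta>. loc_affine w x M}"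
  shows "measure lebesgue A + measure lebesgue B = measure lebesgue \<Omega>"
    "\<bar>X $ i $ j\<bar> * \<bar>measure lebesgue A - t * measure lebesgue \<Omega>\<bar> \<le> \<delta> * measure lebesgue \<Omega>"
proof -
  let ?m = "measure lebesgue"
  have lm: "\<Omega> \<in> lmeasurable" using \<Omega> by (simp add: lmeasurable_open)
  have opA: "open A" and opB: "open B" unfolding A_def B_def by (rule open_loc_affine_in[OF \<Omega>(1)])+
  have sub: "A \<subseteq> \<Omega>" "B \<subseteq> \<Omega>" by (auto simp: A_def B_def)
  have lmA: "A \<in> lmeasurable" and lmB: "B \<in> lmeasurable"
    using bounded_subset[OF \<Omega>(2) sub(1)] bounded_subset[OF \<Omega>(2) sub(2)] opA opB by (auto intro: lmeasurable_open)
  have AB: "A \<inter> B = {}" using disj loc_affine_unique unfolding A_def B_def by blast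
  have neg': "negligible (\<Omega> - (A \<union> B))"
    by (rule negligible_subset[OF neg]) (auto simp: A_def B_def)
  have "?m (A \<union> B) = ?m \<Omega>"
  proof (rule measure_negligible_symdiff[OF lm])
    have "\<Omega> - (A \<union> B) \<union> (A \<union> B - \<Omega>) = \<Omega> - (A \<union> B)" using sub by blast
    then show "negligible (\<Omega> - (A \<union> B) \<union> (A \<union> B - \<Omega>))" using neg' by simp
  qed
  moreover have "?m (A \<union> B) = ?m A + ?m B" using AB by (intro measure_Un2[OF lmA lmB, THEN trans]) (simp add: Diff_triv Int_commute)
  ultimately show sum: "?m A + ?m B = ?m \<Omega>" by simp
  let ?M = "lebesgue_on \<Omega>"
  interpret finite_measure ?M by (rule finite_measure_lebesgue_on[OF lm])
  have \<Omega>': "\<Omega> \<inter> space lebesgue \<in> sets lebesgue" using \<Omega>(1) by simp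
  have aff: "negligible {x\<in>\<Omega>. \<nexists>M. loc_affine w x M}" by (rule negligible_subset[OF neg]) blast
  have ind: "integrable ?M (indicator S :: _ \<Rightarrow> real)" "(LINT x|?M. indicator S x) = ?m S" if "open S" "S \<subseteq> \<Omega>" for S
  proof -
    have b: "(indicator S :: _ \<Rightarrow> real) \<in> borel_measurable ?M"
      by (rule borel_measurable_lebesgue_on) (use that in simp)
    show "integrable ?M (indicator S :: _ \<Rightarrow> real)"
      by (rule integrable_lebesgue_on_bounded[OF lm b, where C = 1]) (simp add: indicator_def)
    have "measure ?M S = ?m S" by (rule measure_restrict_space[OF \<Omega>' that(2)])
    then show "(LINT x|?M. indicator S x) = ?m S" using that(2) by (simp add: Int_absorb2)
  qed
  let ?\<alpha> = "X $ i $ j"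
  \<comment> \<open>The (i, j) entry of an idealised gradient equal to (1 - t) X on A and - t X on
    B. It differs from the true entry by at most \<delta>, and the latter has integral 0.\<close>
  let ?f = "\<lambda>x. ?\<alpha> * ((1 - t) * indicator A x - t * indicator B x)"
  have if': "integrable ?M ?f" using ind(1)[OF opA sub(1)] ind(1)[OF opB sub(2)] by simp
  have bg: "(\<lambda>x. grad w x $ i $ j) \<in> borel_measurable ?M"
    by (rule borel_measurable_lebesgue_on) measurable
  have ig: "integrable ?M (\<lambda>x. grad w x $ i $ j)"
    by (rule integrable_lebesgue_on_bounded[OF lm bg, where C = L]) (simp add: grad_component_bound[OF lip])
  have "AE x in ?M. \<bar>?f x - grad w x $ i $ j\<bar> \<le> \<delta>"
  proof -
    have "AE x in lebesgue. x \<notin> \<Omega> - (A \<union> B)" using neg' unfolding negligible_iff_null_sets by (rule AE_not_in)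
    then have *: "AE x in lebesgue. x \<in> \<Omega> \<longrightarrow> x \<in> A \<or> x \<in> B" by eventually_elim blast
    have "AE x in ?M. x \<in> A \<or> x \<in> B" unfolding AE_restrict_space_iff[OF \<Omega>'] by (rule *)
    then show ?thesis
    proof eventually_elim
      case (elim x)
      have comp: "\<bar>s * ?\<alpha> - grad w x $ i $ j\<bar> \<le> \<delta>" if M: "M \<in> ball (s *\<^sub>R X) \<delta>" "loc_affine w x M" for M s
        using matrix_component_bound[of "s *\<^sub>R X - M" i j] M(1) by (simp add: grad_eq[OF M(2)] dist_norm)
      show ?case
      proof (cases "x \<in> A")
        case True
        then obtain M where "M \<in> ball ((1 - t) *\<^sub>R X) \<delta>" "loc_affine w x M" by (auto simp: A_def)
        from comp[OF this] True AB show ?thesis by (auto simp: indicator_def mult.commute)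
      next
        case False
        then have "x \<in> B" using elim by blast
        then obtain M where "M \<in> ball ((- t) *\<^sub>R X) \<delta>" "loc_affine w x M" by (auto simp: B_def)
        from comp[OF this] False \<open>x \<in> B\<close> show ?thesis by (simp add: mult.commute)
      qed
    qed
  qed
  then have "(LINT x|?M. \<bar>?f x - grad w x $ i $ j\<bar>) \<le> (LINT x|?M. \<delta>)"
    using if' ig by (intro integral_mono_AE) auto
  also have "\<dots> = \<delta> * ?m \<Omega>" using lm by (simp add: measure_restrict_space fmeasurableD)
  finally have 1: "\<bar>LINT x|?M. ?f x - grad w x $ i $ j\<bar> \<le> \<delta> * ?m \<Omega>"
    using integral_abs_bound[of ?M "\<lambda>x. ?f x - grad w x $ i $ j"] by linarith
  have "(LINT x|?M. ?f x - grad w x $ i $ j) = (LINT x|?M. ?f x)"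
    using if' ig integral_grad_zero[OF lip \<Omega> off aff, of i j] by simp
  also have "\<dots> = ?\<alpha> * ((1 - t) * ?m A - t * ?m B)"
    using ind[OF opA sub(1)] ind[OF opB sub(2)] by simp
  also have "(1 - t) * ?m A - t * ?m B = ?m A - t * ?m \<Omega>"
    unfolding sum[symmetric] by (simp add: algebra_simps)
  finally show "\<bar>?\<alpha>\<bar> * \<bar>?m A - t * ?m \<Omega>\<bar> \<le> \<delta> * ?m \<Omega>" using 1 by (simp add: abs_mult)
qed

text \<open>For s \<ge> 0, finitely many members carry all but e of the measure, and disjointness
  lets the inequality be added over them. Negative s can arise as d - \<epsilon> and is
  trivial.\<close>

lemma measure_Union_superadditive:
  fixes Z :: "(real^'n) set \<Rightarrow> (real^'n) set"
  assumes \<D>: "disjoint \<D>" "countable \<D>" "\<And>U. U \<in> \<D> \<Longrightarrow> open U" "\<Union>\<D> \<subseteq> \<Omega>" "bounded \<Omega>"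
    and Z: "\<And>U. U \<in> \<D> \<Longrightarrow> open (Z U) \<and> Z U \<subseteq> U \<and> s * measure lebesgue U \<le> measure lebesgue (Z U)"
  shows "s * measure lebesgue (\<Union>\<D>) \<le> measure lebesgue (\<Union>U\<in>\<D>. Z U)"
proof (cases "s \<ge> 0")
  case False
  then show ?thesis using measure_nonneg[of lebesgue "\<Union>\<D>"] measure_nonneg[of lebesgue "\<Union>U\<in>\<D>. Z U"]
    by (meson le_less_trans linorder_not_le mult_nonpos_nonneg nle_le order_trans)
next
  case True
  let ?m = "measure lebesgue"
  have lm: "S \<in> lmeasurable" if "open S" "S \<subseteq> \<Omega>" for S
    using that bounded_subset[OF \<D>(5)] by (intro lmeasurable_open) auto
  have lmD: "\<Union>\<D>' \<in> lmeasurable" if "\<D>' \<subseteq> \<D>" for \<D>'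
    using that \<D>(3,4) by (intro lm open_Union) blast+
  have lmU: "U \<in> lmeasurable" if "U \<in> \<D>" for U using that \<D>(3,4) by (intro lm) auto
  have lmZ: "Z U \<in> lmeasurable" if "U \<in> \<D>" for U
    using Z[OF that] that \<D>(4) by (intro lm) blast+
  have opZ: "open (\<Union>U\<in>\<D>. Z U)" using Z by (intro open_UN) blast
  have lmUZ: "(\<Union>U\<in>\<D>. Z U) \<in> lmeasurable" using opZ Z \<D>(4) by (intro lm) blast+
  have fin: "s * ?m (\<Union>\<D>') \<le> ?m (\<Union>U\<in>\<D>. Z U)" if "\<D>' \<subseteq> \<D>" "finite \<D>'" for \<D>'
  proof -
    have dj: "U \<inter> V = {}" if "U \<in> \<D>'" "V \<in> \<D>'" "U \<noteq> V" for U V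
      using that \<open>\<D>' \<subseteq> \<D>\<close> \<D>(1) unfolding disjoint_def by blast
    have "?m (\<Union>\<D>') = (\<Sum>U\<in>\<D>'. ?m U)"
    proof (rule measure_negligible_finite_Union[OF that(2)])
      show "S \<in> lmeasurable" if "S \<in> \<D>'" for S using that \<open>\<D>' \<subseteq> \<D>\<close> lmU by blast
      show "pairwise (\<lambda>S T. negligible (S \<inter> T)) \<D>'" unfolding pairwise_def by (simp add: dj)
    qed
    then have "s * ?m (\<Union>\<D>') = (\<Sum>U\<in>\<D>'. s * ?m U)" by (simp add: sum_distrib_left)
    also have "\<dots> \<le> (\<Sum>U\<in>\<D>'. ?m (Z U))" using Z that(1) by (intro sum_mono) blast
    also have "\<dots> = ?m (\<Union>(Z ` \<D>'))"
    proof (rule measure_negligible_finite_Union_image[OF that(2), symmetric])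
      show "Z U \<in> lmeasurable" if "U \<in> \<D>'" for U using that \<open>\<D>' \<subseteq> \<D>\<close> lmZ by blast
      have "Z U \<inter> Z V = {}" if "U \<in> \<D>'" "V \<in> \<D>'" "U \<noteq> V" for U V
        using dj[OF that] Z that(1,2) \<open>\<D>' \<subseteq> \<D>\<close> by blast
      then show "pairwise (\<lambda>U V. negligible (Z U \<inter> Z V)) \<D>'" unfolding pairwise_def by simp
    qed
    also have "\<dots> \<le> ?m (\<Union>U\<in>\<D>. Z U)"
    proof (rule measure_mono_fmeasurable[OF _ _ lmUZ])
      show "\<Union>(Z ` \<D>') \<subseteq> (\<Union>U\<in>\<D>. Z U)" using that(1) by blast
      have "open (\<Union>(Z ` \<D>'))" using Z that(1) by (intro open_UN) blast
      then show "\<Union>(Z ` \<D>') \<in> sets lebesgue" by simp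
    qed
    finally show ?thesis .
  qed
  have le: "?m (\<Union>D') \<le> ?m (\<Union>\<D>)" if "D' \<subseteq> \<D>" "finite D'" for D'
    by (rule measure_mono_fmeasurable) (use that(1) lmD[OF that(1)] lmD[of \<D>] in \<open>auto simp: fmeasurableD\<close>)
  have "s * ?m (\<Union>\<D>) \<le> ?m (\<Union>U\<in>\<D>. Z U) + s * e" if e: "e > 0" for e
  proof -
    obtain D' where D': "D' \<subseteq> \<D>" "finite D'" "?m (\<Union>\<D>) - e < ?m (\<Union>D')"
      by (rule measure_countable_Union_approachable[OF \<D>(2) e lmU le])
    have "s * (?m (\<Union>\<D>) - e) \<le> s * ?m (\<Union>D')" using D'(3) True by (intro mult_left_mono) auto
    then show ?thesis using fin[OF D'(1,2)] by (simp add: right_diff_distrib)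
  qed
  note * = this
  show ?thesis
  proof (rule field_le_epsilon)
    fix e :: real assume "e > 0"
    then have "s * (e / (s + 1)) \<le> e" using True by (simp add: field_simps)
    then show "s * ?m (\<Union>\<D>) \<le> ?m (\<Union>U\<in>\<D>. Z U) + e" using *[of "e / (s + 1)"] \<open>e > 0\<close> True by simp
  qed
qed

subsection \<open>Approachable matrices\<close>

text \<open>The map w is the new layer, u the layer already present, and \<xi> the gradient of the
  underlying affine map, so the total gradient is \<xi> + M. It has to lie in V almost everywhere,
  whereas membership in G is only counted by volume; s may be negative.\<close>

definition perturbation ::
    "(real^'n^'m) set \<Rightarrow> (real^'n^'m) set \<Rightarrow> real \<Rightarrow> real \<Rightarrow> real \<Rightarrow> (real^'n) set \<Rightarrow>
      (real^'n \<Rightarrow> real^'m) \<Rightarrow> real^'n^'m \<Rightarrow> (real^'n \<Rightarrow> real^'m) \<Rightarrow> bool" where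
  "perturbation V G L \<epsilon> s \<Omega> u \<xi> w \<longleftrightarrow> L-lipschitz_on UNIV w \<and> (\<forall>x. x \<notin> \<Omega> \<longrightarrow> w x = 0) \<and> (\<forall>x. norm (w x) \<le> \<epsilon>) \<and>
     negligible {x\<in>\<Omega>. \<nexists>M. loc_affine (\<lambda>y. u y + w y) x M \<and> \<xi> + M \<in> V} \<and>
     s * measure lebesgue \<Omega> \<le> measure lebesgue {x\<in>\<Omega>. \<exists>M. loc_affine (\<lambda>y. u y + w y) x M \<and> \<xi> + M \<in> G}"

text \<open>\<open>approachable V G \<xi> d\<close>: affine data with gradient near \<open>\<xi>\<close> can be perturbed, with small sup norm and
  gradients in \<open>V\<close>, so that the gradients lie in \<open>G\<close> on nearly the fraction \<open>d\<close> of the domain. Both \<open>r\<close>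
  and the Lipschitz constant must not depend on the domain, since the perturbations are glued over
  countably many pieces.\<close>

definition approachable :: "(real^'n^'m) set \<Rightarrow> (real^'n^'m) set \<Rightarrow> real^'n^'m \<Rightarrow> real \<Rightarrow> bool" where
  "approachable V G \<xi> d \<longleftrightarrow> 0 \<le> d \<and> d \<le> 1 \<and> (\<forall>\<epsilon>>0. \<exists>r>0. \<exists>L. \<forall>\<xi>'\<in>ball \<xi> r. \<forall>\<Omega>. open \<Omega> \<and> bounded \<Omega> \<longrightarrow>
     (\<exists>w. perturbation V G L \<epsilon> (d - \<epsilon>) \<Omega> (\<lambda>x. 0) \<xi>' w))"

lemma loc_affine_zero: "loc_affine (\<lambda>x. 0) x 0"
  using loc_affine_affine[of 0 0 x] by simp

text \<open>The zero perturbation suffices. This starts the induction, at the matrices that H_I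
  places in int K.\<close>

lemma approachable_interior:
  fixes V G :: "(real^'n^'m) set"
  assumes "open V" "\<xi> \<in> V" "open G"
  shows "approachable V G \<xi> (if \<xi> \<in> G then 1 else 0)"
  unfolding approachable_def
proof (intro conjI allI impI)
  fix \<epsilon> :: real assume "\<epsilon> > 0"
  obtain r1 where r1: "r1 > 0" "ball \<xi> r1 \<subseteq> V" using assms(1,2) open_contains_ball by blast
  obtain r2 where r2: "r2 > 0" "\<xi> \<in> G \<Longrightarrow> ball \<xi> r2 \<subseteq> G"
    using assms(3) open_contains_ball by (metis zero_less_one)
  have *: "perturbation V G 0 \<epsilon> ((if \<xi> \<in> G then 1 else 0) - \<epsilon>) \<Omega> (\<lambda>x. 0) \<xi>' (\<lambda>x. 0)"
    if "\<xi>' \<in> ball \<xi> (min r1 r2)" for \<xi>' and \<Omega> :: "(real^'n) set"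
    unfolding perturbation_def
  proof (intro conjI allI impI)
    show "0-lipschitz_on UNIV (\<lambda>x :: real^'n. 0 :: real^'m)" by (auto intro: lipschitz_onI)
    have "\<exists>M. loc_affine (\<lambda>y. 0 + 0) x M \<and> \<xi>' + M \<in> V" for x :: "real^'n"
      using loc_affine_zero that r1(2) by (intro exI[of _ 0]) auto
    then have "{x\<in>\<Omega>. \<nexists>M. loc_affine (\<lambda>y. 0 + 0) x M \<and> \<xi>' + M \<in> V} = {}" by blast
    then show "negligible {x\<in>\<Omega>. \<nexists>M. loc_affine (\<lambda>y. 0 + 0) x M \<and> \<xi>' + M \<in> V}" by (simp only: negligible_empty)
    let ?S = "{x\<in>\<Omega>. \<exists>M. loc_affine (\<lambda>y. 0 + 0) x M \<and> \<xi>' + M \<in> G}"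
    show "((if \<xi> \<in> G then 1 else 0) - \<epsilon>) * measure lebesgue \<Omega> \<le> measure lebesgue ?S"
    proof (cases "\<xi> \<in> G")
      case True
      have "\<exists>M. loc_affine (\<lambda>y. 0 + 0) x M \<and> \<xi>' + M \<in> G" for x :: "real^'n"
        using loc_affine_zero that r2(2)[OF True] by (intro exI[of _ 0]) auto
      then have "?S = \<Omega>" by blast
      then show ?thesis using True \<open>\<epsilon> > 0\<close> by (simp add: left_diff_distrib)
    next
      case False
      have "- \<epsilon> * measure lebesgue \<Omega> \<le> 0" using \<open>\<epsilon> > 0\<close> by simp
      also have "0 \<le> measure lebesgue ?S" by (rule measure_nonneg)
      finally show ?thesis using False by simp
    qed
  qed (use \<open>\<epsilon> > 0\<close> in auto)
  show "\<exists>r>0. \<exists>L. \<forall>\<xi>'\<in>ball \<xi> r. \<forall>\<Omega>. open \<Omega> \<and> bounded \<Omega> \<longrightarrow>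
     (\<exists>w. perturbation V G L \<epsilon> ((if \<xi> \<in> G then 1 else 0) - \<epsilon>) \<Omega> (\<lambda>x. 0) \<xi>' w)"
  proof (rule exI[of _ "min r1 r2"], rule conjI)
    show "min r1 r2 > 0" using r1(1) r2(1) by simp
    show "\<exists>L. \<forall>\<xi>'\<in>ball \<xi> (min r1 r2). \<forall>\<Omega>. open \<Omega> \<and> bounded \<Omega> \<longrightarrow>
       (\<exists>w. perturbation V G L \<epsilon> ((if \<xi> \<in> G then 1 else 0) - \<epsilon>) \<Omega> (\<lambda>x. 0) \<xi>' w)"
      using * by blast
  qed
qed auto

text \<open>On a piece where u has the constant gradient M, adding u shifts all gradients by M. A
  perturbation built for the gradient \<xi> + M alone therefore becomes a second layer on top of
  u.\<close>

lemma perturbation_shift: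
  assumes p: "perturbation V G L \<epsilon> s U (\<lambda>x. 0) (\<xi> + M) w" and U: "open U" "bounded U"
    and u: "\<And>x. x \<in> U \<Longrightarrow> u x = M *v x + b"
  shows "perturbation V G L \<epsilon> s U u \<xi> w"
proof -
  have la: "loc_affine (\<lambda>y. u y + w y) x (M + N)" if "x \<in> U" "loc_affine (\<lambda>y. 0 + w y) x N" for x N
  proof (rule loc_affine_add)
    show "loc_affine u x M"
      using loc_affine_cong_on[OF U(1) that(1), of u "\<lambda>y. M *v y + b" M] u loc_affine_affine by blast
    show "loc_affine w x N" using that(2) by simp
  qed
  have *: "\<exists>N. loc_affine (\<lambda>y. u y + w y) x N \<and> \<xi> + N \<in> S"
    if "x \<in> U" "\<exists>N. loc_affine (\<lambda>y. 0 + w y) x N \<and> \<xi> + M + N \<in> S" for x S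
    using that la by (metis add.assoc)
  have "negligible {x\<in>U. \<nexists>N. loc_affine (\<lambda>y. u y + w y) x N \<and> \<xi> + N \<in> V}"
    by (rule negligible_subset[of "{x\<in>U. \<nexists>N. loc_affine (\<lambda>y. 0 + w y) x N \<and> \<xi> + M + N \<in> V}"])
      (use p * in \<open>auto simp: perturbation_def\<close>)
  moreover have "measure lebesgue {x\<in>U. \<exists>N. loc_affine (\<lambda>y. 0 + w y) x N \<and> \<xi> + M + N \<in> G} \<le>
      measure lebesgue {x\<in>U. \<exists>N. loc_affine (\<lambda>y. u y + w y) x N \<and> \<xi> + N \<in> G}"
  proof (rule measure_mono_fmeasurable)
    have op: "open {x\<in>U. \<exists>N. loc_affine f x N \<and> \<zeta> + N \<in> G}" for f \<zeta>
      using open_loc_affine_in[OF U(1), of "{N. \<zeta> + N \<in> G}" f] by (simp add: Bex_def conj_commute)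
    show "{x\<in>U. \<exists>N. loc_affine (\<lambda>y. 0 + w y) x N \<and> \<xi> + M + N \<in> G} \<in> sets lebesgue" using op by simp
    show "{x\<in>U. \<exists>N. loc_affine (\<lambda>y. u y + w y) x N \<and> \<xi> + N \<in> G} \<in> lmeasurable"
      by (rule lmeasurable_open[OF bounded_subset[OF U(2)] op]) blast
  qed (use * in blast)
  ultimately show ?thesis using p unfolding perturbation_def by (blast intro: order_trans)
qed

text \<open>A first layer u makes the gradient lie near A or near B, on parts of relative volume
  about t and 1 - t. On each affine piece of these parts the total gradient is one constant within
  the radius allowed for A or B, so a second layer exists there, and all second layers glue because
  each vanishes off its piece.\<close>

lemma approachable_laminate:
  fixes V G :: "(real^'n^'m) set"
  assumes A: "approachable V G A dA" and B: "approachable V G B dB" and rk: "rank (A - B) = 1" and t: "0 < t" "t < 1"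
  shows "approachable V G (t *\<^sub>R A + (1 - t) *\<^sub>R B) (t * dA + (1 - t) * dB)"
proof -
  have dA: "0 \<le> dA" "dA \<le> 1" and dB: "0 \<le> dB" "dB \<le> 1" using A B by (auto simp: approachable_def)
  let ?d = "t * dA + (1 - t) * dB" and ?C = "t *\<^sub>R A + (1 - t) *\<^sub>R B" and ?m = "measure lebesgue"
  obtain a e where X: "A - B = outer_product a e" "e \<noteq> 0" "A - B \<noteq> 0" by (rule rank_one_outer[OF rk])
  define X where "X = A - B"
  have X': "X = outer_product a e" "X \<noteq> 0" using X by (auto simp: X_def)
  obtain i j where ij: "X $ i $ j \<noteq> 0" using X'(2) by (auto simp: vec_eq_iff)
  \<comment> \<open>Relative to the barycentre the two phases sit at (1 - t) X and - t X.\<close>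
  have C: "?C + (1 - t) *\<^sub>R X = A" "?C + (- t) *\<^sub>R X = B" by (auto simp: X_def algebra_simps)
  show ?thesis
    unfolding approachable_def
  proof (intro conjI allI impI)
    show "0 \<le> ?d" using t dA dB by simp
    show "?d \<le> 1" using convex_bound_le[OF dA(2) dB(2), of t "1 - t"] t by simp
    fix \<epsilon> :: real assume "\<epsilon> > 0"
    \<comment> \<open>Three losses of volume fraction: the errors in the volumes of the two parts,
      weighted by dA \<le> 1 and dB \<le> 1, and what the second layers lose on both parts together.
      The sup norm spends only two of the thirds.\<close>
    define \<epsilon>1 where "\<epsilon>1 = \<epsilon> / 3"
    have \<epsilon>1: "\<epsilon>1 > 0" using \<open>\<epsilon> > 0\<close> by (simp add: \<epsilon>1_def)
    obtain rA LA where rA: "rA > 0" "\<And>\<xi> U. \<xi> \<in> ball A rA \<Longrightarrow> open U \<Longrightarrow> bounded U \<Longrightarrow> \<exists>w. perturbation V G LA \<epsilon>1 (dA - \<epsilon>1) U (\<lambda>x. 0) \<xi> w"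
      using A \<epsilon>1 unfolding approachable_def by meson
    obtain rB LB where rB: "rB > 0" "\<And>\<xi> U. \<xi> \<in> ball B rB \<Longrightarrow> open U \<Longrightarrow> bounded U \<Longrightarrow> \<exists>w. perturbation V G LB \<epsilon>1 (dB - \<epsilon>1) U (\<lambda>x. 0) \<xi> w"
      using B \<epsilon>1 unfolding approachable_def by meson
    define r where "r = min rA rB / 2"
    \<comment> \<open>Three demands: together with r it stays within the radii for A and B, the
      balls around the two phases are disjoint, and division by the nonzero entry X_ij turns the
      error of the gradient into a relative volume error of at most \<epsilon>1.\<close>
    define \<delta> where "\<delta> = min r (min (norm X / 2) (\<bar>X $ i $ j\<bar> * \<epsilon>1))"
    have r: "r > 0" "r + \<delta> \<le> rA" "r + \<delta> \<le> rB" using rA(1) rB(1) by (auto simp: r_def \<delta>_def)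
    have "\<bar>X $ i $ j\<bar> * \<epsilon>1 > 0" using ij \<epsilon>1 by simp
    then have \<delta>: "\<delta> > 0" using r X'(2) unfolding \<delta>_def by simp
    have \<delta>2: "\<delta> \<le> norm X / 2" unfolding \<delta>_def by (rule min.coboundedI2[OF min.cobounded1])
    have \<delta>3: "\<delta> \<le> \<bar>X $ i $ j\<bar> * \<epsilon>1" unfolding \<delta>_def by (rule min.coboundedI2[OF min.cobounded2])
    let ?TA = "ball ((1 - t) *\<^sub>R X) \<delta>" and ?TB = "ball ((- t) *\<^sub>R X) \<delta>"
    have disj: "?TA \<inter> ?TB = {}"
    proof (rule disjoint_ballI)
      have "(1 - t) *\<^sub>R X - (- t) *\<^sub>R X = X" by (simp add: algebra_simps)
      then have "dist ((1 - t) *\<^sub>R X) ((- t) *\<^sub>R X) = norm X" by (simp only: dist_norm)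
      then show "\<delta> + \<delta> \<le> dist ((1 - t) *\<^sub>R X) ((- t) *\<^sub>R X)" using \<delta>2 by simp
    qed
    obtain D w0 L0 B0 where D: "open D" "bounded D" "convex D" "0 \<in> D" "L0-lipschitz_on UNIV w0"
      "\<And>x. x \<notin> D \<Longrightarrow> w0 x = 0" "\<And>x. norm (w0 x) \<le> B0"
      "negligible {x\<in>D. \<not> (\<exists>M\<in>?TA \<union> ?TB. loc_affine w0 x M)}"
      by (rule laminate_base[OF t X(2) \<delta>, of a, folded X'(1)], rule that)
    \<comment> \<open>The two factors 2 come from the two gluings, over the copies of D and over the
      affine pieces. The constant is fixed before the domain and the gradient near the barycentre
      are chosen.\<close>
    define L where "L = 2 * L0 + 2 * max (max LA LB) 0"
    have main: "\<exists>w. perturbation V G L \<epsilon> (?d - \<epsilon>) \<Omega> (\<lambda>x. 0) \<xi> w"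
      if \<xi>: "\<xi> \<in> ball ?C r" and \<Omega>: "open \<Omega>" "bounded \<Omega>" for \<xi> and \<Omega> :: "(real^'n) set"
    proof -
      obtain u where u: "(2 * L0)-lipschitz_on UNIV u" "\<And>x. x \<notin> \<Omega> \<Longrightarrow> u x = 0" "\<And>x. norm (u x) \<le> \<epsilon>1"
        "negligible {x\<in>\<Omega>. \<not> (\<exists>M\<in>?TA \<union> ?TB. loc_affine u x M)}"
        by (rule transfer_to_domain[OF D(1,2,4,3,5,6,7,8) \<Omega> \<epsilon>1], assumption, rule that)
      define \<Omega>A where "\<Omega>A = {x\<in>\<Omega>. \<exists>M\<in>?TA. loc_affine u x M}"
      define \<Omega>B where "\<Omega>B = {x\<in>\<Omega>. \<exists>M\<in>?TB. loc_affine u x M}"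
      have frac: "?m \<Omega>A + ?m \<Omega>B = ?m \<Omega>" "\<bar>X $ i $ j\<bar> * \<bar>?m \<Omega>A - t * ?m \<Omega>\<bar> \<le> \<delta> * ?m \<Omega>"
        unfolding \<Omega>A_def \<Omega>B_def using laminate_fractions[OF u(1) \<Omega> u(2) u(4) disj] by blast+
      have mA: "\<bar>?m \<Omega>A - t * ?m \<Omega>\<bar> \<le> \<epsilon>1 * ?m \<Omega>"
      proof -
        have "\<delta> * ?m \<Omega> \<le> (\<bar>X $ i $ j\<bar> * \<epsilon>1) * ?m \<Omega>" using \<delta>3 by (rule mult_right_mono) simp
        then have "\<bar>X $ i $ j\<bar> * \<bar>?m \<Omega>A - t * ?m \<Omega>\<bar> \<le> \<bar>X $ i $ j\<bar> * (\<epsilon>1 * ?m \<Omega>)"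
          using frac(2) by (simp only: mult.assoc)
        then show ?thesis using ij by simp
      qed
      have op: "open \<Omega>A" "open \<Omega>B" unfolding \<Omega>A_def \<Omega>B_def by (rule open_loc_affine_in[OF \<Omega>(1)])+
      have sub: "\<Omega>A \<subseteq> \<Omega>" "\<Omega>B \<subseteq> \<Omega>" by (auto simp: \<Omega>A_def \<Omega>B_def)
      have AB: "\<Omega>A \<inter> \<Omega>B = {}" using disj loc_affine_unique unfolding \<Omega>A_def \<Omega>B_def by blast
      \<comment> \<open>Stated for a generic centre \<open>Q\<close> so that it serves both A and B.
        The empty piece is removed, since otherwise it might belong to both families.\<close>
      have pieces: "\<exists>\<D> W. disjoint \<D> \<and> countable \<D> \<and> \<Union>\<D> = \<Omega>' \<and> (\<forall>U\<in>\<D>. U \<noteq> {} \<and> open U \<and>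
           perturbation V G L' \<epsilon>1 s U u \<xi> (W U))"
        if op': "open \<Omega>'" and sub': "\<Omega>' \<subseteq> \<Omega>" and near: "\<And>x. x \<in> \<Omega>' \<Longrightarrow> \<exists>M. \<xi> + M \<in> ball Q \<rho> \<and> loc_affine u x M"
          and Q: "\<And>\<zeta> U. \<zeta> \<in> ball Q \<rho> \<Longrightarrow> open U \<Longrightarrow> bounded U \<Longrightarrow> \<exists>w. perturbation V G L' \<epsilon>1 s U (\<lambda>x. 0) \<zeta> w"
        for \<Omega>' Q \<rho> L' s
      proof -
        obtain \<D> where \<D>: "disjoint \<D>" "countable \<D>" "\<Union>\<D> = \<Omega>'" "\<And>U. U \<in> \<D> \<Longrightarrow> open U"
          "\<And>U. U \<in> \<D> \<Longrightarrow> \<exists>M b. \<forall>x\<in>U. u x = M *v x + b"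
          by (rule affine_pieces[OF op', of u]) (use near in blast, rule that)
        have "\<exists>w. perturbation V G L' \<epsilon>1 s U u \<xi> w" if U: "U \<in> \<D>" "U \<noteq> {}" for U
        proof -
          have opU: "open U" by (rule \<D>(4)[OF U(1)])
          have bU: "bounded U" using U(1) \<D>(3) sub' bounded_subset[OF \<Omega>(2)] by blast
          obtain M b where Mb: "\<forall>x\<in>U. u x = M *v x + b" using \<D>(5)[OF U(1)] by blast
          obtain x where x: "x \<in> U" using U(2) by blast
          have "x \<in> \<Omega>'" using x U(1) \<D>(3) by blast
          then obtain N where N: "\<xi> + N \<in> ball Q \<rho>" "loc_affine u x N" using near by blast
          have "loc_affine u x M"
            using loc_affine_cong_on[OF opU x, of u "\<lambda>y. M *v y + b" M] Mb loc_affine_affine by blast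
          then have "N = M" by (rule loc_affine_unique[OF N(2)])
          then obtain w where "perturbation V G L' \<epsilon>1 s U (\<lambda>x. 0) (\<xi> + M) w" using Q[OF N(1) opU bU] by blast
          then have "perturbation V G L' \<epsilon>1 s U u \<xi> w" by (rule perturbation_shift[OF _ opU bU]) (use Mb in blast)
          then show ?thesis by (rule exI[of "perturbation V G L' \<epsilon>1 s U u \<xi>"])
        qed
        then obtain W where W: "\<forall>U\<in>\<D> - {{}}. perturbation V G L' \<epsilon>1 s U u \<xi> (W U)"
          using bchoice[of "\<D> - {{}}" "\<lambda>U w. perturbation V G L' \<epsilon>1 s U u \<xi> w"] by blast
        have "disjoint (\<D> - {{}})" using \<D>(1) by (auto simp: disjoint_def)
        moreover have "\<Union>(\<D> - {{}}) = \<Omega>'" using \<D>(3) by auto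
        moreover have "countable (\<D> - {{}})" using \<D>(2) by simp
        ultimately show ?thesis using W \<D>(4) by (intro exI[of _ "\<D> - {{}}"] exI[of _ W]) auto
      qed
      have nearA: "\<exists>M. \<xi> + M \<in> ball A rA \<and> loc_affine u x M" if x: "x \<in> \<Omega>A" for x
      proof -
        obtain M where M: "M \<in> ?TA" "loc_affine u x M" using x unfolding \<Omega>A_def by blast
        have "dist (?C + (1 - t) *\<^sub>R X) (\<xi> + M) \<le> dist ?C \<xi> + dist ((1 - t) *\<^sub>R X) M" by (rule dist_triangle_add)
        then have "\<xi> + M \<in> ball A rA" using \<xi> M(1) r(2) unfolding C(1) by simp
        then show ?thesis using M(2) by blast
      qed
      have nearB: "\<exists>M. \<xi> + M \<in> ball B rB \<and> loc_affine u x M" if x: "x \<in> \<Omega>B" for x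
      proof -
        obtain M where M: "M \<in> ?TB" "loc_affine u x M" using x unfolding \<Omega>B_def by blast
        have "dist (?C + (- t) *\<^sub>R X) (\<xi> + M) \<le> dist ?C \<xi> + dist ((- t) *\<^sub>R X) M" by (rule dist_triangle_add)
        then have "\<xi> + M \<in> ball B rB" using \<xi> M(1) r(3) unfolding C(2) by simp
        then show ?thesis using M(2) by blast
      qed
      obtain \<D>A WA where DA: "disjoint \<D>A" "countable \<D>A" "\<Union>\<D>A = \<Omega>A"
        "\<And>U. U \<in> \<D>A \<Longrightarrow> U \<noteq> {} \<and> open U \<and> perturbation V G LA \<epsilon>1 (dA - \<epsilon>1) U u \<xi> (WA U)"
        using pieces[OF op(1) sub(1) nearA rA(2)] by blast
      obtain \<D>B WB where DB: "disjoint \<D>B" "countable \<D>B" "\<Union>\<D>B = \<Omega>B"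
        "\<And>U. U \<in> \<D>B \<Longrightarrow> U \<noteq> {} \<and> open U \<and> perturbation V G LB \<epsilon>1 (dB - \<epsilon>1) U u \<xi> (WB U)"
        using pieces[OF op(2) sub(2) nearB rB(2)] by blast
      have nAB: "U \<notin> \<D>A" if "U \<in> \<D>B" for U using that DA(3) DB(3,4) AB by blast
      define W where "W U = (if U \<in> \<D>A then WA U else WB U)" for U
      let ?\<D> = "\<D>A \<union> \<D>B" and ?L = "max (max LA LB) 0"
      have WA: "perturbation V G LA \<epsilon>1 (dA - \<epsilon>1) U u \<xi> (W U)" if "U \<in> \<D>A" for U
        using DA(4)[OF that] that by (simp add: W_def)
      have WB: "perturbation V G LB \<epsilon>1 (dB - \<epsilon>1) U u \<xi> (W U)" if "U \<in> \<D>B" for U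
        using DB(4)[OF that] nAB[OF that] by (simp add: W_def)
      have opU: "open U" if "U \<in> ?\<D>" for U using that DA(4) DB(4) by blast
      have dis: "disjoint ?\<D>"
        unfolding disjoint_def
      proof (intro ballI impI)
        fix U U' assume "U \<in> ?\<D>" "U' \<in> ?\<D>" "U \<noteq> U'"
        then consider "U \<in> \<D>A" "U' \<in> \<D>A" | "U \<in> \<D>B" "U' \<in> \<D>B" | "U \<in> \<D>A" "U' \<in> \<D>B" | "U \<in> \<D>B" "U' \<in> \<D>A" by blast
        then show "U \<inter> U' = {}"
        proof cases
          case 1 then show ?thesis using DA(1) \<open>U \<noteq> U'\<close> unfolding disjoint_def by blast
        next
          case 2 then show ?thesis using DB(1) \<open>U \<noteq> U'\<close> unfolding disjoint_def by blast
        next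
          case 3 then show ?thesis using AB DA(3) DB(3) by blast
        next
          case 4 then show ?thesis using AB DA(3) DB(3) by blast
        qed
      qed
      have W_lip: "?L-lipschitz_on UNIV (W U)" and W_off: "\<And>x. x \<notin> U \<Longrightarrow> W U x = 0"
        and W_le: "\<And>x. norm (W U x) \<le> \<epsilon>1"
        and W_neg: "negligible {x\<in>U. \<nexists>M. loc_affine (\<lambda>y. u y + W U y) x M \<and> \<xi> + M \<in> V}" if U: "U \<in> ?\<D>" for U
      proof -
        obtain L' s where *: "perturbation V G L' \<epsilon>1 s U u \<xi> (W U)" "L' \<le> ?L"
          using U WA[of U] WB[of U] by (metis UnE max.cobounded1 max.cobounded2 max.coboundedI1)
        show "?L-lipschitz_on UNIV (W U)"
          by (rule lipschitz_on_mono[of L']) (use * in \<open>auto simp: perturbation_def\<close>)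
        show "W U x = 0" if "x \<notin> U" for x using * that by (simp add: perturbation_def)
        show "norm (W U x) \<le> \<epsilon>1" for x using * by (simp add: perturbation_def)
        show "negligible {x\<in>U. \<nexists>M. loc_affine (\<lambda>y. u y + W U y) x M \<and> \<xi> + M \<in> V}" using * by (simp add: perturbation_def)
      qed
      obtain g where g: "(2 * ?L)-lipschitz_on UNIV g" "\<And>U x. U \<in> ?\<D> \<Longrightarrow> x \<in> U \<Longrightarrow> g x = W U x"
        "\<And>x. x \<notin> \<Union>?\<D> \<Longrightarrow> g x = 0"
        by (rule lipschitz_glue[OF dis W_lip W_off], assumption+, simp, rule that)
      define w where "w x = u x + g x" for x
      have loc: "loc_affine w x M \<longleftrightarrow> loc_affine (\<lambda>y. u y + W U y) x M" if "U \<in> ?\<D>" "x \<in> U" for U x M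
        by (rule loc_affine_cong_on[OF opU[OF that(1)] that(2)]) (use g(2)[OF that(1)] in \<open>simp add: w_def\<close>)
      have DU: "\<Union>?\<D> = \<Omega>A \<union> \<Omega>B" using DA(3) DB(3) by blast
      have "perturbation V G L \<epsilon> (?d - \<epsilon>) \<Omega> (\<lambda>x. 0) \<xi> w"
        unfolding perturbation_def add_0_left
      proof (intro conjI allI impI)
        show "L-lipschitz_on UNIV w" unfolding w_def L_def by (rule lipschitz_on_add[OF u(1) g(1)])
        show "w x = 0" if "x \<notin> \<Omega>" for x
        proof -
          have "x \<notin> \<Union>?\<D>" using that DU sub by blast
          then show ?thesis using u(2)[OF that] g(3) by (simp add: w_def)
        qed
        show "norm (w x) \<le> \<epsilon>" for x
        proof -
          have "norm (g x) \<le> \<epsilon>1"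
          proof (cases "x \<in> \<Union>?\<D>")
            case True
            then obtain U where U: "U \<in> ?\<D>" "x \<in> U" by blast
            show ?thesis unfolding g(2)[OF U] by (rule W_le[OF U(1)])
          next
            case False
            show ?thesis unfolding g(3)[OF False] using \<epsilon>1 by simp
          qed
          then have "norm (w x) \<le> \<epsilon>1 + \<epsilon>1" unfolding w_def by (intro norm_triangle_mono u(3))
          then show ?thesis using \<open>\<epsilon> > 0\<close> by (simp add: \<epsilon>1_def)
        qed
        let ?bad = "\<lambda>U. {x\<in>U. \<nexists>M. loc_affine (\<lambda>y. u y + W U y) x M \<and> \<xi> + M \<in> V}"
        have "negligible (\<Union>(?bad ` ?\<D>))"
          using DA(2) DB(2) W_neg by (intro negligible_countable_Union) auto
        then have "negligible ({x\<in>\<Omega>. \<not> (\<exists>M\<in>?TA \<union> ?TB. loc_affine u x M)} \<union> \<Union>(?bad ` ?\<D>))"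
          by (rule negligible_Un[OF u(4)])
        moreover have "{x\<in>\<Omega>. \<nexists>M. loc_affine w x M \<and> \<xi> + M \<in> V} \<subseteq>
            {x\<in>\<Omega>. \<not> (\<exists>M\<in>?TA \<union> ?TB. loc_affine u x M)} \<union> \<Union>(?bad ` ?\<D>)"
        proof (rule subsetI, rule ccontr)
          fix x assume x: "x \<in> {x\<in>\<Omega>. \<nexists>M. loc_affine w x M \<and> \<xi> + M \<in> V}"
          assume n: "x \<notin> {x\<in>\<Omega>. \<not> (\<exists>M\<in>?TA \<union> ?TB. loc_affine u x M)} \<union> \<Union>(?bad ` ?\<D>)"
          then have "x \<in> \<Union>?\<D>" using x unfolding DU \<Omega>A_def \<Omega>B_def by blast
          then obtain U where U: "U \<in> ?\<D>" "x \<in> U" by blast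
          then have "x \<notin> ?bad U" using n by blast
          then have "\<exists>M. loc_affine (\<lambda>y. u y + W U y) x M \<and> \<xi> + M \<in> V" using U(2) by blast
          then show False using x loc[OF U] by blast
        qed
        ultimately show "negligible {x\<in>\<Omega>. \<nexists>M. loc_affine w x M \<and> \<xi> + M \<in> V}" by (rule negligible_subset)
        define Z where "Z U = {x\<in>U. \<exists>M. loc_affine (\<lambda>y. u y + W U y) x M \<and> \<xi> + M \<in> G}" for U
        let ?S = "{x\<in>\<Omega>. \<exists>M. loc_affine w x M \<and> \<xi> + M \<in> G}"
        have opZ: "open (Z U)" if "open U" for U
          using open_loc_affine_in[OF that, of "{N. \<xi> + N \<in> G}" "\<lambda>y. u y + W U y"]
          unfolding Z_def by (simp add: Bex_def conj_commute)
        have opS: "open ?S"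
          using open_loc_affine_in[OF \<Omega>(1), of "{N. \<xi> + N \<in> G}" w] by (simp add: Bex_def conj_commute)
        have lmS: "?S \<in> lmeasurable" by (rule lmeasurable_open[OF bounded_subset[OF \<Omega>(2)] opS]) blast
        have ZA: "(dA - \<epsilon>1) * ?m (\<Union>\<D>A) \<le> ?m (\<Union>U\<in>\<D>A. Z U)"
        proof (rule measure_Union_superadditive[OF DA(1,2) _ _ \<Omega>(2)])
          show "open (Z U) \<and> Z U \<subseteq> U \<and> (dA - \<epsilon>1) * ?m U \<le> ?m (Z U)" if "U \<in> \<D>A" for U
            using opZ[of U] DA(4)[OF that] WA[OF that] by (auto simp: perturbation_def Z_def)
        qed (use DA sub in auto)
        have ZB: "(dB - \<epsilon>1) * ?m (\<Union>\<D>B) \<le> ?m (\<Union>U\<in>\<D>B. Z U)"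
        proof (rule measure_Union_superadditive[OF DB(1,2) _ _ \<Omega>(2)])
          show "open (Z U) \<and> Z U \<subseteq> U \<and> (dB - \<epsilon>1) * ?m U \<le> ?m (Z U)" if "U \<in> \<D>B" for U
            using opZ[of U] DB(4)[OF that] WB[OF that] by (auto simp: perturbation_def Z_def)
        qed (use DB sub in auto)
        have subZ: "Z U \<subseteq> U" for U by (auto simp: Z_def)
        have ZS: "Z U \<subseteq> ?S" if "U \<in> ?\<D>" for U
          using loc[OF that] that DU sub unfolding Z_def by blast
        have opZA: "open (\<Union>U\<in>\<D>A. Z U)" "open (\<Union>U\<in>\<D>B. Z U)" using opZ opU by (intro open_UN; blast)+
        have lmZ: "(\<Union>U\<in>\<D>A. Z U) \<in> lmeasurable" "(\<Union>U\<in>\<D>B. Z U) \<in> lmeasurable"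
          using ZS by (auto intro!: lmeasurable_open[OF bounded_subset[OF \<Omega>(2)]] opZA)
        have "(\<Union>U\<in>\<D>A. Z U) \<inter> (\<Union>U\<in>\<D>B. Z U) = {}" using subZ DA(3) DB(3) AB by blast
        then have "?m ((\<Union>U\<in>\<D>A. Z U) \<union> (\<Union>U\<in>\<D>B. Z U)) = ?m (\<Union>U\<in>\<D>A. Z U) + ?m (\<Union>U\<in>\<D>B. Z U)"
          by (intro measure_Un2[OF lmZ, THEN trans]) (simp add: Diff_triv Int_commute)
        moreover have "?m ((\<Union>U\<in>\<D>A. Z U) \<union> (\<Union>U\<in>\<D>B. Z U)) \<le> ?m ?S"
        proof (rule measure_mono_fmeasurable[OF _ _ lmS])
          show "(\<Union>U\<in>\<D>A. Z U) \<union> (\<Union>U\<in>\<D>B. Z U) \<subseteq> ?S" using ZS by blast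
        qed (use opZA in auto)
        ultimately have S: "(dA - \<epsilon>1) * ?m \<Omega>A + (dB - \<epsilon>1) * ?m \<Omega>B \<le> ?m ?S"
          using ZA ZB unfolding DA(3) DB(3) by linarith
        let ?M = "?m \<Omega>"
        have "dA * (t * ?M - \<epsilon>1 * ?M) \<le> dA * ?m \<Omega>A" using mA dA(1) by (intro mult_left_mono) auto
        moreover have "dB * ((1 - t) * ?M - \<epsilon>1 * ?M) \<le> dB * ?m \<Omega>B"
          using mA frac(1) dB(1) by (intro mult_left_mono) (auto simp: left_diff_distrib)
        moreover have "dA * (\<epsilon>1 * ?M) \<le> \<epsilon>1 * ?M" "dB * (\<epsilon>1 * ?M) \<le> \<epsilon>1 * ?M"
          using dA dB \<epsilon>1 by (auto intro!: mult_left_le_one_le)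
        moreover have "\<epsilon>1 * ?m \<Omega>A + \<epsilon>1 * ?m \<Omega>B = \<epsilon>1 * ?M" using frac(1) by (simp flip: distrib_left)
        ultimately have "?d * ?M - 3 * (\<epsilon>1 * ?M) \<le> (dA - \<epsilon>1) * ?m \<Omega>A + (dB - \<epsilon>1) * ?m \<Omega>B"
          by (simp add: algebra_simps)
        moreover have "(?d - \<epsilon>) * ?M = ?d * ?M - 3 * (\<epsilon>1 * ?M)" by (simp add: \<epsilon>1_def left_diff_distrib)
        ultimately show "(?d - \<epsilon>) * ?M \<le> ?m ?S" using S by linarith
      qed
      then show ?thesis by (rule exI[of "perturbation V G L \<epsilon> (?d - \<epsilon>) \<Omega> (\<lambda>x. 0) \<xi>"])
    qed
    show "\<exists>r>0. \<exists>L. \<forall>\<xi>'\<in>ball ?C r. \<forall>\<Omega>. open \<Omega> \<and> bounded \<Omega> \<longrightarrow>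
       (\<exists>w. perturbation V G L \<epsilon> (?d - \<epsilon>) \<Omega> (\<lambda>x. 0) \<xi>' w)"
      using main r(1) by blast
  qed
qed

section \<open>Induction along the condition H_I\<close>

lemma H_cond_mem: "H_cond U I l x \<Longrightarrow> i \<in> {1..I} \<Longrightarrow> x i \<in> U"
proof (induction U I l x arbitrary: i rule: H_cond.induct)
  case (3 U l x)
  then have "i = 1 \<or> i = 2" by auto
  then show ?case using 3 by auto
next
  case (4 U k l x)
  from 4(2) obtain p where p: "p permutes {1..k + 3}" "x (p 1) \<in> U" "x (p 2) \<in> U"
    and H: "H_cond U (Suc (Suc k))
          (\<lambda>i. if i = 1 then l (p 1) + l (p 2) else l (p (i + 1)))
          (\<lambda>i. if i = 1 then (l (p 1) *\<^sub>R x (p 1) + l (p 2) *\<^sub>R x (p 2)) /\<^sub>R (l (p 1) + l (p 2))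
               else x (p (i + 1)))" by auto
  note IH = 4(1)[OF H]
  have "i \<in> p ` {1..k + 3}" using 4(3) permutes_image[OF p(1)] by simp
  then obtain j where j: "j \<in> {1..k + 3}" "i = p j" by blast
  consider "j = 1" | "j = 2" | "j \<ge> 3" using j(1) by fastforce
  then show ?case
  proof cases
    case 3
    \<comment> \<open>Membership is asked directly of the first two matrices only; a later one
      stands at position j - 1 \<ge> 2 of the merged family, where the value is x (p j).\<close>
    have "j - 1 \<in> {1..Suc (Suc k)}" using j(1) 3 by auto
    from IH[OF this] have "x (p (j - 1 + 1)) \<in> U" using 3 by (simp split: if_splits)
    then show ?thesis using 3 j(2) by simp
  qed (use p j in auto)
qed auto

text \<open>Merging replaces the first two summands by their sum. A general commutative monoid
  allows one statement for the weights, the barycentre and the fraction.\<close>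

lemma sum_merge_first_two:
  fixes f g :: "nat \<Rightarrow> 'b::comm_monoid_add"
  assumes "p permutes {1..k + 3}" "g 1 = f (p 1) + f (p 2)" "\<And>i. i \<noteq> 1 \<Longrightarrow> g i = f (p (i + 1))"
  shows "sum f {1..k + 3} = sum g {1..Suc (Suc k)}"
proof -
  have "sum f {1..k + 3} = (\<Sum>i=1..k + 3. f (p i))"
    using sum.permute[OF assms(1), of f] by (simp add: o_def)
  also have "\<dots> = f (p 1) + (\<Sum>i=Suc 1..k + 3. f (p i))" by (rule sum.atLeast_Suc_atMost) simp
  also have "(\<Sum>i=Suc 1..k + 3. f (p i)) = f (p (Suc 1)) + (\<Sum>i=Suc (Suc 1)..k + 3. f (p i))"
    by (rule sum.atLeast_Suc_atMost) simp
  also have "(\<Sum>i=Suc (Suc 1)..k + 3. f (p i)) = (\<Sum>i=Suc 1..k + 2. f (p (Suc i)))"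
    using sum.shift_bounds_cl_Suc_ivl[of "\<lambda>i. f (p i)" "Suc 1" "k + 2"] by (simp add: numeral_eq_Suc)
  also have "\<dots> = (\<Sum>i=Suc 1..Suc (Suc k). g i)"
    by (rule sum.cong) (auto simp: assms(3))
  also have "f (p 1) + (f (p (Suc 1)) + \<dots>) = g 1 + \<dots>"
    unfolding assms(2) by (simp add: add.assoc numeral_2_eq_2)
  also have "\<dots> = sum g {1..Suc (Suc k)}" by (rule sum.atLeast_Suc_atMost[symmetric]) simp
  finally show ?thesis .
qed

text \<open>The merged pair is a lamination of its two members, with weights normalised by their
  sum, and its fraction d is averaged likewise; so merging changes neither the barycentre nor the
  total fraction. The induction varies d, since the merged family has new fractions.\<close>

lemma H_cond_approachable:
  "H_cond U I l x \<Longrightarrow> (\<forall>i\<in>{1..I}. l i > 0) \<Longrightarrow> (\<Sum>i=1..I. l i) = 1 \<Longrightarrow>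
    (\<forall>i\<in>{1..I}. approachable V G (x i) (d i)) \<Longrightarrow> approachable V G (\<Sum>i=1..I. l i *\<^sub>R x i) (\<Sum>i=1..I. l i * d i)"
proof (induction U I l x arbitrary: d rule: H_cond.induct)
  case (3 U l x)
  have e: "{1..Suc (Suc 0)} = {1, 2::nat}" by auto
  have l: "l 1 > 0" "l 2 > 0" "l 1 + l 2 = 1" using 3(2,3) unfolding e by auto
  have l2: "l 2 = 1 - l 1" using l(3) by simp
  have "approachable V G (l 1 *\<^sub>R x 1 + (1 - l 1) *\<^sub>R x 2) (l 1 * d 1 + (1 - l 1) * d 2)"
  proof (rule approachable_laminate)
    show "approachable V G (x 1) (d 1)" "approachable V G (x 2) (d 2)" using 3(4) unfolding e by auto
    show "rank (x 1 - x 2) = 1" using 3(1) by simp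
    show "0 < l 1" "l 1 < 1" using l by linarith+
  qed
  then show ?case unfolding e by (simp add: l2)
next
  case (4 U k l x)
  let ?l = "\<lambda>p i. if i = 1 then l (p 1) + l (p 2) else l (p (i + 1))"
  let ?x = "\<lambda>p i. if i = 1 then (l (p 1) *\<^sub>R x (p 1) + l (p 2) *\<^sub>R x (p 2)) /\<^sub>R (l (p 1) + l (p 2))
               else x (p (i + 1))"
  from 4(2) obtain p where p: "p permutes {1..k + 3}" "rank (x (p 1) - x (p 2)) = 1"
    and H: "H_cond U (Suc (Suc k)) (?l p) (?x p)" by auto
  let ?d = "\<lambda>i. if i = 1 then (l (p 1) * d (p 1) + l (p 2) * d (p 2)) / (l (p 1) + l (p 2)) else d (p (i + 1))"
  have e: "Suc (Suc (Suc k)) = k + 3" by simp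
  have mem: "p i \<in> {1..k + 3}" if "i \<in> {1..k + 3}" for i using permutes_in_image[OF p(1)] that by blast
  have pos: "l (p i) > 0" and ad: "approachable V G (x (p i)) (d (p i))" if "i \<in> {1..k + 3}" for i
    using mem[OF that] 4(3,5) unfolding e by blast+
  have l12: "l (p 1) > 0" "l (p 2) > 0" using pos[of 1] pos[of 2] by auto
  have s: "l (p 1) + l (p 2) \<noteq> 0" using l12 by linarith
  have "approachable V G (\<Sum>i=1..Suc (Suc k). ?l p i *\<^sub>R ?x p i) (\<Sum>i=1..Suc (Suc k). ?l p i * ?d i)"
  proof (rule 4(1)[OF H])
    show "\<forall>i\<in>{1..Suc (Suc k)}. ?l p i > 0"
    proof
      fix i assume "i \<in> {1..Suc (Suc k)}"
      then show "?l p i > 0" using add_pos_pos[OF l12] pos[of "i + 1"] by auto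
    qed
    show "(\<Sum>i=1..Suc (Suc k). ?l p i) = 1"
      using sum_merge_first_two[OF p(1), of "?l p" l] 4(4) unfolding e by simp
    show "\<forall>i\<in>{1..Suc (Suc k)}. approachable V G (?x p i) (?d i)"
    proof
      fix i assume i: "i \<in> {1..Suc (Suc k)}"
      show "approachable V G (?x p i) (?d i)"
      proof (cases "i = 1")
        case True
        let ?t = "l (p 1) / (l (p 1) + l (p 2))"
        have t: "1 - ?t = l (p 2) / (l (p 1) + l (p 2))" using s by (simp add: field_simps)
        have "approachable V G (?t *\<^sub>R x (p 1) + (1 - ?t) *\<^sub>R x (p 2)) (?t * d (p 1) + (1 - ?t) * d (p 2))"
          by (rule approachable_laminate) (use ad[of 1] ad[of 2] p(2) l12 in auto)
        then show ?thesis using True unfolding t by (simp add: scaleR_add_right divide_inverse distrib_left mult_ac)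
      next
        case False
        then show ?thesis using i ad[of "i + 1"] by simp
      qed
    qed
  qed
  moreover have "(\<Sum>i=1..k + 3. l i *\<^sub>R x i) = (\<Sum>i=1..Suc (Suc k). ?l p i *\<^sub>R ?x p i)"
    by (rule sum_merge_first_two[OF p(1)]) (use s in auto)
  moreover have "(\<Sum>i=1..k + 3. l i * d i) = (\<Sum>i=1..Suc (Suc k). ?l p i * ?d i)"
    by (rule sum_merge_first_two[OF p(1)]) (use s in auto)
  ultimately show ?case unfolding e by simp
qed auto

lemma countable_disjoint_sequence:
  assumes "disjoint \<D>" "countable \<D>"
  obtains A :: "nat \<Rightarrow> 'a set" where "disjoint_family A" "\<And>k. A k \<in> \<D> \<or> A k = {}" "(\<Union>k. A k) = \<Union>\<D>"
proof -
  \<comment> \<open>\<open>from_nat_into\<close> sends numbers that code no member to some member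
    again, which would break disjointness; these get the empty set.\<close>
  define A where "A k = (if k \<in> to_nat_on \<D> ` \<D> then from_nat_into \<D> k else {})" for k
  have A: "A (to_nat_on \<D> U) = U" if "U \<in> \<D>" for U
    using that assms(2) by (simp add: A_def)
  have mem: "A k \<in> \<D> \<or> A k = {}" for k
    using assms(2) by (auto simp: A_def)
  show ?thesis
  proof (rule that[OF _ mem])
    show "disjoint_family A"
      unfolding disjoint_family_on_def
    proof (intro ballI impI)
      fix m n :: nat assume "m \<noteq> n"
      show "A m \<inter> A n = {}"
      proof (cases "m \<in> to_nat_on \<D> ` \<D> \<and> n \<in> to_nat_on \<D> ` \<D>")
        case True
        then obtain U V where UV: "U \<in> \<D>" "V \<in> \<D>" "m = to_nat_on \<D> U" "n = to_nat_on \<D> V" by blast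
        then have "U \<noteq> V" using \<open>m \<noteq> n\<close> by blast
        then show ?thesis using UV A assms(1) unfolding disjoint_def by simp
      qed (auto simp: A_def)
    qed
    show "(\<Union>k. A k) = \<Union>\<D>" using A mem by blast
  qed
qed

subsection \<open>The relaxation property\<close>

text \<open>The pieces are those of \<open>affine_pieces\<close>, with gradient and constant term
  both fixed; they cover the open set of local affinity, hence \<Omega> up to a null set.\<close>

lemma Aff_piec_lipschitz:
  fixes u :: "real^'n \<Rightarrow> real^'m"
  assumes lip: "L-lipschitz_on UNIV u" and \<Omega>: "open \<Omega>" "bounded \<Omega>"
    and aff: "negligible {x\<in>\<Omega>. \<nexists>M. loc_affine u x M}"
  shows "u \<in> W1_inf \<Omega>" "u \<in> Aff_piec \<Omega>"
proof -
  obtain B where B: "\<And>x. x \<in> \<Omega> \<Longrightarrow> norm (u x) \<le> B" by (rule lipschitz_bounded_on[OF lip \<Omega>(2)]) blast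
  have "u \<in> L_inf \<Omega>" by (rule L_inf_bounded[OF lipschitz_borel[OF lip] B])
  moreover have "grad u \<in> L_inf \<Omega>" by (rule L_inf_bounded[OF grad_borel grad_norm_bound[OF lip]])
  ultimately show W: "u \<in> W1_inf \<Omega>"
    using has_weak_gradient_grad[OF lip \<Omega>(1) aff] unfolding W1_inf_def by blast
  have "open {x\<in>\<Omega>. \<exists>M. loc_affine u x M}" using open_loc_affine_in[OF \<Omega>(1), of UNIV u] by simp
  then obtain \<D> where \<D>: "disjoint \<D>" "countable \<D>" "\<Union>\<D> = {x\<in>\<Omega>. \<exists>M. loc_affine u x M}"
    "\<And>U. U \<in> \<D> \<Longrightarrow> open U" "\<And>U. U \<in> \<D> \<Longrightarrow> \<exists>M b. \<forall>x\<in>U. u x = M *v x + b"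
    by (rule affine_pieces[of _ u]) (blast, rule that)
  obtain A :: "nat \<Rightarrow> (real^'n) set" where A: "disjoint_family A" "\<And>k. A k \<in> \<D> \<or> A k = {}" "(\<Union>k. A k) = \<Union>\<D>"
    by (rule countable_disjoint_sequence[OF \<D>(1,2)]) blast
  have "open (A k) \<and> A k \<subseteq> \<Omega>" for k using A(2)[of k] \<D>(3,4) by auto
  moreover have "negligible (\<Omega> - (\<Union>k. A k))"
    unfolding A(3) \<D>(3) by (rule negligible_subset[OF aff]) blast
  moreover have "\<exists>M b. \<forall>x\<in>A k. u x = M *v x + b" for k using A(2)[of k] \<D>(5) by blast
  moreover have "continuous_on (closure \<Omega>) u"
    using lipschitz_on_continuous_on[OF lip] continuous_on_subset by blast
  ultimately show "u \<in> Aff_piec \<Omega>" using W A(1) unfolding Aff_piec_def by blast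
qed

text \<open>The difference of the integrals is at most \<open>s \<nu>\<close> times the L^1 norm of
  the weight.\<close>

lemma weak_star_L_inf_uniform:
  fixes u :: "nat \<Rightarrow> real^'n \<Rightarrow> real^'m"
  assumes "\<And>\<nu>. u \<nu> \<in> L_inf \<Omega>" "v \<in> L_inf \<Omega>" and s: "s \<longlonglongrightarrow> 0" and close: "\<And>\<nu> x. norm (u \<nu> x - v x) \<le> s \<nu>"
  shows "weak_star_L_inf \<Omega> u v"
  unfolding weak_star_L_inf_def
proof (intro conjI allI impI)
  let ?M = "lebesgue_on \<Omega>"
  fix h :: "real^'n \<Rightarrow> real^'m" assume h: "integrable ?M h"
  have int: "integrable ?M (\<lambda>x. f x \<bullet> h x)" if f: "f \<in> L_inf \<Omega>" for f
  proof -
    obtain C where C: "f \<in> borel_measurable ?M" "AE x in ?M. norm (f x) \<le> C" using f unfolding L_inf_def by blast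
    show ?thesis
    proof (rule Bochner_Integration.integrable_bound)
      show "integrable ?M (\<lambda>x. C * norm (h x))" using h by (intro integrable_mult_right integrable_norm)
      show "(\<lambda>x. f x \<bullet> h x) \<in> borel_measurable ?M" using C(1) h by measurable
      show "AE x in ?M. norm (f x \<bullet> h x) \<le> norm (C * norm (h x))"
        using C(2)
      proof eventually_elim
        case (elim x)
        have "\<bar>f x \<bullet> h x\<bar> \<le> norm (f x) * norm (h x)" by (rule Cauchy_Schwarz_ineq2)
        also have "\<dots> \<le> C * norm (h x)" using elim by (intro mult_right_mono) auto
        finally show ?case by simp
      qed
    qed
  qed
  have "(\<lambda>\<nu>. (LINT x|?M. u \<nu> x \<bullet> h x) - (LINT x|?M. v x \<bullet> h x)) \<longlonglongrightarrow> 0"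
  proof (rule Lim_null_comparison)
    show "(\<lambda>\<nu>. s \<nu> * (LINT x|?M. norm (h x))) \<longlonglongrightarrow> 0" using tendsto_mult[OF s tendsto_const] by simp
    have "norm ((LINT x|?M. u \<nu> x \<bullet> h x) - (LINT x|?M. v x \<bullet> h x)) \<le> s \<nu> * (LINT x|?M. norm (h x))" for \<nu>
    proof -
      have "(LINT x|?M. u \<nu> x \<bullet> h x) - (LINT x|?M. v x \<bullet> h x) = (LINT x|?M. u \<nu> x \<bullet> h x - v x \<bullet> h x)"
        using int assms(1,2) by simp
      also have "norm \<dots> \<le> (LINT x|?M. norm (u \<nu> x \<bullet> h x - v x \<bullet> h x))" by (rule integral_norm_bound)
      also have "\<dots> \<le> (LINT x|?M. s \<nu> * norm (h x))"
      proof (rule integral_mono)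
        show "integrable ?M (\<lambda>x. norm (u \<nu> x \<bullet> h x - v x \<bullet> h x))"
          using int assms(1,2) by (intro integrable_norm) auto
        show "integrable ?M (\<lambda>x. s \<nu> * norm (h x))" using h by (intro integrable_mult_right integrable_norm)
        fix x
        have "\<bar>(u \<nu> x - v x) \<bullet> h x\<bar> \<le> norm (u \<nu> x - v x) * norm (h x)" by (rule Cauchy_Schwarz_ineq2)
        also have "\<dots> \<le> s \<nu> * norm (h x)" using close by (intro mult_right_mono) auto
        finally show "norm (u \<nu> x \<bullet> h x - v x \<bullet> h x) \<le> s \<nu> * norm (h x)" by (simp add: inner_diff_left)
      qed
      finally show ?thesis by simp
    qed
    then show "\<forall>\<^sub>F \<nu> in sequentially. norm ((LINT x|?M. u \<nu> x \<bullet> h x) - (LINT x|?M. v x \<bullet> h x)) \<le> s \<nu> * (LINT x|?M. norm (h x))"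
      by simp
  qed
  then show "(\<lambda>\<nu>. LINT x|?M. u \<nu> x \<bullet> h x) \<longlonglongrightarrow> (LINT x|?M. v x \<bullet> h x)" by (rule LIM_zero_cancel)
qed (use assms in auto)

text \<open>Entry by entry, the gradients of w tend to 0 against Lipschitz weights because w is
  small, and against all integrable weights by density. The density argument rests on the bound B,
  uniform in the sequence; the constants \<open>L \<nu>\<close> may be unbounded.\<close>

lemma weak_star_gradients:
  fixes w :: "nat \<Rightarrow> real^'n \<Rightarrow> real^'m" and Du :: "nat \<Rightarrow> real^'n \<Rightarrow> real^'n^'m"
  assumes \<Omega>: "open \<Omega>" "bounded \<Omega>" and lip: "\<And>\<nu>. (L \<nu>)-lipschitz_on UNIV (w \<nu>)"
    and off: "\<And>\<nu> x. x \<notin> \<Omega> \<Longrightarrow> w \<nu> x = 0" and aff: "\<And>\<nu>. negligible {x\<in>\<Omega>. \<nexists>M. loc_affine (w \<nu>) x M}"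
    and s: "s \<longlonglongrightarrow> 0" and small: "\<And>\<nu> x. norm (w \<nu> x) \<le> s \<nu>"
    and Du: "\<And>\<nu>. AE x in lebesgue_on \<Omega>. Du \<nu> x = \<xi> + grad (w \<nu>) x \<and> norm (grad (w \<nu>) x) \<le> B"
    and DuL: "\<And>\<nu>. Du \<nu> \<in> L_inf \<Omega>" and DvL: "Dv \<in> L_inf \<Omega>" and Dv: "\<And>x. Dv x = \<xi>"
  shows "weak_star_L_inf \<Omega> Du Dv"
  unfolding weak_star_L_inf_def
proof (intro conjI allI impI)
  let ?M = "lebesgue_on \<Omega>"
  have lm: "\<Omega> \<in> lmeasurable" using \<Omega> by (simp add: lmeasurable_open)
  fix h :: "real^'n \<Rightarrow> real^'n^'m" assume h: "integrable ?M h"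
  have hij: "integrable ?M (\<lambda>x. h x $ i $ j)" for i j
  proof -
    have "bounded_linear (\<lambda>A :: real^'n^'m. A $ i $ j)"
      by (rule bounded_linear_compose[OF bounded_linear_vec_nth bounded_linear_vec_nth])
    from integrable_bounded_linear[OF this h] show ?thesis .
  qed
  have gm: "(\<lambda>x. grad (w \<nu>) x $ i $ j) \<in> borel_measurable ?M" for \<nu> i j
    by (rule borel_measurable_lebesgue_on) measurable
  have gB: "AE x in ?M. \<bar>grad (w \<nu>) x $ i $ j\<bar> \<le> B" for \<nu> i j
    using Du[of \<nu>] by eventually_elim (use matrix_component_bound order_trans in blast)
  have gh: "integrable ?M (\<lambda>x. grad (w \<nu>) x $ i $ j * h x $ i $ j)" for \<nu> i j
  proof (rule Bochner_Integration.integrable_bound)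
    show "integrable ?M (\<lambda>x. L \<nu> * h x $ i $ j)" using hij by (rule integrable_mult_right)
    show "(\<lambda>x. grad (w \<nu>) x $ i $ j * h x $ i $ j) \<in> borel_measurable ?M"
      by (rule borel_measurable_times[OF gm borel_measurable_integrable[OF hij]])
    show "AE x in ?M. norm (grad (w \<nu>) x $ i $ j * h x $ i $ j) \<le> norm (L \<nu> * h x $ i $ j)"
    proof (rule AE_I2)
      fix x
      have "\<bar>grad (w \<nu>) x $ i $ j\<bar> \<le> \<bar>L \<nu>\<bar>" using grad_component_bound[OF lip] abs_ge_self order_trans by blast
      then show "norm (grad (w \<nu>) x $ i $ j * h x $ i $ j) \<le> norm (L \<nu> * h x $ i $ j)"
        by (simp add: abs_mult mult_right_mono)
    qed
  qed
  have lim: "(\<lambda>\<nu>. LINT x|?M. grad (w \<nu>) x $ i $ j * h x $ i $ j) \<longlonglongrightarrow> 0" for i j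
  proof (rule tendsto_integral_mult_lipschitz_dense[OF lm gm gB _ hij])
    fix H and f :: "real^'n \<Rightarrow> real" assume f: "H-lipschitz_on UNIV f"
    show "(\<lambda>\<nu>. LINT x|?M. grad (w \<nu>) x $ i $ j * f x) \<longlonglongrightarrow> 0"
    proof (rule Lim_null_comparison)
      have "(\<lambda>\<nu>. H * (s \<nu> * measure lebesgue \<Omega>)) \<longlonglongrightarrow> H * (0 * measure lebesgue \<Omega>)"
        by (intro tendsto_intros s)
      then show "(\<lambda>\<nu>. H * (s \<nu> * measure lebesgue \<Omega>)) \<longlonglongrightarrow> 0" by simp
      have "norm (LINT x|?M. grad (w \<nu>) x $ i $ j * f x) \<le> H * (s \<nu> * measure lebesgue \<Omega>)" for \<nu>
        unfolding real_norm_def by (rule integral_grad_lipschitz_bound[OF lip \<Omega> off aff f small])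
      then show "\<forall>\<^sub>F \<nu> in sequentially. norm (LINT x|?M. grad (w \<nu>) x $ i $ j * f x) \<le> H * (s \<nu> * measure lebesgue \<Omega>)"
        by simp
    qed
  qed
  have \<xi>h: "integrable ?M (\<lambda>x. \<xi> \<bullet> h x)" using h by (rule integrable_inner_right)
  have eq: "(LINT x|?M. Du \<nu> x \<bullet> h x) = (LINT x|?M. Dv x \<bullet> h x) +
      (\<Sum>i\<in>UNIV. \<Sum>j\<in>UNIV. LINT x|?M. grad (w \<nu>) x $ i $ j * h x $ i $ j)" for \<nu>
  proof -
    have inner: "(\<Sum>i\<in>UNIV. \<Sum>j\<in>UNIV. A $ i $ j * C $ i $ j) = A \<bullet> C" for A C :: "real^'n^'m"
      by (simp add: inner_vec_def)
    have "(LINT x|?M. Du \<nu> x \<bullet> h x) = (LINT x|?M. \<xi> \<bullet> h x + (\<Sum>i\<in>UNIV. \<Sum>j\<in>UNIV. grad (w \<nu>) x $ i $ j * h x $ i $ j))"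
    proof (rule integral_cong_AE)
      have "Du \<nu> \<in> borel_measurable ?M" using DuL by (simp add: L_inf_def)
      then show "(\<lambda>x. Du \<nu> x \<bullet> h x) \<in> borel_measurable ?M"
        using borel_measurable_integrable[OF h] by (rule borel_measurable_inner)
      show "(\<lambda>x. \<xi> \<bullet> h x + (\<Sum>i\<in>UNIV. \<Sum>j\<in>UNIV. grad (w \<nu>) x $ i $ j * h x $ i $ j)) \<in> borel_measurable ?M"
        using gh \<xi>h by (intro borel_measurable_integrable Bochner_Integration.integrable_add Bochner_Integration.integrable_sum)
      show "AE x in ?M. Du \<nu> x \<bullet> h x = \<xi> \<bullet> h x + (\<Sum>i\<in>UNIV. \<Sum>j\<in>UNIV. grad (w \<nu>) x $ i $ j * h x $ i $ j)"
        using Du[of \<nu>] by eventually_elim (simp add: inner inner_add_left)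
    qed
    also have "\<dots> = (LINT x|?M. \<xi> \<bullet> h x) + (\<Sum>i\<in>UNIV. \<Sum>j\<in>UNIV. LINT x|?M. grad (w \<nu>) x $ i $ j * h x $ i $ j)"
      using gh \<xi>h by (simp add: Bochner_Integration.integral_add Bochner_Integration.integral_sum Bochner_Integration.integrable_sum)
    finally show ?thesis by (simp add: Dv)
  qed
  have "(\<lambda>\<nu>. (LINT x|?M. Dv x \<bullet> h x) + (\<Sum>i\<in>UNIV. \<Sum>j\<in>UNIV. LINT x|?M. grad (w \<nu>) x $ i $ j * h x $ i $ j)) \<longlonglongrightarrow>
      (LINT x|?M. Dv x \<bullet> h x) + (\<Sum>i\<in>(UNIV::'m set). \<Sum>j\<in>(UNIV::'n set). 0)"
    by (intro tendsto_add tendsto_const tendsto_sum lim)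
  then show "(\<lambda>\<nu>. LINT x|?M. Du \<nu> x \<bullet> h x) \<longlonglongrightarrow> (LINT x|?M. Dv x \<bullet> h x)"
    unfolding eq by simp
qed (use DuL DvL in auto)

text \<open>The strict \<epsilon>-neighbourhood of E as a union of balls is visibly open, as
  required of \<open>G\<close>; for empty E it is empty, in accordance with the infinite
  distance.\<close>

lemma dist_set_less_iff: "dist_set M E < ennreal \<epsilon> \<longleftrightarrow> M \<in> (\<Union>y\<in>E. ball y \<epsilon>)"
  by (auto simp: dist_set_def INF_less_iff dist_commute ennreal_less_iff)

text \<open>The target \<open>?G\<close> is the \<epsilon>-neighbourhood of E, and the fraction at
  x_i is 1 or 0 according to whether x_i lies in it; the averaged fraction is then the weight of the
  x_i near E.\<close>

lemma approximating_perturbation: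
  fixes E K :: "(real^'n^'m) set"
    and E\<delta> K\<delta> :: "real \<Rightarrow> (real^'n^'m) set"
  assumes i: "\<forall>\<epsilon>>0. \<exists>\<delta>0>0. \<forall>\<delta>\<in>{0<..\<delta>0}. \<forall>\<eta>\<in>E\<delta> \<delta>. dist_set \<eta> E \<le> ennreal \<epsilon>"
    and ii: "\<forall>\<eta>\<in>interior K. \<exists>\<delta>0>0. \<forall>\<delta>\<in>{0<..\<delta>0}. \<eta> \<in> K\<delta> \<delta>"
    and iii: "\<forall>\<delta>>0. \<forall>\<xi>\<in>K\<delta> \<delta>. \<exists>(I::nat) (l :: nat \<Rightarrow> real) (x :: nat \<Rightarrow> real^'n^'m).
           I \<ge> 1 \<and> (\<forall>i\<in>{1..I}. l i > 0) \<and> (\<Sum>i=1..I. l i) = 1 \<and>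
           H_cond (interior K) I l x \<and>
           \<xi> = (\<Sum>i=1..I. l i *\<^sub>R x i) \<and>
           (\<Sum>i\<in>{i\<in>{1..I}. x i \<notin> E\<delta> \<delta>}. l i) < \<delta>"
    and \<xi>: "\<xi> \<in> interior K" and \<Omega>: "open \<Omega>" "bounded \<Omega>" and \<epsilon>: "\<epsilon> > 0"
  shows "\<exists>w L. L-lipschitz_on UNIV w \<and> (\<forall>x. x \<notin> \<Omega> \<longrightarrow> w x = 0) \<and> (\<forall>x. norm (w x) \<le> \<epsilon>) \<and>
     negligible {x\<in>\<Omega>. \<nexists>M. loc_affine w x M \<and> \<xi> + M \<in> interior K} \<and>
     (1 - \<epsilon>) * measure lebesgue \<Omega> \<le> measure lebesgue {x\<in>\<Omega>. \<exists>M. loc_affine w x M \<and> dist_set (\<xi> + M) E < ennreal \<epsilon>}"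
proof -
  let ?V = "interior K" and ?G = "\<Union>y\<in>E. ball y \<epsilon>"
  obtain \<delta>1 where \<delta>1: "\<delta>1 > 0" "\<And>\<delta> \<eta>. \<delta> \<in> {0<..\<delta>1} \<Longrightarrow> \<eta> \<in> E\<delta> \<delta> \<Longrightarrow> dist_set \<eta> E \<le> ennreal (\<epsilon> / 2)"
    using i[rule_format, of "\<epsilon> / 2"] \<epsilon> by auto
  obtain \<delta>2 where \<delta>2: "\<delta>2 > 0" "\<And>\<delta>. \<delta> \<in> {0<..\<delta>2} \<Longrightarrow> \<xi> \<in> K\<delta> \<delta>" using ii \<xi> by blast
  \<comment> \<open>By (i) the members in E_\<delta> are within \<epsilon>/2 of E, hence strictly
    within \<epsilon>; by (ii) \<xi> is in K_\<delta>; the remaining members weigh less than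
    \<epsilon>/2. The other half of the allowed loss goes to \<open>approachable\<close>.\<close>
  define \<delta> where "\<delta> = min (\<epsilon> / 2) (min \<delta>1 \<delta>2)"
  have \<delta>: "\<delta> > 0" "\<delta> \<le> \<epsilon> / 2" "\<delta> \<in> {0<..\<delta>1}" "\<delta> \<in> {0<..\<delta>2}" using \<epsilon> \<delta>1(1) \<delta>2(1) by (auto simp: \<delta>_def)
  obtain I l x where Ilx: "\<forall>i\<in>{1..I}. l i > 0" "(\<Sum>i=1..I. l i) = 1" "H_cond ?V I l x"
    "\<xi> = (\<Sum>i=1..I. l i *\<^sub>R x i)" "(\<Sum>i\<in>{i\<in>{1..I}. x i \<notin> E\<delta> \<delta>}. l i) < \<delta>"
    using iii \<delta>(1) \<delta>2(2)[OF \<delta>(4)] by blast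
  let ?d = "\<lambda>i. if x i \<in> ?G then 1 else 0 :: real"
  have "approachable ?V ?G \<xi> (\<Sum>i=1..I. l i * ?d i)"
    unfolding Ilx(4)
  proof (rule H_cond_approachable[OF Ilx(3,1,2)], rule ballI)
    show "approachable ?V ?G (x i) (?d i)" if "i \<in> {1..I}" for i
      by (rule approachable_interior) (use H_cond_mem[OF Ilx(3) that] in auto)
  qed
  moreover have "1 - \<epsilon> / 2 \<le> (\<Sum>i=1..I. l i * ?d i)"
  proof -
    have G: "x i \<in> ?G" if "x i \<in> E\<delta> \<delta>" for i
    proof -
      have "ennreal (\<epsilon> / 2) < ennreal \<epsilon>" using \<epsilon> by (simp add: ennreal_less_iff)
      then have "dist_set (x i) E < ennreal \<epsilon>" using \<delta>1(2)[OF \<delta>(3) that] by (rule le_less_trans[rotated])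
      then show ?thesis by (simp only: dist_set_less_iff)
    qed
    have "1 = (\<Sum>i=1..I. l i)" using Ilx(2) by simp
    also have "\<dots> \<le> (\<Sum>i=1..I. l i * ?d i + (if x i \<notin> E\<delta> \<delta> then l i else 0))"
      by (rule sum_mono) (use G Ilx(1) in \<open>auto simp: less_imp_le\<close>)
    also have "\<dots> = (\<Sum>i=1..I. l i * ?d i) + (\<Sum>i\<in>{i\<in>{1..I}. x i \<notin> E\<delta> \<delta>}. l i)"
      by (simp only: sum.distrib sum.inter_filter[OF finite_atLeastAtMost])
    finally show ?thesis using Ilx(5) \<delta>(2) by linarith
  qed
  moreover have "\<epsilon> / 2 > 0" using \<epsilon> by simp
  ultimately obtain r L where "r > 0" "\<And>\<xi>' \<Omega>. \<xi>' \<in> ball \<xi> r \<Longrightarrow> open \<Omega> \<Longrightarrow> bounded \<Omega> \<Longrightarrow>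
     \<exists>w. perturbation ?V ?G L (\<epsilon> / 2) ((\<Sum>i=1..I. l i * ?d i) - \<epsilon> / 2) \<Omega> (\<lambda>x. 0) \<xi>' w"
    unfolding approachable_def by meson
  then obtain w where w: "perturbation ?V ?G L (\<epsilon> / 2) ((\<Sum>i=1..I. l i * ?d i) - \<epsilon> / 2) \<Omega> (\<lambda>x. 0) \<xi> w"
    using \<Omega> by (meson centre_in_ball)
  have "(1 - \<epsilon>) * measure lebesgue \<Omega> \<le> ((\<Sum>i=1..I. l i * ?d i) - \<epsilon> / 2) * measure lebesgue \<Omega>"
    using \<open>1 - \<epsilon> / 2 \<le> _\<close> by (intro mult_right_mono) auto
  also have "\<dots> \<le> measure lebesgue {x\<in>\<Omega>. \<exists>M. loc_affine w x M \<and> \<xi> + M \<in> ?G}"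
    using w by (simp add: perturbation_def)
  finally have "(1 - \<epsilon>) * measure lebesgue \<Omega> \<le> measure lebesgue {x\<in>\<Omega>. \<exists>M. loc_affine w x M \<and> dist_set (\<xi> + M) E < ennreal \<epsilon>}"
    by (simp only: dist_set_less_iff)
  moreover have "norm (w x) \<le> \<epsilon>" for x
  proof -
    have "norm (w x) \<le> \<epsilon> / 2" using w by (simp add: perturbation_def)
    then show ?thesis using \<epsilon> by linarith
  qed
  ultimately show ?thesis using w unfolding perturbation_def add_0_left by blast
qed

theorem theorem3p5:
  fixes E K :: "(real^'n^'m) set"
    and E\<delta> K\<delta> :: "real \<Rightarrow> (real^'n^'m) set"
  assumes "bounded E" and "bounded K"
    and "\<forall>\<epsilon>>0. \<exists>\<delta>0>0. \<forall>\<delta>\<in>{0<..\<delta>0}. \<forall>\<eta>\<in>E\<delta> \<delta>. dist_set \<eta> E \<le> ennreal \<epsilon>"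
    and "\<forall>\<eta>\<in>interior K. \<exists>\<delta>0>0. \<forall>\<delta>\<in>{0<..\<delta>0}. \<eta> \<in> K\<delta> \<delta>"
    and "\<forall>\<delta>>0. \<forall>\<xi>\<in>K\<delta> \<delta>. \<exists>(I::nat) (l :: nat \<Rightarrow> real) (x :: nat \<Rightarrow> real^'n^'m).
           I \<ge> 1 \<and> (\<forall>i\<in>{1..I}. l i > 0) \<and> (\<Sum>i=1..I. l i) = 1 \<and>
           H_cond (interior K) I l x \<and>
           \<xi> = (\<Sum>i=1..I. l i *\<^sub>R x i) \<and>
           (\<Sum>i\<in>{i\<in>{1..I}. x i \<notin> E\<delta> \<delta>}. l i) < \<delta>"
  shows "relaxation_property (interior K) E"
  unfolding relaxation_property_def
proof (intro allI impI)
  fix \<Omega> :: "(real^'n) set" and \<xi> :: "real^'n^'m" and b :: "real^'m"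
  assume "open \<Omega> \<and> bounded \<Omega> \<and> \<xi> \<in> interior K"
  then have \<Omega>: "open \<Omega>" "bounded \<Omega>" and \<xi>: "\<xi> \<in> interior K" by auto
  let ?M = "lebesgue_on \<Omega>" and ?m = "measure lebesgue"
  have lm: "\<Omega> \<in> lmeasurable" using \<Omega> by (simp add: lmeasurable_open)
  have \<Omega>': "\<Omega> \<inter> space lebesgue \<in> sets lebesgue" using \<Omega>(1) by simp
  \<comment> \<open>One null sequence controls the sup norm, the lost volume fraction and the
    distance from E.\<close>
  define s where "s \<nu> = inverse (real (Suc \<nu>))" for \<nu>
  have s: "s \<nu> > 0" for \<nu> by (simp add: s_def)
  have s0: "s \<longlonglongrightarrow> 0" unfolding s_def by (rule LIMSEQ_inverse_real_of_nat)
  define P where "P \<nu> w L \<longleftrightarrow> L-lipschitz_on UNIV w \<and> (\<forall>x. x \<notin> \<Omega> \<longrightarrow> w x = 0) \<and> (\<forall>x. norm (w x) \<le> s \<nu>) \<and>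
     negligible {x\<in>\<Omega>. \<nexists>M. loc_affine w x M \<and> \<xi> + M \<in> interior K} \<and>
     (1 - s \<nu>) * ?m \<Omega> \<le> ?m {x\<in>\<Omega>. \<exists>M. loc_affine w x M \<and> dist_set (\<xi> + M) E < ennreal (s \<nu>)}" for \<nu> w L
  have "\<exists>w L. P \<nu> w L" for \<nu>
    unfolding P_def by (rule approximating_perturbation[OF assms(3-5) \<xi> \<Omega> s])
  then obtain w L where P: "\<And>\<nu>. P \<nu> (w \<nu>) (L \<nu>)" by metis
  have w: "(L \<nu>)-lipschitz_on UNIV (w \<nu>)" "x \<notin> \<Omega> \<Longrightarrow> w \<nu> x = 0"
     "norm (w \<nu> x) \<le> s \<nu>" "negligible {x\<in>\<Omega>. \<nexists>M. loc_affine (w \<nu>) x M \<and> \<xi> + M \<in> interior K}"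
     "(1 - s \<nu>) * ?m \<Omega> \<le> ?m {x\<in>\<Omega>. \<exists>M. loc_affine (w \<nu>) x M \<and> dist_set (\<xi> + M) E < ennreal (s \<nu>)}" for \<nu> x
    using P[of \<nu>] unfolding P_def by blast+
  have w_aff: "negligible {x\<in>\<Omega>. \<nexists>M. loc_affine (w \<nu>) x M}" for \<nu> by (rule negligible_subset[OF w(4)]) blast
  define v where "v x = \<xi> *v x + b" for x
  define u where "u \<nu> x = v x + w \<nu> x" for \<nu> x
  have v_loc: "loc_affine v x \<xi>" for x unfolding v_def by (rule loc_affine_affine)
  obtain Lv where v_lip: "Lv-lipschitz_on UNIV v"
  proof -
    have "norm (\<xi> *v x) \<le> onorm ((*v) \<xi>) * norm x" for x by (rule onorm[OF matrix_vector_mul_bounded_linear])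
    then have "norm (\<xi> *v x - \<xi> *v y) \<le> onorm ((*v) \<xi>) * norm (x - y)" for x y
      by (metis matrix_vector_mult_diff_distrib)
    then have "(onorm ((*v) \<xi>))-lipschitz_on UNIV v"
      by (intro lipschitz_onI onorm_pos_le[OF matrix_vector_mul_bounded_linear]) (simp add: v_def dist_norm)
    then show ?thesis by (rule that)
  qed
  have u_lip: "(Lv + L \<nu>)-lipschitz_on UNIV (u \<nu>)" for \<nu>
    unfolding u_def by (rule lipschitz_on_add[OF v_lip w(1)])
  have u_loc: "loc_affine (u \<nu>) x (\<xi> + M)" if "loc_affine (w \<nu>) x M" for \<nu> x M
    unfolding u_def by (rule loc_affine_add[OF v_loc that])
  have u_aff: "negligible {x\<in>\<Omega>. \<nexists>M. loc_affine (u \<nu>) x M}" for \<nu>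
    by (rule negligible_subset[OF w_aff[of \<nu>]]) (use u_loc in blast)
  have v_aff: "negligible {x\<in>\<Omega>. \<nexists>M. loc_affine v x M}"
    by (rule negligible_subset[OF negligible_empty]) (use v_loc in blast)
  have AE: "AE x in ?M. \<exists>M. loc_affine (w \<nu>) x M \<and> \<xi> + M \<in> interior K" for \<nu>
  proof -
    have "AE x in lebesgue. x \<notin> {x\<in>\<Omega>. \<nexists>M. loc_affine (w \<nu>) x M \<and> \<xi> + M \<in> interior K}"
      using w(4)[of \<nu>] unfolding negligible_iff_null_sets by (rule AE_not_in)
    then show ?thesis unfolding AE_restrict_space_iff[OF \<Omega>'] by eventually_elim blast
  qed
  \<comment> \<open>The Lipschitz constants of the w may grow with \<nu>; the uniform gradient bound
    is that of K, in whose interior the total gradients lie.\<close>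
  obtain BK where BK: "\<forall>M\<in>K. norm M \<le> BK" using \<open>bounded K\<close> unfolding bounded_iff ..
  have gradu: "AE x in ?M. grad (u \<nu>) x = \<xi> + grad (w \<nu>) x \<and> norm (grad (w \<nu>) x) \<le> BK + norm \<xi>" for \<nu>
    using AE[of \<nu>]
  proof eventually_elim
    case (elim x)
    then obtain M where M: "loc_affine (w \<nu>) x M" "\<xi> + M \<in> interior K" by blast
    have "norm (\<xi> + M) \<le> BK" using M(2) BK interior_subset by blast
    then have "norm M \<le> BK + norm \<xi>" using norm_diff_ineq[of M \<xi>] by (simp add: add.commute)
    then show ?case unfolding grad_eq[OF M(1)] grad_eq[OF u_loc[OF M(1)]] by simp
  qed
  have gu_L: "grad (u \<nu>) \<in> L_inf \<Omega>" for \<nu> by (rule L_inf_bounded[OF grad_borel grad_norm_bound[OF u_lip]])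
  have gv_L: "grad v \<in> L_inf \<Omega>" by (rule L_inf_bounded[OF grad_borel grad_norm_bound[OF v_lip]])
  have wg_u: "has_weak_gradient \<Omega> (u \<nu>) (grad (u \<nu>))" for \<nu> by (rule has_weak_gradient_grad[OF u_lip \<Omega>(1) u_aff])
  have wg_v: "has_weak_gradient \<Omega> v (grad v)" by (rule has_weak_gradient_grad[OF v_lip \<Omega>(1) v_aff])
  have 1: "u \<nu> \<in> Aff_piec \<Omega>" for \<nu> by (rule Aff_piec_lipschitz(2)[OF u_lip \<Omega> u_aff])
  have 2: "(\<lambda>x. u \<nu> x - (\<xi> *v x + b)) \<in> W1_inf_0 \<Omega>" for \<nu>
  proof -
    have "(\<lambda>x. u \<nu> x - (\<xi> *v x + b)) = w \<nu>" by (simp add: u_def v_def)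
    then show ?thesis
      using Aff_piec_lipschitz(1)[OF w(1) \<Omega> w_aff] W11_0_lipschitz[OF w(1) \<Omega> w(2) w_aff]
      unfolding W1_inf_0_def by simp
  qed
  have 3: "AE x in ?M. grad (u \<nu>) x \<in> E \<union> interior K" for \<nu>
    using AE[of \<nu>]
  proof eventually_elim
    case (elim x)
    then obtain M where M: "loc_affine (w \<nu>) x M" "\<xi> + M \<in> interior K" by blast
    then show ?case unfolding grad_eq[OF u_loc[OF M(1)]] by blast
  qed
  have 4: "weak_star_W1_inf \<Omega> u v"
  proof -
    have "u \<nu> \<in> L_inf \<Omega>" "v \<in> L_inf \<Omega>" for \<nu>
      using Aff_piec_lipschitz(1)[OF u_lip \<Omega> u_aff] Aff_piec_lipschitz(1)[OF v_lip \<Omega> v_aff] unfolding W1_inf_def by blast+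
    then have "weak_star_L_inf \<Omega> u v"
      by (rule weak_star_L_inf_uniform[OF _ _ s0]) (simp add: u_def w(3))
    moreover have "weak_star_L_inf \<Omega> (\<lambda>\<nu>. grad (u \<nu>)) (grad v)"
      by (rule weak_star_gradients[OF \<Omega> w(1,2) w_aff s0 w(3) gradu gu_L gv_L grad_eq[OF v_loc]])
    ultimately show ?thesis unfolding weak_star_W1_inf_def
      by (intro conjI exI[of _ "\<lambda>\<nu>. grad (u \<nu>)"] exI[of _ "grad v"] allI wg_u wg_v)
  qed
  have 5: "(\<lambda>\<nu>. \<integral>\<^sup>+x. dist_set (grad (u \<nu>) x) E \<partial>?M) \<longlonglongrightarrow> 0"
  proof (cases "E = {}")
    case True
    \<comment> \<open>With E empty all distances are infinite, so the set of good points is empty.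
      For \<nu> = 1 it has to fill at least half of \<Omega>, which makes \<Omega> null and
      therefore, being open, empty.\<close>
    then have "{x\<in>\<Omega>. \<exists>M. loc_affine (w 1) x M \<and> dist_set (\<xi> + M) E < ennreal (s 1)} = {}"
      by (simp add: dist_set_def)
    from w(5)[of 1, unfolded this] have "?m \<Omega> \<le> 0" by (simp add: s_def)
    then have "?m \<Omega> = 0" using measure_nonneg[of lebesgue \<Omega>] by linarith
    then have "negligible \<Omega>" using lm by (simp add: negligible_iff_measure)
    then have "\<Omega> = {}" using open_not_negligible[OF \<Omega>(1)] by blast
    then show ?thesis by (simp add: nn_integral_empty)
  next
    case False
    then obtain y0 where y0: "y0 \<in> E" by blast
    \<comment> \<open>A bound for the distance from E of any matrix in K, through one point of E;
      the maximum with 0 lets products and sums pass through \<open>ennreal\<close>.\<close>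
    define B where "B = max (BK + norm y0) 0"
    have "(\<integral>\<^sup>+x. dist_set (grad (u \<nu>) x) E \<partial>?M) \<le> ennreal (s \<nu> * ((1 + B) * ?m \<Omega>))" for \<nu>
    proof -
      \<comment> \<open>On \<open>?S\<close> the distance is at most \<open>s \<nu>\<close>; the
        rest has at most the fraction \<open>s \<nu>\<close> of the measure of \<Omega>, and there
        the distance is at most B.\<close>
      let ?S = "{x\<in>\<Omega>. \<exists>M. loc_affine (w \<nu>) x M \<and> dist_set (\<xi> + M) E < ennreal (s \<nu>)}"
      have opS: "open ?S"
        using open_loc_affine_in[OF \<Omega>(1), of "{M. dist_set (\<xi> + M) E < ennreal (s \<nu>)}" "w \<nu>"]
        by (simp add: Bex_def conj_commute)
      have lmS: "?S \<in> lmeasurable" by (rule lmeasurable_open[OF bounded_subset[OF \<Omega>(2)] opS]) blast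
      have "(\<integral>\<^sup>+x. dist_set (grad (u \<nu>) x) E \<partial>?M) \<le> (\<integral>\<^sup>+x. ennreal (s \<nu>) + ennreal B * indicator (\<Omega> - ?S) x \<partial>?M)"
      proof (rule nn_integral_mono_AE)
        have "AE x in ?M. x \<in> \<Omega>" by (rule AE_I2) simp
        with AE[of \<nu>] show "AE x in ?M. dist_set (grad (u \<nu>) x) E \<le> ennreal (s \<nu>) + ennreal B * indicator (\<Omega> - ?S) x"
        proof eventually_elim
          case (elim x)
          then obtain M where M: "loc_affine (w \<nu>) x M" "\<xi> + M \<in> interior K" by blast
          have g: "grad (u \<nu>) x = \<xi> + M" by (rule grad_eq[OF u_loc[OF M(1)]])
          show ?case
          proof (cases "x \<in> ?S")
            case True
            then obtain N where N: "loc_affine (w \<nu>) x N" "dist_set (\<xi> + N) E < ennreal (s \<nu>)" by blast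
            have "dist_set (\<xi> + M) E \<le> ennreal (s \<nu>)" using N(2) loc_affine_unique[OF N(1) M(1)] by simp
            then show ?thesis unfolding g by (rule order_trans) simp
          next
            case False
            have "norm (\<xi> + M) \<le> BK" using M(2) BK interior_subset by blast
            then have "dist (\<xi> + M) y0 \<le> B" unfolding B_def dist_norm using norm_triangle_ineq4[of "\<xi> + M" y0] by linarith
            moreover have "dist_set (\<xi> + M) E \<le> ennreal (dist (\<xi> + M) y0)"
              unfolding dist_set_def by (rule INF_lower[OF y0])
            ultimately have "dist_set (\<xi> + M) E \<le> ennreal B" by (meson ennreal_leI order_trans)
            moreover have "indicator (\<Omega> - ?S) x = (1::ennreal)" using False elim(2) by simp
            ultimately show ?thesis unfolding g by (simp add: add_increasing)
          qed
        qed
      qed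
      also have "\<dots> = (\<integral>\<^sup>+x. ennreal (s \<nu>) \<partial>?M) + (\<integral>\<^sup>+x. ennreal B * indicator (\<Omega> - ?S) x \<partial>?M)"
      proof (rule nn_integral_add)
        show "(\<lambda>x. ennreal B * indicator (\<Omega> - ?S) x) \<in> borel_measurable ?M"
        proof (rule borel_measurable_lebesgue_on)
          have "(\<lambda>x. ennreal B * indicator T x) \<in> borel_measurable borel"
            if [measurable]: "T \<in> sets borel" for T :: "(real^'n) set" by measurable
          then show "(\<lambda>x. ennreal B * indicator (\<Omega> - ?S) x) \<in> borel_measurable borel"
            using sets.Diff[OF borel_open[OF \<Omega>(1)] borel_open[OF opS]] by blast
        qed
      qed simp
      also have "(\<integral>\<^sup>+x. ennreal (s \<nu>) \<partial>?M) = ennreal (s \<nu> * ?m \<Omega>)"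
      proof -
        have "emeasure ?M \<Omega> = ennreal (?m \<Omega>)"
          using lm \<Omega>' by (simp add: emeasure_restrict_space emeasure_eq_measure2)
        then show ?thesis using s[of \<nu>] by (simp add: ennreal_mult)
      qed
      also have "(\<integral>\<^sup>+x. ennreal B * indicator (\<Omega> - ?S) x \<partial>?M) = ennreal (B * (?m \<Omega> - ?m ?S))"
      proof -
        have lmD: "\<Omega> - ?S \<in> lmeasurable" using fmeasurable.Diff[OF lm lmS] .
        have sets: "\<Omega> - ?S \<in> sets ?M"
          using lmD \<Omega>' by (simp add: sets_restrict_space_iff fmeasurableD)
        have "?m (\<Omega> - ?S) = ?m \<Omega> - ?m ?S" by (rule measurable_measure_Diff[OF lm fmeasurableD[OF lmS]]) blast
        moreover have "emeasure ?M (\<Omega> - ?S) = ennreal (?m (\<Omega> - ?S))"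
          using lmD \<Omega>' by (simp add: emeasure_restrict_space emeasure_eq_measure2)
        ultimately show ?thesis
          using nn_integral_cmult_indicator[OF sets, of "ennreal B"] measure_nonneg[of lebesgue "\<Omega> - ?S"]
          by (simp add: ennreal_mult B_def)
      qed
      also have "ennreal (s \<nu> * ?m \<Omega>) + ennreal (B * (?m \<Omega> - ?m ?S)) \<le> ennreal (s \<nu> * ?m \<Omega>) + ennreal (B * (s \<nu> * ?m \<Omega>))"
      proof (intro add_left_mono ennreal_leI mult_left_mono)
        show "?m \<Omega> - ?m ?S \<le> s \<nu> * ?m \<Omega>" using w(5)[of \<nu>] by (simp add: left_diff_distrib)
      qed (simp add: B_def)
      also have "\<dots> = ennreal (s \<nu> * ((1 + B) * ?m \<Omega>))"
        using s[of \<nu>] by (simp add: B_def algebra_simps flip: ennreal_plus)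
      finally show ?thesis .
    qed
    note bound = this
    have "(\<lambda>\<nu>. s \<nu> * ((1 + B) * ?m \<Omega>)) \<longlonglongrightarrow> 0 * ((1 + B) * ?m \<Omega>)" by (intro tendsto_mult s0 tendsto_const)
    then have "(\<lambda>\<nu>. ennreal (s \<nu> * ((1 + B) * ?m \<Omega>))) \<longlonglongrightarrow> ennreal 0" by (intro tendsto_ennrealI) simp
    then have up: "(\<lambda>\<nu>. ennreal (s \<nu> * ((1 + B) * ?m \<Omega>))) \<longlonglongrightarrow> 0" by simp
    show ?thesis
      by (rule tendsto_sandwich[OF _ _ tendsto_const up]) (use bound in auto)
  qed
  show "\<exists>(u :: nat \<Rightarrow> real^'n \<Rightarrow> real^'m) Du.
          (\<forall>\<nu>. u \<nu> \<in> Aff_piec \<Omega> \<and>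
               (\<lambda>x. u \<nu> x - (\<xi> *v x + b)) \<in> W1_inf_0 \<Omega> \<and>
               has_weak_gradient \<Omega> (u \<nu>) (Du \<nu>) \<and>
               (AE x in lebesgue_on \<Omega>. Du \<nu> x \<in> E \<union> interior K)) \<and>
          weak_star_W1_inf \<Omega> u (\<lambda>x. \<xi> *v x + b) \<and>
          (\<lambda>\<nu>. \<integral>\<^sup>+x. dist_set (Du \<nu> x) E \<partial>lebesgue_on \<Omega>) \<longlonglongrightarrow> 0"
  proof (intro exI[of _ u] exI[of _ "\<lambda>\<nu>. grad (u \<nu>)"] conjI allI)
    have "v = (\<lambda>x. \<xi> *v x + b)" by (rule ext) (rule v_def)
    then show "weak_star_W1_inf \<Omega> u (\<lambda>x. \<xi> *v x + b)" using 4 by simp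
  qed (rule 1 2 wg_u 3 5)+
qed

end
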